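(* Let $m\ge2$ be an integer, $\alpha\in[0,1)$, $u=\frac{\alpha}{1-\alpha}$, $\psi=\frac1{1+2u}$ and $a=m+2mu$. Let $(G_n)$ be any of the three versions (independent, conditional, sequential) of the preferential attachment graph with parameters $m,\alpha$. Let $v_0$ be a uniformly chosen vertex in $G_n$, let $D$ be the degree of $v_0$, and let $D'$ be the degree of a vertex chosen uniformly at random from the $m$ vertices which received an edge from $v_0$. Then, as $n\to\infty$, the joint distribution of $D$ and $D'$ converges to the distribution given, for $j,k=0,1,2,\ldots$, by $$\mathbf P(D'=m+1+k,\,D=m+j)=\frac{\psi+1}{\psi^2}\,\frac{\Gamma(k+a+1)}{k!\,\Gamma(a+1)}\,\frac{\Gamma(j+a)}{j!\,\Gamma(a)}\int_0^1 dv\,(1-v)^k v^{a+1/\psi}\int_v^1 dw\,(1-w)^j w^a .$$ For this limiting distribution, as $k\to\infty$ while $j$ is fixed, $$\mathbf P(D'=m+1+k\mid D=m+j)=C_j\,k^{-1-1/\psi}\Bigl(1+O\bigl(\tfrac1k\bigr)\Bigr),$$ where $C_j$ is a constant depending on $j$, $m$ and $\alpha$, while for $k$ fixed and $j\to\infty$, $$\mathbf P(D=m+j\mid D'=m+1+k)=\tilde C_k\,j^{-a-3-1/\psi}\Bigl(1+O\bigl(\tfrac1j\bigr)\Bigr),$$ where $\tilde C_k$ is a constant depending on $k$, $m$ and $\alpha$.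
   Context: In the formulas, $\Gamma(\cdot)$ is Euler's Gamma function. Degrees count edge multiplicities. Preferential attachment graphs. $G_1$ is a single vertex $1$ with no edges; $G_2$ has vertices $1,2$ joined by $m$ edges. Given $G_{n-1}$ on $\{1,\ldots,n-1\}$, $G_n$ is obtained by adding the vertex $n$ and $m$ edges from $n$ to $w_1,\ldots,w_m\in\{1,\ldots,n-1\}$ (repetitions give multiple edges); $w_1,\ldots,w_m$ are the vertices which received an edge from $n$. Let $\deg_{n-1}(k)$ be the degree of $k$ in $G_{n-1}$. The choice of the $w_i$ is as follows. (1) Independent model: given $G_{n-1}$, the $w_i$ are i.i.d.; with probability $\alpha$, $w_i$ is uniform on $\{1,\ldots,n-1\}$, and with probability $1-\alpha$, $\mathbf P(w_i=k)=\deg_{n-1}(k)/Z$ with $Z=\sum_{k=1}^{n-1}\deg_{n-1}(k)=2m(n-2)$. (2) Conditional model: start from some predetermined graph structure on the first $m$ vertices (instead of $G_1,G_2$); for later vertices, $w_1,\ldots,w_m$ are chosen as in the independent rule ($Z$ being the sum of the degrees in $G_{n-1}$), conditioned on being pairwise distinct. (In particular vertex $m+1$ is joined to each of $1,\ldots,m$.) (3) Sequential model: the $w_i$ are chosen successively; given $G_{n-1}$ and $w_1,\ldots,w_{i-1}$, with probability $\tilde\alpha=\alpha\frac{2m(n-1)}{2m(n-2)+2m\alpha+(1-\alpha)(i-1)}$, $w_i$ is uniform on $\{1,\ldots,n-1\}$, and with probability $1-\tilde\alpha$, $\mathbf P(w_i=k)=\deg'_{n-1}(k)/Z'$, where $\deg'_{n-1}(k)=\deg_{n-1}(k)+\#\{1\le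 j\le i-1:w_j=k\}$ and $Z'=2m(n-2)+i-1$. The finitely many initial vertices of $G_n$ that do not send out $m$ edges (for which $D'$ is not defined) are chosen as $v_0$ with probability tending to $0$ and play no role in the limit; $D'$ may be assigned any value there. *)

theory Defs
  imports "HOL-Probability.Probability" "HOL-Library.Landau_Symbols"
begin

text \<open>
  A multigraph is the multiset of its edges; an edge \<^term>\<open>(x, y)\<close> joins \<^term>\<open>x\<close> and \<^term>\<open>y\<close>,
  and for an edge created by the attachment process \<^term>\<open>x\<close> is the new vertex that sends it and
  \<^term>\<open>y\<close> the old vertex that receives it. Degrees ignore this orientation.
\<close>

type_synonym mgraph = "(nat \<times> nat) multiset"

definition endpoints :: "mgraph \<Rightarrow> nat multiset" where
  "endpoints G = image_mset fst G + image_mset snd G"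

definition deg :: "mgraph \<Rightarrow> nat \<Rightarrow> nat" where
  "deg G k = count (endpoints G) k"

definition receivers :: "mgraph \<Rightarrow> nat \<Rightarrow> nat multiset" where
  "receivers G v = image_mset snd (filter_mset (\<lambda>e. fst e = v) G)"

definition attach :: "nat \<Rightarrow> nat list \<Rightarrow> mgraph \<Rightarrow> mgraph" where
  "attach n ws G = G + image_mset (Pair n) (mset ws)"

text \<open>
  With probability \<^term>\<open>p\<close> a uniform vertex of \<open>{1, \<dots>, n-1}\<close>, and with probability \<open>1 - p\<close> the
  vertex \<open>k\<close> with probability \<open>count M k / size M\<close>. For \<open>M = endpoints G\<close> this is \<open>deg G k / Z\<close>,
  where \<open>Z\<close> is the sum of all degrees. If \<open>Z = 0\<close>, which can only occur for vertex \<open>m + 1\<close> in the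
  conditional model with an edgeless initial graph, the second choice is uniform as well.
\<close>

definition choose_vertex :: "real \<Rightarrow> nat \<Rightarrow> nat multiset \<Rightarrow> nat pmf" where
  "choose_vertex p n M =
     bernoulli_pmf p \<bind> (\<lambda>b. if b \<or> M = {#} then pmf_of_set {1..<n} else pmf_of_multiset M)"

definition independent_choice :: "nat \<Rightarrow> real \<Rightarrow> nat \<Rightarrow> mgraph \<Rightarrow> nat list pmf" where
  "independent_choice m \<alpha> n G = replicate_pmf m (choose_vertex \<alpha> n (endpoints G))"

text \<open>
  The second branch only concerns vertex \<open>m + 1\<close> when \<open>\<alpha> = 0\<close> and the initial graph has an isolated
  vertex: the conditioning event is then null, but distinctness still forces \<open>m + 1\<close> to be joined
  to each of \<open>1, \<dots>, m\<close>.
\<close>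

definition conditional_choice :: "nat \<Rightarrow> real \<Rightarrow> nat \<Rightarrow> mgraph \<Rightarrow> nat list pmf" where
  "conditional_choice m \<alpha> n G =
     (if set_pmf (independent_choice m \<alpha> n G) \<inter> {ws. distinct ws} \<noteq> {}
      then cond_pmf (independent_choice m \<alpha> n G) {ws. distinct ws}
      else pmf_of_set {ws. length ws = m \<and> distinct ws \<and> set ws \<subseteq> {1..<n}})"

definition alpha_tilde :: "nat \<Rightarrow> real \<Rightarrow> nat \<Rightarrow> nat \<Rightarrow> real" where
  "alpha_tilde m \<alpha> n i =
     \<alpha> * (2 * real m * (real n - 1)) /
       (2 * real m * (real n - 2) + 2 * real m * \<alpha> + (1 - \<alpha>) * (real i - 1))"

text \<open>\<open>sequential_choice m \<alpha> n G i\<close> is the law of \<open>[w\<^sub>1, \<dots>, w\<^sub>i]\<close>.\<close>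

primrec sequential_choice :: "nat \<Rightarrow> real \<Rightarrow> nat \<Rightarrow> mgraph \<Rightarrow> nat \<Rightarrow> nat list pmf" where
  "sequential_choice m \<alpha> n G 0 = return_pmf []"
| "sequential_choice m \<alpha> n G (Suc i) =
     sequential_choice m \<alpha> n G i \<bind> (\<lambda>ws.
       choose_vertex (alpha_tilde m \<alpha> n (Suc i)) n (endpoints G + mset ws) \<bind> (\<lambda>w.
         return_pmf (ws @ [w])))"

text \<open>
  \<open>grow choice init s n\<close> is the law of \<open>G\<^sub>n\<close>, where \<open>G\<^sub>n = init n\<close> for \<open>n \<le> s\<close> and every
  later vertex sends edges according to \<open>choice\<close>.
\<close>

primrec grow :: "(nat \<Rightarrow> mgraph \<Rightarrow> nat list pmf) \<Rightarrow> (nat \<Rightarrow> mgraph) \<Rightarrow> nat \<Rightarrow> nat \<Rightarrow> mgraph pmf" where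
  "grow choice init s 0 = return_pmf (init 0)"
| "grow choice init s (Suc n) =
     (if Suc n \<le> s then return_pmf (init (Suc n))
      else grow choice init s n \<bind> (\<lambda>G.
             choice (Suc n) G \<bind> (\<lambda>ws. return_pmf (attach (Suc n) ws G))))"

definition first_graphs :: "nat \<Rightarrow> nat \<Rightarrow> mgraph" where
  "first_graphs m n = (if n = 2 then replicate_mset m (2, 1) else {#})"

text \<open>The argument of \<open>Conditional\<close> is the predetermined multigraph on the first \<open>m\<close> vertices.\<close>

datatype version = Independent | Conditional mgraph | Sequential

fun valid_version :: "nat \<Rightarrow> version \<Rightarrow> bool" where
  "valid_version m (Conditional H) \<longleftrightarrow> set_mset H \<subseteq> {1..m} \<times> {1..m}"
| "valid_version m _ \<longleftrightarrow> True"

fun pa_graph :: "nat \<Rightarrow> real \<Rightarrow> version \<Rightarrow> nat \<Rightarrow> mgraph pmf" where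
  "pa_graph m \<alpha> Independent n = grow (independent_choice m \<alpha>) (first_graphs m) 2 n"
| "pa_graph m \<alpha> (Conditional H) n = grow (conditional_choice m \<alpha>) (\<lambda>_. H) m n"
| "pa_graph m \<alpha> Sequential n = grow (\<lambda>k G. sequential_choice m \<alpha> k G m) (first_graphs m) 2 n"

text \<open>
  The joint law of \<open>(D, D')\<close>. The receiver is picked among \<open>w\<^sub>1, \<dots>, w\<^sub>m\<close> with multiplicity.
  For an initial vertex of the conditional model, \<open>D'\<close> depends on the arbitrary orientation
  of the initial edges, and \<open>D' = 0\<close> if a vertex sends no edge.
\<close>

definition degree_pair :: "nat \<Rightarrow> real \<Rightarrow> version \<Rightarrow> nat \<Rightarrow> (nat \<times> nat) pmf" where
  "degree_pair m \<alpha> V n =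
     pa_graph m \<alpha> V n \<bind> (\<lambda>G.
       pmf_of_set {1..n} \<bind> (\<lambda>v0.
         (if receivers G v0 = {#} then return_pmf 0
          else map_pmf (deg G) (pmf_of_multiset (receivers G v0))) \<bind> (\<lambda>d'.
           return_pmf (deg G v0, d'))))"

definition converges_in_distribution ::
    "(nat \<Rightarrow> 'a::topological_space pmf) \<Rightarrow> 'a pmf \<Rightarrow> bool" where
  "converges_in_distribution M L \<longleftrightarrow>
     (\<forall>f :: 'a \<Rightarrow> real. continuous_on UNIV f \<longrightarrow> bounded (range f) \<longrightarrow>
        (\<lambda>n. measure_pmf.expectation (M n) f) \<longlonglongrightarrow> measure_pmf.expectation L f)"

end

theory Submission
  imports Defs "HOL-Real_Asymp.Real_Asymp"
begin

text \<open>
  Why the degree pairs converge. A vertex of degree \<open>d\<close> in the graph on \<open>n\<close> vertices receives an edge in the next step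
  with probability about \<open>rate d / n\<close>, where \<open>rate\<close> is affine in \<open>d\<close>. The pair \<open>(D, D')\<close> is, up to the few initial
  vertices, the pair of degrees of the endpoints of a uniformly chosen edge, so it is enough to follow the
  expected numbers of vertices of degree \<open>d\<close> and of edges from a vertex of degree \<open>d\<close> to one of degree \<open>d'\<close>. Linearity
  of expectation gives recurrences for both (\<open>vertex_count_step\<close>, \<open>edge_count_step\<close>), with errors that are small because
  only vertices of bounded degree enter. A recurrence \<open>a (n + 1) = (1 - x / n) a n + b n\<close> with \<open>b n\<close> convergent forces
  \<open>a n / n\<close> to converge (\<open>rate_equation_limit\<close>). By induction on the degrees all densities converge to the solution of a
  stationary system (\<open>vertex_limit\<close>, \<open>edge_limit\<close>).

  The stated formula solves this system: two integrations by parts in the double integral give exactly the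
  stationary equation for edges (\<open>double_beta_recurrence\<close>, \<open>edge_density_rate_equation\<close>). Summing two generalised binomial
  series under the integral shows that the limit has total mass \<open>1\<close> (\<open>joint_sums\<close>), so pointwise convergence
  of the probabilities implies convergence in distribution (\<open>converges_in_distribution_if_pmf\<close>).

  The versions of the model differ in the verification of the attachment rate. For the independent and the
  sequential model the probability of a vertex of bounded degree is \<open>rate d / (m n)\<close> up to order \<open>1 / n\<^sup>2\<close>, apart from edges it
  has received in the same step. In the conditional model, conditioning on distinct receivers has a negligible
  effect if two independent receivers rarely coincide, that is, if the sum of the squared degrees is of smaller order than
  \<open>n\<^sup>2\<close>. This needs an estimate for vertices of all degrees. Degrees are at most \<open>n\<close> plus a constant there, so no vertex
  is drawn with probability much above \<open>1 / (2 m)\<close>; conditioning then increases the mean number of edges a vertex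
  receives by a factor \<open>g < 2\<close> at most (\<open>cond_mean_le\<close>), and the sum of the squared degrees grows at most like a power of \<open>n\<close>
  with exponent less than \<open>2\<close> (\<open>squares_step\<close>, \<open>squares_subquadratic\<close>).

  The tails of the limit follow by comparing the double integral with a single beta integral, whose product with
  the binomial coefficient in front is a quotient of two values of \<open>Gamma\<close> (\<open>negbin_beta_power_law\<close>).
\<close>

section \<open>Recurrences and power laws\<close>
text \<open>
  Fix a level \<open>\<epsilon> / 2\<close>. As soon as \<open>e n < c \<epsilon> / 2\<close>, the part of \<open>z n\<close> above this level is multiplied by at most
  \<open>1 - c / (n + 1)\<close> in each step, and a product of such factors is at most \<open>exp\<close> of \<open>- c\<close> times a harmonic
  sum, which tends to \<open>0\<close>.
\<close>

lemma contracting_recurrence_tendsto_0: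
  fixes z e :: "nat \<Rightarrow> real"
  assumes c: "c > 0"
    and nonneg: "\<And>n. 0 \<le> z n"
    and step: "\<forall>\<^sub>F n in sequentially. z (Suc n) \<le> (1 - c / (real n + 1)) * z n + e n / (real n + 1)"
    and e: "e \<longlonglongrightarrow> 0"
  shows "z \<longlonglongrightarrow> 0"
proof (rule LIMSEQ_I)
  fix \<epsilon> :: real assume \<epsilon>: "\<epsilon> > 0"
  have "\<forall>\<^sub>F n in sequentially. e n < c * (\<epsilon> / 2)"
    using order_tendstoD(2)[OF e, of "c * (\<epsilon> / 2)"] c \<epsilon> by simp
  moreover have "\<forall>\<^sub>F n in sequentially. c / (real n + 1) < 1" by real_asymp
  ultimately have "\<forall>\<^sub>F n in sequentially. e n < c * (\<epsilon> / 2) \<and> c / (real n + 1) < 1 \<and>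
      z (Suc n) \<le> (1 - c / (real n + 1)) * z n + e n / (real n + 1)"
    using step by eventually_elim auto
  then obtain N where N: "\<And>n. n \<ge> N \<Longrightarrow> e n < c * (\<epsilon> / 2)" "\<And>n. n \<ge> N \<Longrightarrow> c / (real n + 1) < 1"
      "\<And>n. n \<ge> N \<Longrightarrow> z (Suc n) \<le> (1 - c / (real n + 1)) * z n + e n / (real n + 1)"
    unfolding eventually_sequentially by blast
  define w where "w n = max 0 (z n - \<epsilon> / 2)" for n
  have w_step: "w (Suc n) \<le> (1 - c / (real n + 1)) * w n" if "n \<ge> N" for n
  proof -
    have "z (Suc n) - \<epsilon> / 2 \<le> (1 - c / (real n + 1)) * z n + (c * (\<epsilon> / 2)) / (real n + 1) - \<epsilon> / 2"
      using N(3)[OF that] divide_right_mono[OF less_imp_le[OF N(1)[OF that]], of "real n + 1"] by linarith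
    also have "\<dots> = (1 - c / (real n + 1)) * (z n - \<epsilon> / 2)" by (simp add: algebra_simps)
    also have "\<dots> \<le> (1 - c / (real n + 1)) * w n"
      using N(2)[OF that] by (intro mult_left_mono) (auto simp: w_def)
    finally have "z (Suc n) - \<epsilon> / 2 \<le> (1 - c / (real n + 1)) * w n" .
    moreover have "0 \<le> (1 - c / (real n + 1)) * w n"
      using N(2)[OF that] by (intro mult_nonneg_nonneg) (auto simp: w_def)
    ultimately show ?thesis by (simp add: w_def)
  qed
  have w_bound: "w (N + k) \<le> w N * exp (- c * (harm (N + k) - harm N))" for k
  proof (induction k)
    case (Suc k)
    have "w (N + Suc k) \<le> (1 - c / (real (N + k) + 1)) * w (N + k)" using w_step[of "N + k"] by simp
    also have "\<dots> \<le> exp (- (c / (real (N + k) + 1))) * w (N + k)"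
      using exp_ge_add_one_self[of "- (c / (real (N + k) + 1))"]
      by (intro mult_right_mono) (auto simp: w_def)
    also have "\<dots> \<le> exp (- (c / (real (N + k) + 1))) * (w N * exp (- c * (harm (N + k) - harm N)))"
      by (intro mult_left_mono Suc) auto
    also have "\<dots> = w N * exp (- c * (harm (N + Suc k) - harm N))"
      by (simp add: harm_Suc exp_add[symmetric] algebra_simps divide_inverse)
    finally show ?case .
  qed simp
  have "filterlim (\<lambda>k. harm (N + k) :: real) at_top sequentially"
    by (rule filterlim_compose[OF harm_at_top]) (auto simp: filterlim_sequentially_Suc add.commute intro: filterlim_add_const_nat_at_top)
  hence "filterlim (\<lambda>k. harm (N + k) - harm N :: real) at_top sequentially"
    using filterlim_tendsto_add_at_top[of "\<lambda>k. - harm N" "- harm N" sequentially "\<lambda>k. harm (N + k)"] by simp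
  hence "filterlim (\<lambda>k. c * (harm (N + k) - harm N)) at_top sequentially"
    by (rule filterlim_tendsto_pos_mult_at_top[OF tendsto_const c])
  hence "filterlim (\<lambda>k. - c * (harm (N + k) - harm N)) at_bot sequentially"
    by (simp add: filterlim_uminus_at_bot)
  hence "(\<lambda>k. exp (- c * (harm (N + k) - harm N))) \<longlonglongrightarrow> 0"
    by (rule filterlim_compose[OF exp_at_bot])
  hence "(\<lambda>k. w N * exp (- c * (harm (N + k) - harm N))) \<longlonglongrightarrow> 0"
    using tendsto_mult_right_zero by blast
  hence "\<forall>\<^sub>F k in sequentially. w N * exp (- c * (harm (N + k) - harm N)) < \<epsilon> / 2"
    using \<epsilon> by (intro order_tendstoD(2)) auto
  then obtain k0 where k0: "\<And>k. k \<ge> k0 \<Longrightarrow> w N * exp (- c * (harm (N + k) - harm N)) < \<epsilon> / 2"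
    unfolding eventually_sequentially by blast
  have "norm (z n - 0) < \<epsilon>" if "n \<ge> N + k0" for n
  proof -
    obtain k where k: "n = N + k" "k \<ge> k0" using \<open>n \<ge> N + k0\<close> le_Suc_ex[of "N + k0" n] by auto
    have "w n < \<epsilon> / 2" using w_bound[of k] k0[OF k(2)] k by simp
    then show ?thesis using nonneg[of n] by (auto simp: w_def max_def split: if_splits)
  qed
  then show "\<exists>no. \<forall>n\<ge>no. norm (z n - 0) < \<epsilon>" by blast
qed

text \<open>
  Here \<open>a n\<close> is an expected count that loses the fraction \<open>x / n\<close> in step \<open>n\<close> and gains \<open>b n\<close>. The deviation of
  \<open>a n / n\<close> from \<open>L\<close> is multiplied by \<open>1 - (1 + x) / (n + 1)\<close>, where the additional \<open>1\<close> comes from dividing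
  by \<open>n\<close>, and the value of \<open>L\<close> is the one that makes the remaining inhomogeneity vanish in the limit.
\<close>

lemma rate_equation_limit:
  fixes a b :: "nat \<Rightarrow> real"
  assumes x: "x \<ge> 0"
    and step: "\<forall>\<^sub>F n in sequentially. a (Suc n) = (1 - x / real n) * a n + b n"
    and b: "b \<longlonglongrightarrow> (1 + x) * L"
  shows "(\<lambda>n. a n / real n) \<longlonglongrightarrow> L"
proof -
  define z where "z n = \<bar>a n / real n - L\<bar>" for n
  define e where "e n = \<bar>b n - (1 + x) * L\<bar>" for n
  have "z \<longlonglongrightarrow> 0"
  proof (rule contracting_recurrence_tendsto_0[of "1 + x"])
    show "e \<longlonglongrightarrow> 0"
      unfolding e_def by (rule tendsto_rabs_zero) (rule LIM_zero[OF b])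
    have "\<forall>\<^sub>F n in sequentially. real n > 1 + x" by real_asymp
    with step show "\<forall>\<^sub>F n in sequentially. z (Suc n) \<le> (1 - (1 + x) / (real n + 1)) * z n + e n / (real n + 1)"
    proof eventually_elim
      case (elim n)
      have n: "real n > 0" using elim x by linarith
      have "a (Suc n) / real (Suc n) - L =
          (1 - (1 + x) / (real n + 1)) * (a n / real n - L) + (b n - (1 + x) * L) / (real n + 1)"
        using n unfolding elim(1) by (simp add: divide_simps) (simp add: algebra_simps)
      hence "z (Suc n) \<le> \<bar>(1 - (1 + x) / (real n + 1)) * (a n / real n - L)\<bar> + \<bar>(b n - (1 + x) * L) / (real n + 1)\<bar>"
        unfolding z_def using abs_triangle_ineq by metis
      also have "\<bar>(1 - (1 + x) / (real n + 1)) * (a n / real n - L)\<bar> = (1 - (1 + x) / (real n + 1)) * z n"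
        using elim(2) by (simp add: abs_mult z_def)
      finally show ?case by (simp add: e_def)
    qed
  qed (use x in \<open>auto simp: z_def\<close>)
  hence "(\<lambda>n. a n / real n - L) \<longlonglongrightarrow> 0"
    unfolding z_def by (rule tendsto_rabs_zero_cancel)
  thus ?thesis by (rule LIM_zero_cancel)
qed

text \<open>
  After division by \<open>n\<^sup>2\<close> the growth factor \<open>1 + \<theta> / n\<close> turns into \<open>1 - (2 - \<theta>) / n\<close> up to lower order.
\<close>

lemma subquadratic_growth:
  fixes t :: "nat \<Rightarrow> real"
  assumes nonneg: "\<And>n. 0 \<le> t n" and \<theta>: "0 \<le> \<theta>" "\<theta> < 2"
    and step: "\<forall>\<^sub>F n in sequentially. t (Suc n) \<le> (1 + \<theta> / real n) * t n + C"
  shows "(\<lambda>n. t n / (real n)\<^sup>2) \<longlonglongrightarrow> 0"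
proof (rule contracting_recurrence_tendsto_0[of "min 1 (2 - \<theta>)"])
  show "(\<lambda>n. \<bar>C\<bar> / (real n + 1)) \<longlonglongrightarrow> 0" by real_asymp
  define c where "c = min 1 (2 - \<theta>)"
  have "\<forall>\<^sub>F n in sequentially. n > 0" by real_asymp
  with step show "\<forall>\<^sub>F n in sequentially. t (Suc n) / (real (Suc n))\<^sup>2 \<le>
      (1 - min 1 (2 - \<theta>) / (real n + 1)) * (t n / (real n)\<^sup>2) + \<bar>C\<bar> / (real n + 1) / (real n + 1)"
    unfolding c_def[symmetric]
  proof eventually_elim
    case (elim n)
    have n: "real n > 0" using elim by simp
    have "(1 + \<theta> / real n) * (real n)\<^sup>2 \<le> (1 - c / (real n + 1)) * (real n + 1)\<^sup>2"
    proof -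
      have "c \<le> 1" "c + \<theta> \<le> 2" unfolding c_def by auto
      have "(c + \<theta>) * real n \<le> 2 * real n" using \<open>c + \<theta> \<le> 2\<close> n by (intro mult_right_mono) auto
      moreover have "(1 + \<theta> / real n) * (real n)\<^sup>2 = (real n)\<^sup>2 + \<theta> * real n"
        using n by (simp add: field_simps power2_eq_square)
      moreover have "(1 - c / (real n + 1)) * (real n + 1)\<^sup>2 = (real n)\<^sup>2 + 2 * real n + 1 - c * real n - c"
        using n by (simp add: divide_simps power2_eq_square) (simp add: algebra_simps)
      ultimately show ?thesis using \<open>c \<le> 1\<close> by (simp add: algebra_simps)
    qed
    moreover have cross: "A / P \<le> B / Q" if "A * Q \<le> B * P" "P > 0" "Q > 0" for A B P Q :: real
      using that by (simp add: divide_simps mult.commute)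
    ultimately have *: "(1 + \<theta> / real n) / (real n + 1)\<^sup>2 \<le> (1 - c / (real n + 1)) / (real n)\<^sup>2"
      using n by (intro cross) auto
    have "t (Suc n) / (real n + 1)\<^sup>2 \<le> ((1 + \<theta> / real n) * t n + \<bar>C\<bar>) / (real n + 1)\<^sup>2"
      using elim(1) by (intro divide_right_mono) auto
    also have "\<dots> = (1 + \<theta> / real n) / (real n + 1)\<^sup>2 * t n + \<bar>C\<bar> / (real n + 1)\<^sup>2"
      by (simp only: add_divide_distrib[of "_ * _"] times_divide_eq_left)
    also have "\<dots> \<le> (1 - c / (real n + 1)) / (real n)\<^sup>2 * t n + \<bar>C\<bar> / (real n + 1)\<^sup>2"
      by (intro add_right_mono mult_right_mono * nonneg)
    finally show ?case by (simp add: power2_eq_square add.commute)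
  qed
qed (use nonneg \<theta> in auto)

text \<open>
  Increments of order \<open>1 / k\<^sup>2\<close> have tail sums of order \<open>1 / k\<close>, so \<open>ln (r k)\<close> converges to some \<open>l\<close> with an error of
  this order, and \<open>c = exp l\<close>.
\<close>

lemma power_law_from_log_increments:
  fixes r :: "nat \<Rightarrow> real"
  assumes pos: "\<forall>\<^sub>F k in sequentially. r k > 0"
    and ratio: "(\<lambda>k. ln (r (Suc k)) - ln (r k)) \<in> O(\<lambda>k. 1 / (real k)\<^sup>2)"
  shows "\<exists>c>0. \<exists>\<epsilon>. \<epsilon> \<in> O(\<lambda>k. 1 / real k) \<and> (\<forall>\<^sub>F k in sequentially. r k = c * (1 + \<epsilon> k))"
proof -
  obtain B where B: "B > 0" "\<forall>\<^sub>F k in sequentially. norm (ln (r (Suc k)) - ln (r k)) \<le> B * norm (1 / (real k)\<^sup>2)"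
    using landau_o.bigE[OF ratio] by blast
  have "\<forall>\<^sub>F k in sequentially. k \<ge> 2 \<and> r k > 0 \<and> \<bar>ln (r (Suc k)) - ln (r k)\<bar> \<le> B / (real k)\<^sup>2"
    using eventually_gt_at_top[of 2] pos B(2) by eventually_elim auto
  then obtain N where N: "\<And>k. k \<ge> N \<Longrightarrow> k \<ge> 2" "\<And>k. k \<ge> N \<Longrightarrow> r k > 0"
      "\<And>k. k \<ge> N \<Longrightarrow> \<bar>ln (r (Suc k)) - ln (r k)\<bar> \<le> B / (real k)\<^sup>2"
    unfolding eventually_sequentially by blast
  \<comment> \<open>Since \<open>1 / k\<^sup>2 \<le> 1 / (k - 1) - 1 / k\<close>, adding or subtracting \<open>B / (k - 1)\<close> makes \<open>ln (r k)\<close> monotone.\<close>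
  define lo up where "lo k = ln (r (N + k)) - B / (real (N + k) - 1)"
    and "up k = ln (r (N + k)) + B / (real (N + k) - 1)" for k
  have tele: "B / (real (N + k))\<^sup>2 \<le> B / (real (N + k) - 1) - B / (real (N + Suc k) - 1)" for k
  proof -
    have "real (N + k) \<ge> 2" using N(1)[of "N + k"] by linarith
    hence "B / (real (N + k))\<^sup>2 \<le> B / ((real (N + k) - 1) * real (N + k))"
      using B(1) by (intro divide_left_mono) (auto simp: power2_eq_square intro!: mult_pos_pos mult_right_mono)
    also have "\<dots> = B / (real (N + k) - 1) - B / (real (N + Suc k) - 1)"
      using \<open>real (N + k) \<ge> 2\<close> by (simp add: divide_simps) (simp add: algebra_simps)
    finally show ?thesis .
  qed
  have lo: "incseq lo"
  proof (rule incseq_SucI)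
    fix k show "lo k \<le> lo (Suc k)" using N(3)[of "N + k"] tele[of k] unfolding lo_def by (simp add: abs_le_iff)
  qed
  have up: "decseq up"
  proof (rule decseq_SucI)
    fix k show "up (Suc k) \<le> up k" using N(3)[of "N + k"] tele[of k] unfolding up_def by (simp add: abs_le_iff)
  qed
  have lo_up: "lo i \<le> up j" for i j
  proof -
    have "lo i \<le> lo (max i j)" using lo by (simp add: incseq_def)
    also have "\<dots> \<le> up (max i j)" using B(1) N(1)[of "N + max i j"] by (auto simp: lo_def up_def)
    also have "\<dots> \<le> up j" using up by (simp add: decseq_def)
    finally show ?thesis .
  qed
  define l where "l = (SUP i. lo i)"
  have bdd: "bdd_above (range lo)" using lo_up[of _ 0] by (auto intro!: bdd_aboveI2)
  have l: "lo k \<le> l" "l \<le> up k" for k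
    unfolding l_def using bdd lo_up by (auto intro!: cSUP_upper cSUP_least)
  define \<epsilon> where "\<epsilon> k = exp (ln (r k) - l) - 1" for k
  have bound: "\<bar>ln (r k) - l\<bar> \<le> B / (real k - 1)" if "k \<ge> N" for k
    using l[of "k - N"] that by (auto simp: lo_def up_def abs_le_iff)
  have "\<forall>\<^sub>F k in sequentially. \<bar>\<epsilon> k\<bar> \<le> (4 * B) * (1 / real k)"
  proof -
    have "\<forall>\<^sub>F k in sequentially. B / (real k - 1) \<le> 1" by real_asymp
    moreover have "\<forall>\<^sub>F k in sequentially. 1 / (real k - 1) \<le> 2 * (1 / real k)" by real_asymp
    ultimately show ?thesis using eventually_ge_at_top[of N]
    proof eventually_elim
      case (elim k)
      define y where "y = ln (r k) - l"
      have y: "\<bar>y\<bar> \<le> B / (real k - 1)" using bound elim unfolding y_def by simp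
      have "\<bar>exp y - 1\<bar> \<le> 2 * \<bar>y\<bar>"
      proof (cases "y \<ge> 0")
        case True
        have "exp y \<le> 1 + y + y\<^sup>2" by (rule exp_bound) (use True y elim in auto)
        moreover have "y\<^sup>2 \<le> y" using True y elim mult_left_mono[of y 1 y] by (simp add: power2_eq_square)
        ultimately show ?thesis using True by simp
      next
        case False
        have "1 + y \<le> exp y" "exp y \<le> 1" using False exp_ge_add_one_self[of y] by auto
        then show ?thesis using False by linarith
      qed
      also have "\<dots> \<le> 2 * (B * (1 / (real k - 1)))" using y by simp
      also have "\<dots> \<le> 2 * (B * (2 * (1 / real k)))" using B(1) elim by (intro mult_left_mono) auto
      finally show ?case by (simp add: \<epsilon>_def y_def)
    qed
  qed
  hence "\<epsilon> \<in> O(\<lambda>k. 1 / real k)" by (intro bigoI[of _ "4 * B"]) auto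
  moreover have "\<forall>\<^sub>F k in sequentially. r k = exp l * (1 + \<epsilon> k)"
    using eventually_ge_at_top[of N] by eventually_elim (use N(2) in \<open>auto simp: \<epsilon>_def exp_diff\<close>)
  ultimately show ?thesis by (intro exI[of _ "exp l"]) auto
qed

text \<open>
  The functional equation of \<open>Gamma\<close> turns the increments of the logarithm of the quotient, corrected by
  the power \<open>k powr (y - x)\<close>, into \<open>ln (1 + x / k) - ln (1 + y / k) + (y - x) ln (1 + 1 / k)\<close>, in which the terms of
  order \<open>1 / k\<close> cancel.
\<close>

lemma Gamma_ratio_power_law:
  fixes x y :: real
  assumes "x > 0" "y > 0"
  shows "\<exists>c>0. \<exists>\<epsilon>. \<epsilon> \<in> O(\<lambda>k. 1 / real k) \<and>
     (\<forall>\<^sub>F k in sequentially. Gamma (real k + x) / Gamma (real k + y) = c * real k powr (x - y) * (1 + \<epsilon> k))"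
proof -
  define r where "r k = Gamma (real k + x) / Gamma (real k + y) * real k powr (y - x)" for k
  have "\<exists>c>0. \<exists>\<epsilon>. \<epsilon> \<in> O(\<lambda>k. 1 / real k) \<and> (\<forall>\<^sub>F k in sequentially. r k = c * (1 + \<epsilon> k))"
  proof (rule power_law_from_log_increments)
    show "\<forall>\<^sub>F k in sequentially. r k > 0"
      using eventually_gt_at_top[of 0] by eventually_elim (use assms in \<open>auto simp: r_def intro!: Gamma_real_pos mult_pos_pos divide_pos_pos\<close>)
    have ln_expand: "(\<lambda>k. ln (1 + t / real k) - t / real k) \<in> O(\<lambda>k. 1 / (real k)\<^sup>2)" for t :: real
    proof (rule bigoI[of _ "2 * t\<^sup>2"])
      have "\<forall>\<^sub>F k in sequentially. \<bar>t\<bar> / real k \<le> 1 / 2" by real_asymp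
      then show "\<forall>\<^sub>F k in sequentially. norm (ln (1 + t / real k) - t / real k) \<le> 2 * t\<^sup>2 * norm (1 / (real k)\<^sup>2)"
      proof eventually_elim
        case (elim k)
        show ?case using abs_ln_one_plus_x_minus_x_bound[of "t / real k"] elim by (simp add: power_divide)
      qed
    qed
    have "\<forall>\<^sub>F k in sequentially. ln (r (Suc k)) - ln (r k) =
        (ln (1 + x / real k) - x / real k) - (ln (1 + y / real k) - y / real k)
          + (y - x) * (ln (1 + 1 / real k) - 1 / real k)"
      using eventually_gt_at_top[of 0]
    proof eventually_elim
      case (elim k)
      have G: "Gamma (real k + x) > 0" "Gamma (real k + y) > 0" using assms by (auto intro!: Gamma_real_pos)
      have rec: "Gamma (real (Suc k) + z) = (real k + z) * Gamma (real k + z)" if "z > 0" for z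
        using Gamma_plus1[of "real k + z"] nonpos_Ints_nonpos[of "real k + z"] that by (force simp: add_ac)
      have k1: "1 + t / real k = (real k + t) / real k" for t using elim by (simp add: field_simps)
      define g h where "g = Gamma (real k + x)" and "h = Gamma (real k + y)"
      note G = G[folded g_def h_def]
      have "ln (r (Suc k)) = ln (real k + x) + ln (Gamma (real k + x)) - (ln (real k + y) + ln (Gamma (real k + y)))
          + (y - x) * ln (real k + 1)"
        unfolding r_def rec[OF assms(1)] rec[OF assms(2)] g_def[symmetric] h_def[symmetric] using G assms elim
        by (simp add: ln_mult ln_div ln_powr add.commute)
      moreover have "ln (r k) = ln (Gamma (real k + x)) - ln (Gamma (real k + y)) + (y - x) * ln (real k)"
        unfolding r_def g_def[symmetric] h_def[symmetric] using G assms elim by (simp add: ln_mult ln_div ln_powr)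
      moreover have "ln (1 + t / real k) = ln (real k + t) - ln (real k)" if "t > 0" for t
        unfolding k1 using elim that by (simp add: ln_div)
      moreover have "(y - x) * (1 / real k) = y / real k - x / real k" by (simp add: diff_divide_distrib)
      ultimately show ?case using assms by (simp only: right_diff_distrib)
    qed
    moreover have "(\<lambda>k. (y - x) * (ln (1 + 1 / real k) - 1 / real k)) \<in> O(\<lambda>k. 1 / (real k)\<^sup>2)"
      using ln_expand[of 1] by (cases "y = x") simp_all
    hence "(\<lambda>k. (ln (1 + x / real k) - x / real k) - (ln (1 + y / real k) - y / real k)
          + (y - x) * (ln (1 + 1 / real k) - 1 / real k)) \<in> O(\<lambda>k. 1 / (real k)\<^sup>2)"
      by (rule sum_in_bigo(1)[OF sum_in_bigo(2)[OF ln_expand[of x] ln_expand[of y]]])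
    ultimately show "(\<lambda>k. ln (r (Suc k)) - ln (r k)) \<in> O(\<lambda>k. 1 / (real k)\<^sup>2)"
      by (rule landau_o.big.in_cong[THEN iffD2])
  qed
  then obtain c \<epsilon> where c: "c > 0" "\<epsilon> \<in> O(\<lambda>k. 1 / real k)" "\<forall>\<^sub>F k in sequentially. r k = c * (1 + \<epsilon> k)" by blast
  have "\<forall>\<^sub>F k in sequentially. Gamma (real k + x) / Gamma (real k + y) = c * real k powr (x - y) * (1 + \<epsilon> k)"
    using c(3) eventually_gt_at_top[of 0]
  proof eventually_elim
    case (elim k)
    have "Gamma (real k + x) / Gamma (real k + y) = r k * real k powr (x - y)"
      using elim(2) by (simp add: r_def powr_add[symmetric])
    then show ?case unfolding elim(1) by (simp only: mult_ac)
  qed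
  with c(1,2) show ?thesis by (intro exI[of _ c] exI[of _ \<epsilon>] conjI)
qed

section \<open>Incomplete beta integrals\<close>
text \<open>
  An upper incomplete beta integral; \<open>upper_beta a j 0\<close> is Euler's beta function at \<open>(a + 1, j + 1)\<close>.
\<close>

definition upper_beta :: "real \<Rightarrow> nat \<Rightarrow> real \<Rightarrow> real" where
  "upper_beta a j v = integral {v..1} (\<lambda>w. (1 - w) ^ j * w powr a)"

text \<open>
  With \<open>s = a + 1 / \<psi>\<close> this is the double integral in the formula for the limiting distribution.
\<close>

definition double_beta :: "real \<Rightarrow> real \<Rightarrow> nat \<Rightarrow> nat \<Rightarrow> real" where
  "double_beta s a j k = integral {0..1} (\<lambda>v. (1 - v) ^ k * v powr s * upper_beta a j v)"

text \<open>
  The coefficient of \<open>y ^ k\<close> in \<open>(1 - y) powr (- r)\<close>; multiplied by \<open>(1 - y) powr r * y ^ k\<close> it is a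
  negative binomial probability.
\<close>

definition negbin_coeff :: "real \<Rightarrow> nat \<Rightarrow> real" where
  "negbin_coeff r k = Gamma (real k + r) / (fact k * Gamma r)"

lemma continuous_on_beta_kernel:
  assumes "a > 0" "S \<subseteq> {0..}"
  shows "continuous_on S (\<lambda>w::real. (1 - w) ^ j * w powr a)"
  using assms by (intro continuous_intros continuous_on_powr') auto

lemma beta_kernel_integrable:
  assumes "a > 0" "0 \<le> p"
  shows "(\<lambda>w::real. (1 - w) ^ j * w powr a) integrable_on {p..q}"
  using assms by (intro integrable_continuous_real continuous_on_beta_kernel) auto

lemma upper_beta_at_1 [simp]: "upper_beta a j 1 = 0"
  by (simp add: upper_beta_def)

lemma upper_beta_nonneg: "0 \<le> upper_beta a j v" if "a > 0" "0 \<le> v"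
  unfolding upper_beta_def using that by (intro integral_nonneg beta_kernel_integrable) auto

lemma lower_beta:
  assumes "a > 0" "0 \<le> v" "v \<le> 1"
  shows "integral {0..v} (\<lambda>w. (1 - w) ^ j * w powr a) = upper_beta a j 0 - upper_beta a j v"
  using Henstock_Kurzweil_Integration.integral_combine[of 0 v 1 "\<lambda>w. (1 - w) ^ j * w powr a"] assms
    beta_kernel_integrable[of a 0 j 1]
  by (simp add: upper_beta_def)

lemma upper_beta_has_derivative:
  assumes "a > 0" "0 < v" "v < 1"
  shows "(upper_beta a j has_real_derivative - ((1 - v) ^ j * v powr a)) (at v)"
proof -
  let ?f = "\<lambda>w::real. (1 - w) ^ j * w powr a"
  have "((\<lambda>x. integral {0..x} ?f) has_real_derivative ?f v) (at v within {0..1})"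
    using assms by (intro integral_has_real_derivative continuous_on_beta_kernel) auto
  hence "((\<lambda>x. integral {0..x} ?f) has_real_derivative ?f v) (at v)"
    using assms at_within_Icc_at[of 0 v 1] by simp
  hence D: "((\<lambda>x. upper_beta a j 0 - integral {0..x} ?f) has_real_derivative 0 - ?f v) (at v)"
    by (intro DERIV_diff DERIV_const)
  have "\<forall>\<^sub>F x in nhds v. x \<in> {0<..<1}" using assms by (intro eventually_nhds_in_open) auto
  hence "\<forall>\<^sub>F x in nhds v. upper_beta a j x = upper_beta a j 0 - integral {0..x} ?f"
    by eventually_elim (use lower_beta[OF assms(1)] in auto)
  thus ?thesis using D by (subst DERIV_cong_ev[OF refl _ refl]) auto
qed

lemma continuous_on_upper_beta:
  assumes "a > 0"
  shows "continuous_on {0..1} (upper_beta a j)"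
proof -
  have "continuous_on {0..1} (\<lambda>x. upper_beta a j 0 - integral {0..x} (\<lambda>w. (1 - w) ^ j * w powr a))"
    using assms by (intro continuous_intros indefinite_integral_continuous_1 beta_kernel_integrable) auto
  thus ?thesis by (rule continuous_on_eq) (use lower_beta[OF assms] in auto)
qed

lemma beta_antiderivative:
  assumes "a > 0" "0 < (v::real)"
  shows "((\<lambda>w. (1 - w) ^ j * w powr (a + 1)) has_real_derivative
           (a + 1 + real j) * ((1 - v) ^ j * v powr a) - real j * ((1 - v) ^ (j - 1) * v powr a)) (at v)"
proof -
  have e: "v powr (a + 1) = v * v powr a" using assms by (simp add: powr_add)
  have p: "(1 - v) ^ j = (1 - v) * (1 - v) ^ (j - 1)" if "j > 0"
    using that by (cases j) auto
  have "((\<lambda>w. (1 - w) ^ j * w powr (a + 1)) has_real_derivative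
      (real j * (1 - v) ^ (j - 1) * (0 - 1)) * v powr (a + 1) + ((a + 1) * v powr (a + 1 - 1)) * (1 - v) ^ j) (at v)"
    using assms by (intro DERIV_mult has_real_derivative_powr) (auto intro!: derivative_eq_intros)
  also have "(real j * (1 - v) ^ (j - 1) * (0 - 1)) * v powr (a + 1) + ((a + 1) * v powr (a + 1 - 1)) * (1 - v) ^ j =
      (a + 1 + real j) * ((1 - v) ^ j * v powr a) - real j * ((1 - v) ^ (j - 1) * v powr a)"
    unfolding e by (cases "j = 0") (simp_all add: p algebra_simps)
  finally show ?thesis .
qed

text \<open>
  The fundamental theorem of calculus for \<open>(1 - w) ^ j * w powr (a + 1)\<close>. The indicator is the value of this
  function at \<open>w = 1\<close>; for \<open>j = 0\<close> the truncated index \<open>j - 1\<close> is multiplied by \<open>0\<close>.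
\<close>

lemma upper_beta_recurrence:
  assumes "a > 0" "0 \<le> v" "v \<le> 1"
  shows "(a + 1 + real j) * upper_beta a j v =
    of_bool (j = 0) + real j * upper_beta a (j - 1) v - (1 - v) ^ j * v powr (a + 1)"
proof -
  let ?g = "\<lambda>i w::real. (1 - w) ^ i * w powr a"
  have "((\<lambda>w. (a + 1 + real j) * ?g j w - real j * ?g (j - 1) w) has_integral
      ((1 - 1) ^ j * 1 powr (a + 1) - (1 - v) ^ j * v powr (a + 1))) {v..1}"
  proof (rule fundamental_theorem_of_calculus_interior)
    show "continuous_on {v..1} (\<lambda>w. (1 - w) ^ j * w powr (a + 1))"
      using assms by (intro continuous_on_beta_kernel) auto
    fix w assume "w \<in> {v<..<1}"
    thus "((\<lambda>w. (1 - w) ^ j * w powr (a + 1)) has_vector_derivative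
        (a + 1 + real j) * ?g j w - real j * ?g (j - 1) w) (at w)"
      using beta_antiderivative[of a w j] assms
      by (simp add: has_real_derivative_iff_has_vector_derivative)
  qed (use assms in auto)
  moreover have "((\<lambda>w. (a + 1 + real j) * ?g j w - real j * ?g (j - 1) w) has_integral
      ((a + 1 + real j) * upper_beta a j v - real j * upper_beta a (j - 1) v)) {v..1}"
    unfolding upper_beta_def using assms
    by (intro has_integral_diff has_integral_mult_right integrable_integral beta_kernel_integrable) auto
  ultimately have "(a + 1 + real j) * upper_beta a j v - real j * upper_beta a (j - 1) v =
      (1 - 1) ^ j * 1 powr (a + 1) - (1 - v) ^ j * v powr (a + 1)"
    by (rule has_integral_unique[rotated])
  thus ?thesis by (cases j) auto
qed

lemma upper_beta_0:
  assumes "a > 0"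
  shows "upper_beta a j 0 = fact j * Gamma (a + 1) / Gamma (real j + a + 2)"
proof (induction j)
  have "Gamma (a + 1 + 1) = (a + 1) * Gamma (a + 1)"
    using assms nonpos_Ints_nonpos[of "a + 1"] by (intro Gamma_plus1) force
  moreover have "a + 1 + 1 = a + 2" by simp
  ultimately have G: "Gamma (a + 2) = (a + 1) * Gamma (a + 1)" by simp
  case 0
  have "(a + 1) * upper_beta a 0 0 = 1" using upper_beta_recurrence[of a 0 0] assms by simp
  moreover have "Gamma (a + 1) > 0" using assms by (intro Gamma_real_pos) auto
  moreover have "u = g / ((a + 1) * g)" if "(a + 1) * u = 1" "g > 0" for u g :: real
    using that assms by (simp add: divide_simps mult.commute)
  ultimately show ?case by (simp add: G)
next
  case (Suc j)
  have G: "Gamma (real j + a + 2 + 1) = (real j + a + 2) * Gamma (real j + a + 2)"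
    using assms nonpos_Ints_nonpos[of "real j + a + 2"] by (intro Gamma_plus1) force
  have P: "Gamma (real j + a + 2) > 0" using assms by (intro Gamma_real_pos) auto
  have "(real j + a + 2) * upper_beta a (Suc j) 0 = real (Suc j) * upper_beta a j 0"
    using upper_beta_recurrence[of a 0 "Suc j"] assms by (simp add: algebra_simps)
  hence "upper_beta a (Suc j) 0 = real (Suc j) * upper_beta a j 0 / (real j + a + 2)"
    using assms by (simp add: field_simps)
  also have "\<dots> = fact (Suc j) * Gamma (a + 1) / ((real j + a + 2) * Gamma (real j + a + 2))"
    unfolding Suc by (simp add: mult_ac)
  also have "(real j + a + 2) * Gamma (real j + a + 2) = Gamma (real (Suc j) + a + 2)"
    unfolding G[symmetric] by (simp add: add_ac)
  finally show ?case .
qed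

lemma double_beta_integrable:
  assumes "s > 0" "a > 0"
  shows "(\<lambda>v. (1 - v) ^ k * v powr s * upper_beta a j v) integrable_on {0..1}"
  using assms
  by (intro integrable_continuous_real continuous_on_mult[OF continuous_on_beta_kernel] continuous_on_upper_beta) auto

lemma double_beta_nonneg: "0 \<le> double_beta s a j k" if "s > 0" "a > 0"
  unfolding double_beta_def using that upper_beta_nonneg[of a]
  by (intro integral_nonneg double_beta_integrable) auto

text \<open>
  The recurrence of the inner integral, integrated over \<open>v\<close>.
\<close>

lemma double_beta_recurrence_fst:
  assumes "s > 0" "a > 0"
  shows "(a + 1 + real j) * double_beta s a j k = of_bool (j = 0) * upper_beta s k 0
     + real j * double_beta s a (j - 1) k - upper_beta (s + a + 1) (k + j) 0"
proof -
  have "(a + 1 + real j) * double_beta s a j k =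
      integral {0..1} (\<lambda>v. (1 - v) ^ k * v powr s * ((a + 1 + real j) * upper_beta a j v))"
    unfolding double_beta_def by (subst integral_mult_right[symmetric]) (simp add: mult_ac)
  also have "\<dots> = integral {0..1} (\<lambda>v. of_bool (j = 0) * ((1 - v) ^ k * v powr s)
      + real j * ((1 - v) ^ k * v powr s * upper_beta a (j - 1) v) - (1 - v) ^ (k + j) * v powr (s + a + 1))"
  proof (rule integral_cong)
    fix v :: real assume v: "v \<in> {0..1}"
    have "v powr (s + a + 1) = v powr s * v powr (a + 1)" by (simp add: powr_add[symmetric] add_ac)
    moreover have "(a + 1 + real j) * upper_beta a j v =
        of_bool (j = 0) + real j * upper_beta a (j - 1) v - (1 - v) ^ j * v powr (a + 1)"
      using v assms by (intro upper_beta_recurrence) auto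
    ultimately show "(1 - v) ^ k * v powr s * ((a + 1 + real j) * upper_beta a j v) =
      of_bool (j = 0) * ((1 - v) ^ k * v powr s)
      + real j * ((1 - v) ^ k * v powr s * upper_beta a (j - 1) v) - (1 - v) ^ (k + j) * v powr (s + a + 1)"
      by (simp only: power_add) (simp only: algebra_simps)
  qed
  also have "\<dots> = of_bool (j = 0) * upper_beta s k 0
     + real j * double_beta s a (j - 1) k - upper_beta (s + a + 1) (k + j) 0"
    unfolding double_beta_def upper_beta_def[of _ _ 0] using assms
    by (intro integral_unique has_integral_diff has_integral_add has_integral_mult_right
        integrable_integral beta_kernel_integrable double_beta_integrable) auto
  finally show ?thesis .
qed

text \<open>
  The function \<open>(1 - v) ^ k * v powr (s + 1) * upper_beta a j v\<close> vanishes at both ends of the interval, so its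
  derivative has integral \<open>0\<close>.
\<close>

lemma double_beta_recurrence_snd:
  assumes "s > 0" "a > 0"
  shows "(s + 1 + real k) * double_beta s a j k =
     real k * double_beta s a j (k - 1) + upper_beta (s + a + 1) (k + j) 0"
proof -
  let ?g = "\<lambda>i v::real. (1 - v) ^ i * v powr s"
  let ?D = "\<lambda>v. ((s + 1 + real k) * ?g k v - real k * ?g (k - 1) v) * upper_beta a j v
                   - (1 - v) ^ (k + j) * v powr (s + a + 1)"
  have "(?D has_integral ((1 - 1) ^ k * 1 powr (s + 1) * upper_beta a j 1
      - (1 - 0) ^ k * 0 powr (s + 1) * upper_beta a j 0)) {0..1}"
  proof (rule fundamental_theorem_of_calculus_interior)
    show "continuous_on {0..1} (\<lambda>v. (1 - v) ^ k * v powr (s + 1) * upper_beta a j v)"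
      using assms by (intro continuous_on_mult[OF continuous_on_beta_kernel] continuous_on_upper_beta) auto
    fix v :: real assume v: "v \<in> {0<..<1}"
    have "((\<lambda>v. (1 - v) ^ k * v powr (s + 1) * upper_beta a j v) has_real_derivative
        ((s + 1 + real k) * ?g k v - real k * ?g (k - 1) v) * upper_beta a j v
        + (- ((1 - v) ^ j * v powr a)) * ((1 - v) ^ k * v powr (s + 1))) (at v)"
      using v assms by (intro DERIV_mult beta_antiderivative upper_beta_has_derivative) auto
    also have "((s + 1 + real k) * ?g k v - real k * ?g (k - 1) v) * upper_beta a j v
        + (- ((1 - v) ^ j * v powr a)) * ((1 - v) ^ k * v powr (s + 1)) = ?D v"
    proof -
      have "v powr (s + a + 1) = v powr a * v powr (s + 1)" by (simp add: powr_add[symmetric] add_ac)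
      thus ?thesis by (simp add: power_add)
    qed
    finally show "((\<lambda>v. (1 - v) ^ k * v powr (s + 1) * upper_beta a j v) has_vector_derivative ?D v) (at v)"
      by (simp add: has_real_derivative_iff_has_vector_derivative)
  qed auto
  hence 1: "(?D has_integral 0) {0..1}" by simp
  have 2: "((\<lambda>v. (s + 1 + real k) * (?g k v * upper_beta a j v) - real k * (?g (k - 1) v * upper_beta a j v)
        - (1 - v) ^ (k + j) * v powr (s + a + 1)) has_integral
      ((s + 1 + real k) * double_beta s a j k - real k * double_beta s a j (k - 1)
        - upper_beta (s + a + 1) (k + j) 0)) {0..1}"
    unfolding double_beta_def upper_beta_def[of _ _ 0] using assms
    by (intro has_integral_diff has_integral_mult_right
        integrable_integral beta_kernel_integrable double_beta_integrable) auto
  have 3: "(\<lambda>v. (s + 1 + real k) * (?g k v * upper_beta a j v) - real k * (?g (k - 1) v * upper_beta a j v)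
        - (1 - v) ^ (k + j) * v powr (s + a + 1)) = ?D" by (simp add: algebra_simps fun_eq_iff)
  have "(s + 1 + real k) * double_beta s a j k - real k * double_beta s a j (k - 1)
        - upper_beta (s + a + 1) (k + j) 0 = 0"
    by (rule has_integral_unique[OF 2[unfolded 3] 1])
  thus ?thesis by simp
qed

text \<open>
  Adding the two previous recurrences cancels their last terms. Up to the factors in front of the integral this
  is the equation that the limiting edge densities have to satisfy.
\<close>

lemma double_beta_recurrence:
  assumes "s > 0" "a > 0"
  shows "(s + a + 2 + real j + real k) * double_beta s a j k = real j * double_beta s a (j - 1) k
     + real k * double_beta s a j (k - 1) + of_bool (j = 0) * upper_beta s k 0"
  using double_beta_recurrence_fst[OF assms, of j k] double_beta_recurrence_snd[OF assms, of k j]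
  by (simp add: algebra_simps)

text \<open>
  Integration by parts; it amounts to exchanging the order of integration in the double integral.
\<close>

lemma double_beta_swap:
  assumes "s > 0" "a > 0"
  shows "double_beta s a j k =
    integral {0..1} (\<lambda>w. (1 - w) ^ j * w powr a * (upper_beta s k 0 - upper_beta s k w))"
proof -
  let ?H = "\<lambda>w. upper_beta s k 0 - upper_beta s k w"
  let ?g = "\<lambda>w::real. (1 - w) ^ j * w powr a" and ?h = "\<lambda>v::real. (1 - v) ^ k * v powr s"
  have A: "((\<lambda>w. ?h w * upper_beta a j w - ?g w * ?H w) has_integral
      (?H 1 * upper_beta a j 1 - ?H 0 * upper_beta a j 0)) {0..1}"
  proof (rule fundamental_theorem_of_calculus_interior)
    show "continuous_on {0..1} (\<lambda>w. ?H w * upper_beta a j w)"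
      using assms by (intro continuous_intros continuous_on_upper_beta) auto
    fix w :: real assume w: "w \<in> {0<..<1}"
    have "((\<lambda>w. ?H w * upper_beta a j w) has_real_derivative
        (0 - - ?h w) * upper_beta a j w + (- ?g w) * ?H w) (at w)"
      using w assms by (intro DERIV_mult DERIV_diff DERIV_const upper_beta_has_derivative) auto
    thus "((\<lambda>w. ?H w * upper_beta a j w) has_vector_derivative ?h w * upper_beta a j w - ?g w * ?H w) (at w)"
      by (simp add: has_real_derivative_iff_has_vector_derivative)
  qed auto
  have B: "(\<lambda>w. ?g w * ?H w) integrable_on {0..1}"
    using assms by (intro integrable_continuous_real continuous_on_mult[OF continuous_on_beta_kernel]
        continuous_on_diff continuous_on_const continuous_on_upper_beta) auto
  show ?thesis unfolding double_beta_def
    using integral_unique[OF has_integral_add[OF A integrable_integral[OF B]]] by simp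
qed

text \<open>
  Integrate \<open>1 - k v \<le> (1 - v) ^ k \<le> 1\<close> over \<open>{0..w}\<close>.
\<close>

lemma lower_beta_bounds:
  assumes "s > 0" "0 \<le> w" "w \<le> 1"
  shows "upper_beta s k 0 - upper_beta s k w \<le> w powr (s + 1) / (s + 1)"
    and "w powr (s + 1) / (s + 1) - real k * (w powr (s + 2) / (s + 2)) \<le> upper_beta s k 0 - upper_beta s k w"
proof -
  have power_int: "((\<lambda>v. v powr t) has_integral w powr (t + 1) / (t + 1)) {0..w}" if "t > 0" for t
  proof -
    have "((\<lambda>v. v powr t) has_integral (w powr (t + 1) / (t + 1) - 0 powr (t + 1) / (t + 1))) {0..w}"
    proof (rule fundamental_theorem_of_calculus_interior)
      show "continuous_on {0..w} (\<lambda>v. v powr (t + 1) / (t + 1))"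
        using that by (intro continuous_intros continuous_on_powr') auto
      fix v assume "v \<in> {0<..<w}"
      thus "((\<lambda>v. v powr (t + 1) / (t + 1)) has_vector_derivative v powr t) (at v)"
        unfolding has_real_derivative_iff_has_vector_derivative[symmetric] using that
        by (auto intro!: derivative_eq_intros)
    qed (use assms in auto)
    thus ?thesis by simp
  qed
  have main: "((\<lambda>v. (1 - v) ^ k * v powr s) has_integral (upper_beta s k 0 - upper_beta s k w)) {0..w}"
    using lower_beta[OF assms, of k] beta_kernel_integrable[OF assms(1), of 0 k w] by (metis integrable_integral order_refl)
  show "upper_beta s k 0 - upper_beta s k w \<le> w powr (s + 1) / (s + 1)"
    by (rule has_integral_le[OF main power_int]) (use assms in \<open>auto intro!: mult_left_le_one_le power_le_one\<close>)
  have "((\<lambda>v. v powr s - real k * v powr (s + 1)) has_integral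
      (w powr (s + 1) / (s + 1) - real k * (w powr (s + 2) / (s + 2)))) {0..w}"
    using power_int[of "s + 1"] power_int[of s] assms
    by (intro has_integral_diff has_integral_mult_right) (auto simp: add_ac)
  thus "w powr (s + 1) / (s + 1) - real k * (w powr (s + 2) / (s + 2)) \<le> upper_beta s k 0 - upper_beta s k w"
  proof (rule has_integral_le[OF _ main])
    fix v assume v: "v \<in> {0..w}"
    have "1 + real k * (- v) \<le> (1 + (- v)) ^ k" using v assms by (intro Bernoulli_inequality) auto
    hence "(1 - real k * v) * v powr s \<le> (1 - v) ^ k * v powr s" by (intro mult_right_mono) auto
    moreover have "v powr (s + 1) = v * v powr s" using v assms by (simp add: powr_add)
    ultimately show "v powr s - real k * v powr (s + 1) \<le> (1 - v) ^ k * v powr s"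
      by (simp add: algebra_simps)
  qed
qed

text \<open>
  For large \<open>j\<close> only small \<open>w\<close> contribute, and then \<open>v \<le> w\<close> is small as well, so that \<open>(1 - v) ^ k\<close> may be
  replaced by \<open>1\<close>. The error is a beta integral with an exponent that is larger by one.
\<close>

lemma double_beta_bounds_fst:
  assumes "s > 0" "a > 0"
  shows "double_beta s a j k \<le> 1 / (s + 1) * upper_beta (s + a + 1) j 0"
    and "1 / (s + 1) * upper_beta (s + a + 1) j 0 - real k / (s + 2) * upper_beta (s + a + 2) j 0 \<le> double_beta s a j k"
proof -
  let ?g = "\<lambda>w::real. (1 - w) ^ j * w powr a"
  have main: "((\<lambda>w. ?g w * (upper_beta s k 0 - upper_beta s k w)) has_integral double_beta s a j k) {0..1}"
    unfolding double_beta_swap[OF assms] using assms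
    by (intro integrable_integral integrable_continuous_real continuous_on_mult[OF continuous_on_beta_kernel]
        continuous_on_diff continuous_on_const continuous_on_upper_beta) auto
  have up: "((\<lambda>w. c * ((1 - w) ^ j * w powr t)) has_integral c * upper_beta t j 0) {0..1}" if "t > 0" for c t
    unfolding upper_beta_def using that by (intro has_integral_mult_right integrable_integral beta_kernel_integrable) auto
  show "double_beta s a j k \<le> 1 / (s + 1) * upper_beta (s + a + 1) j 0"
  proof (rule has_integral_le[OF main up])
    fix w :: real assume w: "w \<in> {0..1}"
    have "?g w * (upper_beta s k 0 - upper_beta s k w) \<le> ?g w * (w powr (s + 1) / (s + 1))"
      using w assms lower_beta_bounds(1)[of s w k] by (intro mult_left_mono) auto
    also have "\<dots> = 1 / (s + 1) * ((1 - w) ^ j * w powr (s + a + 1))"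
      using powr_add[of w a "s + 1"] by (simp add: add_ac)
    finally show "?g w * (upper_beta s k 0 - upper_beta s k w) \<le> 1 / (s + 1) * ((1 - w) ^ j * w powr (s + a + 1))" .
  qed (use assms in auto)
  show "1 / (s + 1) * upper_beta (s + a + 1) j 0 - real k / (s + 2) * upper_beta (s + a + 2) j 0 \<le> double_beta s a j k"
  proof (rule has_integral_le[OF has_integral_diff[OF up up] main])
    fix w :: real assume w: "w \<in> {0..1}"
    have "1 / (s + 1) * ((1 - w) ^ j * w powr (s + a + 1)) - real k / (s + 2) * ((1 - w) ^ j * w powr (s + a + 2))
        = ?g w * (w powr (s + 1) / (s + 1) - real k * (w powr (s + 2) / (s + 2)))"
      using powr_add[of w a "s + 1"] powr_add[of w a "s + 2"] by (simp add: add_ac algebra_simps)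
    also have "\<dots> \<le> ?g w * (upper_beta s k 0 - upper_beta s k w)"
      using w assms lower_beta_bounds(2)[of s w k] by (intro mult_left_mono) auto
    finally show "1 / (s + 1) * ((1 - w) ^ j * w powr (s + a + 1)) - real k / (s + 2) * ((1 - w) ^ j * w powr (s + a + 2))
        \<le> ?g w * (upper_beta s k 0 - upper_beta s k w)" .
  qed (use assms in auto)
qed

text \<open>
  For large \<open>k\<close> only small \<open>v\<close> contribute, and the inner integral may be replaced by its value at \<open>v = 0\<close>.
\<close>

lemma double_beta_bounds_snd:
  assumes "s > 0" "a > 0"
  shows "double_beta s a j k \<le> upper_beta a j 0 * upper_beta s k 0"
    and "upper_beta a j 0 * upper_beta s k 0 - 1 / (a + 1) * upper_beta (s + a + 1) k 0 \<le> double_beta s a j k"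
proof -
  let ?h = "\<lambda>v::real. (1 - v) ^ k * v powr s"
  have main: "((\<lambda>v. ?h v * upper_beta a j v) has_integral double_beta s a j k) {0..1}"
    unfolding double_beta_def using assms by (intro integrable_integral double_beta_integrable) auto
  have up: "((\<lambda>w. c * ((1 - w) ^ k * w powr t)) has_integral c * upper_beta t k 0) {0..1}" if "t > 0" for c t
    unfolding upper_beta_def using that by (intro has_integral_mult_right integrable_integral beta_kernel_integrable) auto
  show "double_beta s a j k \<le> upper_beta a j 0 * upper_beta s k 0"
  proof (rule has_integral_le[OF main up])
    fix v :: real assume v: "v \<in> {0..1}"
    have "0 \<le> integral {0..v} (\<lambda>w. (1 - w) ^ j * w powr a)"
      using v assms by (intro integral_nonneg beta_kernel_integrable) auto
    hence "upper_beta a j v \<le> upper_beta a j 0" using lower_beta[of a v j] v assms by simp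
    hence "?h v * upper_beta a j v \<le> ?h v * upper_beta a j 0" using v by (intro mult_left_mono) auto
    thus "?h v * upper_beta a j v \<le> upper_beta a j 0 * ?h v" by (simp add: mult_ac)
  qed (use assms in auto)
  show "upper_beta a j 0 * upper_beta s k 0 - 1 / (a + 1) * upper_beta (s + a + 1) k 0 \<le> double_beta s a j k"
  proof (rule has_integral_le[OF has_integral_diff[OF up up] main])
    fix v :: real assume v: "v \<in> {0..1}"
    have "upper_beta a j 0 * ?h v - 1 / (a + 1) * ((1 - v) ^ k * v powr (s + a + 1))
        = ?h v * (upper_beta a j 0 - v powr (a + 1) / (a + 1))"
      using powr_add[of v s "a + 1"] by (simp add: add_ac algebra_simps)
    also have "\<dots> \<le> ?h v * upper_beta a j v"
      using v assms lower_beta_bounds(1)[of a v j] by (intro mult_left_mono) auto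
    finally show "upper_beta a j 0 * ?h v - 1 / (a + 1) * ((1 - v) ^ k * v powr (s + a + 1)) \<le> ?h v * upper_beta a j v" .
  qed (use assms in auto)
qed

text \<open>
  The relative error of \<open>X k\<close> compared with \<open>M * upper_beta s k 0\<close> is at most a multiple of
  \<open>upper_beta t k 0 / upper_beta s k 0\<close>, which is of order \<open>k powr (s - t)\<close> and hence \<open>O(1 / k)\<close>. The leading term is
  a quotient of two values of \<open>Gamma\<close>.
\<close>

lemma negbin_beta_power_law:
  fixes X :: "nat \<Rightarrow> real"
  assumes "r > 0" "s > 0" "t \<ge> s + 1" "M > 0" "D \<ge> 0"
    and up: "\<And>k. X k \<le> M * upper_beta s k 0"
    and lo: "\<And>k. M * upper_beta s k 0 - D * upper_beta t k 0 \<le> X k"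
  shows "\<exists>C \<epsilon>. \<epsilon> \<in> O(\<lambda>k. 1 / real k) \<and>
     (\<forall>\<^sub>F k in sequentially. negbin_coeff r k * X k = C * real k powr (r - s - 2) * (1 + \<epsilon> k))"
proof -
  have ub_pos: "upper_beta s k 0 > 0" for k
    unfolding upper_beta_0[OF \<open>s > 0\<close>] using assms by (intro divide_pos_pos mult_pos_pos Gamma_real_pos) auto
  obtain c \<epsilon>1 where c: "\<epsilon>1 \<in> O(\<lambda>k. 1 / real k)"
      "\<forall>\<^sub>F k in sequentially. Gamma (real k + r) / Gamma (real k + (s + 2)) = c * real k powr (r - (s + 2)) * (1 + \<epsilon>1 k)"
    using Gamma_ratio_power_law[of r "s + 2"] assms by auto
  obtain c' \<epsilon>2 where c': "\<epsilon>2 \<in> O(\<lambda>k. 1 / real k)"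
      "\<forall>\<^sub>F k in sequentially. Gamma (real k + (s + 2)) / Gamma (real k + (t + 2)) = c' * real k powr ((s + 2) - (t + 2)) * (1 + \<epsilon>2 k)"
    using Gamma_ratio_power_law[of "s + 2" "t + 2"] assms by auto
  define \<eta> where "\<eta> k = X k / (M * upper_beta s k 0) - 1" for k
  have \<eta>: "\<bar>\<eta> k\<bar> \<le> D / M * (upper_beta t k 0 / upper_beta s k 0)" for k
  proof -
    let ?u = "upper_beta s k 0" and ?w = "upper_beta t k 0"
    have "\<eta> k = (X k - M * ?u) / (M * ?u)" using ub_pos[of k] assms by (simp add: \<eta>_def diff_divide_distrib)
    also have "\<bar>\<dots>\<bar> = \<bar>X k - M * ?u\<bar> / (M * ?u)" using ub_pos[of k] assms by (simp add: abs_divide abs_mult)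
    also have "\<dots> \<le> (D * ?w) / (M * ?u)"
    proof (intro divide_right_mono)
      show "\<bar>X k - M * ?u\<bar> \<le> D * ?w" using up[of k] lo[of k] by linarith
    qed (use ub_pos[of k] \<open>M > 0\<close> in simp)
    finally show ?thesis by simp
  qed
  have "\<eta> \<in> O(\<lambda>k. upper_beta t k 0 / upper_beta s k 0)"
    using \<eta> order_trans[OF \<eta> mult_left_mono[OF abs_ge_self]] assms by (intro bigoI[of _ "D / M"]) (auto simp: field_simps)
  also have "(\<lambda>k. upper_beta t k 0 / upper_beta s k 0) =
      (\<lambda>k. Gamma (t + 1) / Gamma (s + 1) * (Gamma (real k + (s + 2)) / Gamma (real k + (t + 2))))"
    using assms by (simp add: fun_eq_iff upper_beta_0 add_ac)
  also have "\<dots> \<in> O(\<lambda>k. Gamma (real k + (s + 2)) / Gamma (real k + (t + 2)))"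
    by (intro bigoI[of _ "\<bar>Gamma (t + 1) / Gamma (s + 1)\<bar>"] always_eventually) (simp add: abs_mult)
  also have "(\<lambda>k. Gamma (real k + (s + 2)) / Gamma (real k + (t + 2))) \<in> O(\<lambda>k. 1 / real k)"
  proof -
    have "\<epsilon>2 \<in> O(\<lambda>_. 1)" using c'(1) by (rule landau_o.big_trans) real_asymp
    hence "(\<lambda>k. 1 + \<epsilon>2 k) \<in> O(\<lambda>_. 1)" by (intro sum_in_bigo) auto
    moreover have "(\<lambda>k. c' * real k powr ((s + 2) - (t + 2))) \<in> O(\<lambda>k. 1 / real k)"
    proof (rule bigoI[of _ "\<bar>c'\<bar>"])
      show "\<forall>\<^sub>F k in sequentially. norm (c' * real k powr ((s + 2) - (t + 2))) \<le> \<bar>c'\<bar> * norm (1 / real k)"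
        using eventually_ge_at_top[of 1]
      proof eventually_elim
        case (elim k)
        have "real k powr ((s + 2) - (t + 2)) \<le> real k powr (-1)" using elim assms by (intro powr_mono) auto
        thus ?case using elim mult_left_mono[of "real k powr (s - t)" "1 / real k" "\<bar>c'\<bar>"]
            by (simp add: abs_mult powr_minus_divide)
      qed
    qed
    ultimately have "(\<lambda>k. c' * real k powr ((s + 2) - (t + 2)) * (1 + \<epsilon>2 k)) \<in> O(\<lambda>k. 1 / real k * 1)"
      by (rule landau_o.big.mult[rotated])
    thus ?thesis using landau_o.big.in_cong[OF c'(2)] by simp
  qed
  finally have \<eta>_bigo: "\<eta> \<in> O(\<lambda>k. 1 / real k)" .
  define \<epsilon> where "\<epsilon> k = \<epsilon>1 k + \<eta> k + \<epsilon>1 k * \<eta> k" for k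
  have "(\<lambda>k. \<epsilon>1 k * \<eta> k) \<in> O(\<lambda>k. 1 / real k * (1 / real k))" by (intro landau_o.big.mult c \<eta>_bigo)
  also have "(\<lambda>k. 1 / real k * (1 / real k)) \<in> O(\<lambda>k. 1 / real k)" by real_asymp
  finally have "\<epsilon> \<in> O(\<lambda>k. 1 / real k)" unfolding \<epsilon>_def by (intro sum_in_bigo c \<eta>_bigo)
  moreover have "\<forall>\<^sub>F k in sequentially. negbin_coeff r k * X k =
      (M * Gamma (s + 1) / Gamma r * c) * real k powr (r - s - 2) * (1 + \<epsilon> k)"
    using c(2)
  proof eventually_elim
    case (elim k)
    have "X k = M * upper_beta s k 0 * (1 + \<eta> k)" using ub_pos[of k] assms by (simp add: \<eta>_def)
    hence "negbin_coeff r k * X k = M * (negbin_coeff r k * upper_beta s k 0) * (1 + \<eta> k)" by simp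
    also have "negbin_coeff r k * upper_beta s k 0 =
        Gamma (s + 1) / Gamma r * (Gamma (real k + r) / Gamma (real k + (s + 2)))"
      unfolding upper_beta_0[OF \<open>s > 0\<close>] negbin_coeff_def by (simp add: add_ac)
    also have "Gamma (real k + r) / Gamma (real k + (s + 2)) = c * real k powr (r - s - 2) * (1 + \<epsilon>1 k)"
      unfolding elim by (simp add: algebra_simps)
    also have "M * (Gamma (s + 1) / Gamma r * (c * real k powr (r - s - 2) * (1 + \<epsilon>1 k))) * (1 + \<eta> k) =
      (M * Gamma (s + 1) / Gamma r * c) * real k powr (r - s - 2) * (1 + \<epsilon> k)"
    proof -
      have "1 + \<epsilon> k = (1 + \<epsilon>1 k) * (1 + \<eta> k)" by (simp add: \<epsilon>_def algebra_simps)
      thus ?thesis by simp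
    qed
    finally show ?case .
  qed
  ultimately show ?thesis by blast
qed

section \<open>The limiting distribution\<close>
lemma negbin_coeff_sums:
  assumes "r > 0" "0 \<le> y" "y < 1"
  shows "(\<lambda>k. negbin_coeff r k * y ^ k) sums (1 - y) powr (- r)"
proof -
  have "(\<lambda>k. (- r gchoose k) * (- y) ^ k) sums (1 + - y) powr (- r)"
    using assms by (intro gen_binomial_real) auto
  moreover have "(- r gchoose k) * (- y) ^ k = negbin_coeff r k * y ^ k" for k
  proof -
    have "(- r gchoose k) * (- y) ^ k = ((-1) ^ k * (-1) ^ k) * (pochhammer r k / fact k) * y ^ k"
      by (subst power_minus) (simp add: gbinomial_pochhammer mult_ac)
    also have "(-1 :: real) ^ k * (-1) ^ k = 1" by (simp add: power_mult_distrib[symmetric])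
    also have "pochhammer r k / fact k = negbin_coeff r k"
      using assms nonpos_Ints_nonpos[of r] by (force simp: negbin_coeff_def pochhammer_Gamma add.commute)
    finally show ?thesis by simp
  qed
  ultimately show ?thesis by simp
qed

lemma negbin_coeff_pos: "r > 0 \<Longrightarrow> negbin_coeff r k > 0"
  unfolding negbin_coeff_def by (intro divide_pos_pos mult_pos_pos Gamma_real_pos) auto

lemma negbin_coeff_0: "negbin_coeff r 0 = 1" if "r > 0"
proof -
  have "Gamma r \<noteq> 0" using Gamma_real_pos[OF that] by linarith
  thus ?thesis by (simp add: negbin_coeff_def)
qed

lemma negbin_coeff_Suc:
  assumes "r > 0"
  shows "(real k + r) * negbin_coeff r k = real (Suc k) * negbin_coeff r (Suc k)"
proof -
  have "Gamma (real k + r + 1) = (real k + r) * Gamma (real k + r)"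
    using assms nonpos_Ints_nonpos[of "real k + r"] by (intro Gamma_plus1) force
  moreover have "real k + r + 1 = real (Suc k) + r" by simp
  ultimately have "Gamma (real (Suc k) + r) = (real k + r) * Gamma (real k + r)" by simp
  thus ?thesis by (simp add: negbin_coeff_def del: of_nat_Suc)
qed

lemma negbin_coeff_raise:
  assumes "r > 0"
  shows "r * negbin_coeff (r + 1) k = (real k + r) * negbin_coeff r k"
proof -
  have "Gamma (real k + r + 1) = (real k + r) * Gamma (real k + r)"
    using assms nonpos_Ints_nonpos[of "real k + r"] by (intro Gamma_plus1) force
  moreover have "Gamma (r + 1) = r * Gamma r"
    using assms nonpos_Ints_nonpos[of r] by (intro Gamma_plus1) force
  ultimately show ?thesis using assms by (simp add: negbin_coeff_def add.assoc[symmetric])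
qed

text \<open>
  The partial sums are dominated by their limit \<open>g\<close>.
\<close>

lemma sums_integral_nonneg:
  fixes f :: "nat \<Rightarrow> real \<Rightarrow> real"
  assumes f: "\<And>n. f n integrable_on S" and g: "(g has_integral G) S"
    and nonneg: "\<And>n x. x \<in> S \<Longrightarrow> 0 \<le> f n x"
    and sums: "\<And>x. x \<in> S \<Longrightarrow> (\<lambda>n. f n x) sums g x"
  shows "(\<lambda>n. integral S (f n)) sums G"
proof -
  have "(\<lambda>N. integral S (\<lambda>x. \<Sum>n<N. f n x)) \<longlonglongrightarrow> integral S g"
  proof (rule dominated_convergence(2)[where h = g])
    show "(\<lambda>x. \<Sum>n<N. f n x) integrable_on S" for N by (intro integrable_sum f) auto
    show "g integrable_on S" using g by (rule has_integral_integrable)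
    show "norm (\<Sum>n<N. f n x) \<le> g x" if "x \<in> S" for N x
    proof -
      have "(\<Sum>n<N. f n x) \<le> (\<Sum>n. f n x)"
        using sums[OF that] nonneg[OF that] by (intro sum_le_suminf) (auto simp: sums_iff)
      thus ?thesis using sums[OF that] nonneg[OF that] by (simp add: sums_iff sum_nonneg)
    qed
    show "(\<lambda>N. \<Sum>n<N. f n x) \<longlonglongrightarrow> g x" if "x \<in> S" for x
      using sums[OF that] by (simp add: sums_def)
  qed
  moreover have "integral S (\<lambda>x. \<Sum>n<N. f n x) = (\<Sum>n<N. integral S (f n))" for N
    by (intro integral_sum f) auto
  ultimately show ?thesis using g by (simp add: sums_def integral_unique)
qed

text \<open>
  Under the integral the series sums to \<open>w powr (- a)\<close>, which cancels \<open>w powr a\<close>.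
\<close>

lemma upper_beta_sums:
  assumes "a > 0" "0 < v" "v \<le> 1"
  shows "(\<lambda>j. negbin_coeff a j * upper_beta a j v) sums (1 - v)"
proof -
  have "(\<lambda>j. integral {v..1} (\<lambda>w. negbin_coeff a j * ((1 - w) ^ j * w powr a))) sums (1 - v)"
  proof (rule sums_integral_nonneg[where g = "\<lambda>_. 1"])
    show "(\<lambda>w. negbin_coeff a j * ((1 - w) ^ j * w powr a)) integrable_on {v..1}" for j
      using assms by (intro integrable_on_mult_right beta_kernel_integrable) auto
    show "((\<lambda>_. 1) has_integral (1 - v)) {v..1}" using has_integral_const_real[of "1::real" v 1] assms by simp
    show "0 \<le> negbin_coeff a j * ((1 - w) ^ j * w powr a)" if "w \<in> {v..1}" for j w
      using that assms negbin_coeff_pos[of a j] by simp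
    show "(\<lambda>j. negbin_coeff a j * ((1 - w) ^ j * w powr a)) sums 1" if "w \<in> {v..1}" for w
    proof -
      have "(\<lambda>j. negbin_coeff a j * (1 - w) ^ j * w powr a) sums ((1 - (1 - w)) powr (- a) * w powr a)"
        using that assms by (intro sums_mult2 negbin_coeff_sums) auto
      moreover have "(1 - (1 - w)) powr (- a) * w powr a = 1" using that assms by (simp add: powr_add[symmetric])
      ultimately show ?thesis by (simp add: mult.assoc)
    qed
  qed
  thus ?thesis by (simp add: upper_beta_def)
qed

text \<open>
  The parameter \<open>\<beta>\<close> is \<open>1 / \<psi>\<close>. The degree of a vertex of degree \<open>d\<close> grows in step \<open>n\<close> by \<open>rate d / n\<close> on average,
  and \<open>rate\<close> is affine in \<open>d\<close>.
\<close>

locale limit_law =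
  fixes m :: nat and a \<beta> :: real
  assumes m_pos: "m \<ge> 1" and \<beta>_ge_1: "\<beta> \<ge> 1" and a_eq: "a = real m * \<beta>"
begin

lemma a_pos: "a > 0" using m_pos \<beta>_ge_1 a_eq by simp

lemma s_pos: "a + \<beta> > 0" using a_pos \<beta>_ge_1 by simp

definition joint :: "nat \<Rightarrow> nat \<Rightarrow> real" where
  "joint j k = \<beta> * (\<beta> + 1) * negbin_coeff (a + 1) k * negbin_coeff a j * double_beta (a + \<beta>) a j k"

definition rate :: "nat \<Rightarrow> real" where
  "rate d = (real d - real m + a) / (1 + \<beta>)"

text \<open>
  The limit of the expected number of vertices of degree \<open>d\<close> divided by the number of vertices.
\<close>

definition vertex_density :: "nat \<Rightarrow> real" where
  "vertex_density d = (if d < m then 0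
     else (1 + \<beta>) * negbin_coeff a (d - m) * upper_beta (a + \<beta>) (d - m) 0)"

text \<open>
  The limit of the expected number of edges from a vertex of degree \<open>d\<close> to one of degree \<open>d'\<close>, again divided by
  the number of vertices. There are \<open>m\<close> edges per vertex, whence the factor \<open>m\<close>; a receiver has degree at
  least \<open>m + 1\<close>, counting the edge itself.
\<close>

definition edge_density :: "nat \<Rightarrow> nat \<Rightarrow> real" where
  "edge_density d d' = (if d < m \<or> d' < m + 1 then 0 else real m * joint (d - m) (d' - m - 1))"

lemma rate_nonneg: "0 \<le> rate d"
proof -
  have "real m \<le> a" using \<beta>_ge_1 by (simp add: a_eq mult_le_cancel_left1)
  thus ?thesis using \<beta>_ge_1 by (simp add: rate_def)
qed

lemma joint_nonneg: "0 \<le> joint j k"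
proof -
  have "negbin_coeff (a + 1) k > 0" "negbin_coeff a j > 0" using negbin_coeff_pos a_pos by simp_all
  thus ?thesis unfolding joint_def using \<beta>_ge_1 double_beta_nonneg[OF s_pos a_pos, of j k] by simp
qed

text \<open>
  For fixed \<open>v\<close> the sum over \<open>j\<close> of the inner integrals is \<open>1 - v\<close>.
\<close>

lemma joint_sums_snd:
  "(\<lambda>j. joint j k) sums (\<beta> * (\<beta> + 1) * negbin_coeff (a + 1) k * upper_beta (a + \<beta>) (Suc k) 0)"
proof -
  let ?h = "\<lambda>v::real. (1 - v) ^ k * v powr (a + \<beta>)"
  have "(\<lambda>j. integral {0..1} (\<lambda>v. negbin_coeff a j * (?h v * upper_beta a j v))) sums upper_beta (a + \<beta>) (Suc k) 0"
  proof (rule sums_integral_nonneg[where g = "\<lambda>v. (1 - v) ^ Suc k * v powr (a + \<beta>)"])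
    show "(\<lambda>v. negbin_coeff a j * (?h v * upper_beta a j v)) integrable_on {0..1}" for j
      by (intro integrable_on_mult_right double_beta_integrable s_pos a_pos)
    show "((\<lambda>v. (1 - v) ^ Suc k * v powr (a + \<beta>)) has_integral upper_beta (a + \<beta>) (Suc k) 0) {0..1}"
      unfolding upper_beta_def by (intro integrable_integral beta_kernel_integrable s_pos) auto
    fix v :: real assume v: "v \<in> {0..1}"
    show "0 \<le> negbin_coeff a j * (?h v * upper_beta a j v)" for j
      using v negbin_coeff_pos[OF a_pos, of j] upper_beta_nonneg[of a v j] a_pos by simp
    show "(\<lambda>j. negbin_coeff a j * (?h v * upper_beta a j v)) sums ((1 - v) ^ Suc k * v powr (a + \<beta>))"
    proof (cases "v = 0")
      case False
      hence "(\<lambda>j. ?h v * (negbin_coeff a j * upper_beta a j v)) sums (?h v * (1 - v))"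
        using v by (intro sums_mult upper_beta_sums a_pos) auto
      thus ?thesis by (simp add: mult_ac)
    qed simp
  qed
  hence "(\<lambda>j. \<beta> * (\<beta> + 1) * negbin_coeff (a + 1) k * integral {0..1} (\<lambda>v. negbin_coeff a j * (?h v * upper_beta a j v)))
      sums (\<beta> * (\<beta> + 1) * negbin_coeff (a + 1) k * upper_beta (a + \<beta>) (Suc k) 0)"
    by (rule sums_mult)
  thus ?thesis by (simp add: joint_def double_beta_def mult_ac)
qed

text \<open>
  Under the integral the sum over \<open>k\<close> yields \<open>v powr (\<beta> - 1) * (1 - v)\<close>, whose integral \<open>1 / \<beta> - 1 / (\<beta> + 1)\<close> is the
  reciprocal of the factor \<open>\<beta> (\<beta> + 1)\<close> in \<open>joint\<close>. That the total mass is \<open>1\<close> is also what rules out a loss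
  of mass in the limit of the degree pairs.
\<close>

lemma joint_sums:
  "(\<lambda>k. \<beta> * (\<beta> + 1) * negbin_coeff (a + 1) k * upper_beta (a + \<beta>) (Suc k) 0) sums 1"
proof -
  have "(\<lambda>k. integral {0..1} (\<lambda>v. negbin_coeff (a + 1) k * ((1 - v) ^ Suc k * v powr (a + \<beta>)))) sums
      (1 / \<beta> - 1 / (\<beta> + 1))"
  proof (rule sums_integral_nonneg[where g = "\<lambda>v. v powr (\<beta> - 1) * (1 - v)"])
    show "(\<lambda>v. negbin_coeff (a + 1) k * ((1 - v) ^ Suc k * v powr (a + \<beta>))) integrable_on {0..1}" for k
      by (intro integrable_on_mult_right beta_kernel_integrable s_pos) auto
    have "((\<lambda>v. v powr (\<beta> - 1) * (1 - v)) has_integral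
        (1 powr \<beta> / \<beta> - 1 powr (\<beta> + 1) / (\<beta> + 1) - (0 powr \<beta> / \<beta> - 0 powr (\<beta> + 1) / (\<beta> + 1)))) {0..1}"
    proof (rule fundamental_theorem_of_calculus_interior)
      show "continuous_on {0..1} (\<lambda>v. v powr \<beta> / \<beta> - v powr (\<beta> + 1) / (\<beta> + 1))"
        using \<beta>_ge_1 by (intro continuous_intros continuous_on_powr') auto
      fix v :: real assume v: "v \<in> {0<..<1}"
      have "v powr \<beta> = v powr (\<beta> - 1) * v" using v powr_add[of v "\<beta> - 1" 1] by simp
      hence "v powr (\<beta> - 1) * (1 - v) = v powr (\<beta> - 1) - v powr \<beta>" by (simp add: algebra_simps)
      thus "((\<lambda>v. v powr \<beta> / \<beta> - v powr (\<beta> + 1) / (\<beta> + 1)) has_vector_derivative v powr (\<beta> - 1) * (1 - v)) (at v)"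
        unfolding has_real_derivative_iff_has_vector_derivative[symmetric] using v \<beta>_ge_1
        by (auto intro!: derivative_eq_intros)
    qed simp
    thus "((\<lambda>v. v powr (\<beta> - 1) * (1 - v)) has_integral (1 / \<beta> - 1 / (\<beta> + 1))) {0..1}" by simp
    fix v :: real assume v: "v \<in> {0..1}"
    have "negbin_coeff (a + 1) k > 0" for k using negbin_coeff_pos a_pos by simp
    thus "0 \<le> negbin_coeff (a + 1) k * ((1 - v) ^ Suc k * v powr (a + \<beta>))" for k
      using v by (simp add: less_imp_le)
    show "(\<lambda>k. negbin_coeff (a + 1) k * ((1 - v) ^ Suc k * v powr (a + \<beta>))) sums (v powr (\<beta> - 1) * (1 - v))"
    proof (cases "v = 0")
      case False
      hence "(\<lambda>k. (negbin_coeff (a + 1) k * (1 - v) ^ k) * ((1 - v) * v powr (a + \<beta>))) sums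
          ((1 - (1 - v)) powr (- (a + 1)) * ((1 - v) * v powr (a + \<beta>)))"
        using v a_pos by (intro sums_mult2 negbin_coeff_sums) auto
      moreover have "(1 - (1 - v)) powr (- (a + 1)) * ((1 - v) * v powr (a + \<beta>)) = v powr (\<beta> - 1) * (1 - v)"
      proof -
        have "v powr (- (a + 1)) * v powr (a + \<beta>) = v powr (\<beta> - 1)"
          by (subst powr_add[symmetric]) (simp add: algebra_simps)
        thus ?thesis by (simp add: mult_ac)
      qed
      moreover have "(negbin_coeff (a + 1) k * (1 - v) ^ k) * ((1 - v) * v powr (a + \<beta>)) =
          negbin_coeff (a + 1) k * ((1 - v) ^ Suc k * v powr (a + \<beta>))" for k
        by simp
      ultimately show ?thesis by (simp only:)
    qed simp
  qed
  hence "(\<lambda>k. \<beta> * (\<beta> + 1) * integral {0..1} (\<lambda>v. negbin_coeff (a + 1) k * ((1 - v) ^ Suc k * v powr (a + \<beta>))))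
      sums (\<beta> * (\<beta> + 1) * (1 / \<beta> - 1 / (\<beta> + 1)))"
    by (rule sums_mult)
  moreover have "\<beta> * (\<beta> + 1) * (1 / \<beta> - 1 / (\<beta> + 1)) = 1"
  proof -
    have "\<beta> \<noteq> 0" "\<beta> + 1 \<noteq> 0" using \<beta>_ge_1 by auto
    thus ?thesis by (simp add: right_diff_distrib)
  qed
  ultimately show ?thesis by (simp add: upper_beta_def mult.assoc)
qed

definition pair_pmf_excess :: "(nat \<times> nat) pmf" where
  "pair_pmf_excess = embed_pmf (\<lambda>(j, k). joint j k)"

lemma pmf_pair_excess: "pmf pair_pmf_excess (j, k) = joint j k"
proof -
  have inner: "(\<Sum>j. ennreal (joint j k)) = ennreal (\<beta> * (\<beta> + 1) * negbin_coeff (a + 1) k * upper_beta (a + \<beta>) (Suc k) 0)" for k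
    using joint_sums_snd[of k] joint_nonneg by (intro suminf_ennreal_eq) auto
  have nonneg: "0 \<le> \<beta> * (\<beta> + 1) * negbin_coeff (a + 1) k * upper_beta (a + \<beta>) (Suc k) 0" for k
    using sums_unique[OF joint_sums_snd[of k]] suminf_nonneg[OF sums_summable[OF joint_sums_snd[of k]]] joint_nonneg by simp
  have "(\<integral>\<^sup>+ x. ennreal (case x of (j, k) \<Rightarrow> joint j k) \<partial>count_space UNIV) =
      (\<integral>\<^sup>+ k. \<integral>\<^sup>+ j. ennreal (joint j k) \<partial>count_space UNIV \<partial>count_space UNIV)"
    by (subst nn_integral_snd_count_space[symmetric]) simp
  also have "\<dots> = (\<Sum>k. \<Sum>j. ennreal (joint j k))" by (simp add: nn_integral_count_space_nat)
  also have "\<dots> = ennreal 1"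
    unfolding inner using joint_sums nonneg by (intro suminf_ennreal_eq) auto
  finally show ?thesis
    unfolding pair_pmf_excess_def by (subst pmf_embed_pmf) (auto simp: joint_nonneg)
qed

text \<open>
  The balance at degree \<open>d\<close>: the number of vertices of degree \<open>d\<close> grows by \<open>vertex_density d\<close> in each step, and
  vertices reach degree \<open>d\<close> from degree \<open>d - 1\<close> or, with degree \<open>m\<close>, by birth.
\<close>

lemma vertex_density_rate_equation:
  "vertex_density d * (1 + rate d) =
     (if d = 0 then 0 else rate (d - 1) * vertex_density (d - 1)) + of_bool (d = m)"
proof (cases "d < m")
  case True
  thus ?thesis by (auto simp: vertex_density_def)
next
  case False
  define j where "j = d - m"
  have d: "d = m + j" using False by (simp add: j_def)
  have b: "1 + \<beta> \<noteq> 0" using \<beta>_ge_1 by simp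
  have U: "(a + \<beta> + 1 + real j) * upper_beta (a + \<beta>) j 0 =
      of_bool (j = 0) + real j * upper_beta (a + \<beta>) (j - 1) 0"
    using upper_beta_recurrence[OF s_pos, of 0 j] s_pos by (simp add: add_ac)
  have "vertex_density d * (1 + rate d) = negbin_coeff a j * ((a + \<beta> + 1 + real j) * upper_beta (a + \<beta>) j 0)"
    using b by (simp add: vertex_density_def rate_def d field_simps)
  also have "\<dots> = of_bool (j = 0) * negbin_coeff a 0 + real j * negbin_coeff a j * upper_beta (a + \<beta>) (j - 1) 0"
    unfolding U by (cases j) (simp_all add: algebra_simps)
  also have "negbin_coeff a 0 = 1" by (rule negbin_coeff_0[OF a_pos])
  also have "real j * negbin_coeff a j * upper_beta (a + \<beta>) (j - 1) 0 =
      (if d = 0 then 0 else rate (d - 1) * vertex_density (d - 1))"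
  proof (cases j)
    case 0
    thus ?thesis using m_pos by (simp add: d vertex_density_def)
  next
    case (Suc i)
    have "real j * negbin_coeff a j = (real i + a) * negbin_coeff a i"
      using negbin_coeff_Suc[OF a_pos, of i] Suc by simp
    thus ?thesis using Suc b by (simp add: d vertex_density_def rate_def)
  qed
  finally show ?thesis by (simp add: d)
qed

text \<open>
  The balance for edges: the terms on the right stand for an edge whose sender or whose receiver gains one
  degree, and for a new edge whose receiver had degree \<open>d' - 1\<close> before. The last one corresponds to the
  boundary term of the recurrence for \<open>double_beta\<close>, because \<open>a = m \<beta>\<close>.
\<close>

lemma edge_density_rate_equation:
  "edge_density d d' * (1 + (rate d + rate d')) =
     (if d = 0 then 0 else rate (d - 1) * edge_density (d - 1) d') +
     (if d' = 0 then 0 else rate (d' - 1) * edge_density d (d' - 1)) +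
     of_bool (d = m) * (if d' = 0 then 0 else rate (d' - 1) * vertex_density (d' - 1))"
proof (cases "d < m \<or> d' < m + 1")
  case True
  thus ?thesis by (auto simp: edge_density_def vertex_density_def)
next
  case False
  define j k where "j = d - m" and "k = d' - m - 1"
  have d: "d = m + j" "d' = m + 1 + k" using False by (auto simp: j_def k_def)
  have b: "1 + \<beta> \<noteq> 0" using \<beta>_ge_1 by simp
  define K where "K = real m * \<beta> * negbin_coeff (a + 1) k * negbin_coeff a j"
  let ?I = "double_beta (a + \<beta>) a"
  have "edge_density d d' * (1 + (rate d + rate d')) = K * ((a + \<beta> + a + 2 + real j + real k) * ?I j k)"
  proof -
    have "(\<beta> + 1) * rate d = real j + a" "(\<beta> + 1) * rate d' = real k + 1 + a"
      using b by (simp_all add: rate_def d field_simps)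
    hence "(\<beta> + 1) * (1 + (rate d + rate d')) = a + \<beta> + a + 2 + real j + real k"
      by (simp only: distrib_left) simp
    hence "K * ((\<beta> + 1) * (1 + (rate d + rate d')) * ?I j k) =
        K * ((a + \<beta> + a + 2 + real j + real k) * ?I j k)" by (simp only:)
    moreover have "edge_density d d' = K * ((\<beta> + 1) * ?I j k)"
      by (simp add: edge_density_def joint_def K_def d)
    ultimately show ?thesis by (simp only: mult_ac)
  qed
  also have "\<dots> = K * (real j * ?I (j - 1) k) + K * (real k * ?I j (k - 1))
      + K * (of_bool (j = 0) * upper_beta (a + \<beta>) k 0)"
    unfolding double_beta_recurrence[OF s_pos a_pos] by (simp add: algebra_simps)
  also have "K * (real j * ?I (j - 1) k) = (if d = 0 then 0 else rate (d - 1) * edge_density (d - 1) d')"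
  proof (cases j)
    case 0
    thus ?thesis using m_pos by (simp add: d edge_density_def)
  next
    case (Suc i)
    have "real j * negbin_coeff a j = (real i + a) * negbin_coeff a i"
      using negbin_coeff_Suc[OF a_pos, of i] Suc by simp
    hence "K * (real j * ?I (j - 1) k) = real m * \<beta> * negbin_coeff (a + 1) k * ((real i + a) * negbin_coeff a i) * ?I i k"
      using Suc by (simp add: K_def mult_ac)
    also have "real i + a = rate (d - 1) * (1 + \<beta>)" using b Suc by (simp add: rate_def d)
    finally show ?thesis using Suc by (simp add: edge_density_def joint_def d mult_ac add_ac)
  qed
  also have "K * (real k * ?I j (k - 1)) = (if d' = 0 then 0 else rate (d' - 1) * edge_density d (d' - 1))"
  proof (cases k)
    case 0
    thus ?thesis by (simp add: d edge_density_def)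
  next
    case (Suc i)
    have "real k * negbin_coeff (a + 1) k = (real i + (a + 1)) * negbin_coeff (a + 1) i"
      using negbin_coeff_Suc[of "a + 1" i] a_pos Suc by simp
    hence "K * (real k * ?I j (k - 1)) = real m * \<beta> * negbin_coeff a j * ((real i + (a + 1)) * negbin_coeff (a + 1) i) * ?I j i"
      using Suc by (simp add: K_def mult_ac)
    also have "real i + (a + 1) = rate (d' - 1) * (1 + \<beta>)" using b Suc by (simp add: rate_def d)
    finally show ?thesis using Suc by (simp add: edge_density_def joint_def d mult_ac add_ac)
  qed
  also have "K * (of_bool (j = 0) * upper_beta (a + \<beta>) k 0) =
      of_bool (d = m) * (if d' = 0 then 0 else rate (d' - 1) * vertex_density (d' - 1))"
  proof (cases "j = 0")
    case True
    have "negbin_coeff a 0 = 1" by (rule negbin_coeff_0[OF a_pos])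
    hence "K = a * negbin_coeff (a + 1) k" by (simp add: True K_def a_eq)
    also have "\<dots> = (real k + a) * negbin_coeff a k" by (rule negbin_coeff_raise[OF a_pos])
    finally show ?thesis using True b by (simp add: d vertex_density_def rate_def)
  qed (simp add: d)
  finally show ?thesis .
qed

lemma joint_asymptotic_snd:
  "\<exists>C \<epsilon>. \<epsilon> \<in> O(\<lambda>k. 1 / real k) \<and>
     (\<forall>\<^sub>F k in sequentially. joint j k = C * real k powr (- 1 - \<beta>) * (1 + \<epsilon> k))"
proof -
  have U: "upper_beta a j 0 > 0"
    unfolding upper_beta_0[OF a_pos] using a_pos by (intro divide_pos_pos mult_pos_pos Gamma_real_pos) auto
  obtain C \<epsilon> where C: "\<epsilon> \<in> O(\<lambda>k. 1 / real k)"
    "\<forall>\<^sub>F k in sequentially. negbin_coeff (a + 1) k * double_beta (a + \<beta>) a j k =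
       C * real k powr (a + 1 - (a + \<beta>) - 2) * (1 + \<epsilon> k)"
    using negbin_beta_power_law[of "a + 1" "a + \<beta>" "a + \<beta> + a + 1" "upper_beta a j 0" "1 / (a + 1)"
        "\<lambda>k. double_beta (a + \<beta>) a j k"] a_pos s_pos U double_beta_bounds_snd[OF s_pos a_pos, of j]
    by auto
  have "\<forall>\<^sub>F k in sequentially. joint j k = (\<beta> * (\<beta> + 1) * negbin_coeff a j * C) * real k powr (- 1 - \<beta>) * (1 + \<epsilon> k)"
    using C(2)
  proof eventually_elim
    case (elim k)
    have "a + 1 - (a + \<beta>) - 2 = - 1 - \<beta>" by simp
    hence "negbin_coeff (a + 1) k * double_beta (a + \<beta>) a j k = C * real k powr (- 1 - \<beta>) * (1 + \<epsilon> k)"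
      using elim by (simp only:)
    moreover have "joint j k = \<beta> * (\<beta> + 1) * negbin_coeff a j * (negbin_coeff (a + 1) k * double_beta (a + \<beta>) a j k)"
      by (simp add: joint_def)
    ultimately show ?case by simp
  qed
  with C(1) show ?thesis by blast
qed

lemma joint_asymptotic_fst:
  "\<exists>C \<epsilon>. \<epsilon> \<in> O(\<lambda>j. 1 / real j) \<and>
     (\<forall>\<^sub>F j in sequentially. joint j k = C * real j powr (- a - 3 - \<beta>) * (1 + \<epsilon> j))"
proof -
  let ?s = "a + \<beta>"
  have s: "1 / (?s + 1) > 0" "real k / (?s + 2) \<ge> 0" using s_pos by simp_all
  obtain C \<epsilon> where C: "\<epsilon> \<in> O(\<lambda>j. 1 / real j)"
    "\<forall>\<^sub>F j in sequentially. negbin_coeff a j * double_beta ?s a j k =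
       C * real j powr (a - (?s + a + 1) - 2) * (1 + \<epsilon> j)"
    using negbin_beta_power_law[of a "?s + a + 1" "?s + a + 2" "1 / (?s + 1)" "real k / (?s + 2)"
        "\<lambda>j. double_beta ?s a j k"] a_pos s_pos s double_beta_bounds_fst[OF s_pos a_pos, of _ k]
    by auto
  have "\<forall>\<^sub>F j in sequentially. joint j k = (\<beta> * (\<beta> + 1) * negbin_coeff (a + 1) k * C) * real j powr (- a - 3 - \<beta>) * (1 + \<epsilon> j)"
    using C(2)
  proof eventually_elim
    case (elim j)
    have "a - (?s + a + 1) - 2 = - a - 3 - \<beta>" by simp
    hence "negbin_coeff a j * double_beta ?s a j k = C * real j powr (- a - 3 - \<beta>) * (1 + \<epsilon> j)"
      using elim by (simp only:)
    moreover have "joint j k = \<beta> * (\<beta> + 1) * negbin_coeff (a + 1) k * (negbin_coeff a j * double_beta ?s a j k)"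
      by (simp add: joint_def)
    ultimately show ?case by simp
  qed
  with C(1) show ?thesis by blast
qed

end

section \<open>One attachment step\<close>
abbreviation "expect M f \<equiv> measure_pmf.expectation M f"

lemma expect_mono_finite:
  fixes f g :: "'a \<Rightarrow> real"
  assumes "finite (set_pmf M)" "\<And>x. x \<in> set_pmf M \<Longrightarrow> f x \<le> g x"
  shows "expect M f \<le> expect M g"
  using assms by (intro integral_mono_AE integrable_measure_pmf_finite) (auto simp: AE_measure_pmf_iff)

lemma expect_cong:
  fixes f g :: "'a \<Rightarrow> real"
  assumes "\<And>x. x \<in> set_pmf M \<Longrightarrow> f x = g x"
  shows "expect M f = expect M g"
  using assms by (intro integral_cong_AE) (auto simp: AE_measure_pmf_iff)

lemma expect_diff_bound:
  fixes f g h :: "'a \<Rightarrow> real"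
  assumes "finite (set_pmf M)" "\<And>x. x \<in> set_pmf M \<Longrightarrow> \<bar>f x - g x\<bar> \<le> h x"
  shows "\<bar>expect M f - expect M g\<bar> \<le> expect M h"
proof -
  have "expect M f - expect M g = expect M (\<lambda>x. f x - g x)"
    using assms by (intro Bochner_Integration.integral_diff[symmetric] integrable_measure_pmf_finite)
  also have "\<bar>\<dots>\<bar> \<le> expect M (\<lambda>x. \<bar>f x - g x\<bar>)" by (rule integral_abs_bound)
  also have "\<dots> \<le> expect M h" using assms by (intro expect_mono_finite)
  finally show ?thesis .
qed

lemma expect_nonneg:
  fixes f :: "'a \<Rightarrow> real"
  assumes "\<And>x. x \<in> set_pmf M \<Longrightarrow> 0 \<le> f x"
  shows "0 \<le> expect M f"
  using assms by (intro integral_nonneg_AE) (auto simp: AE_measure_pmf_iff)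

lemma expect_bind_finite:
  fixes h :: "'b \<Rightarrow> real"
  assumes "finite (set_pmf p)" "\<And>x. x \<in> set_pmf p \<Longrightarrow> finite (set_pmf (f x))"
  shows "expect (p \<bind> f) h = expect p (\<lambda>x. expect (f x) h)"
  using assms by (subst pmf_expectation_bind[of "set_pmf p"]) (auto simp: integral_measure_pmf[of "set_pmf p"])

lemma expect_linear_sum:
  fixes f :: "'i \<Rightarrow> 'a \<Rightarrow> real"
  assumes "finite (set_pmf M)"
  shows "expect M (\<lambda>x. \<Sum>i\<in>A. f i x) = (\<Sum>i\<in>A. expect M (f i))"
  using assms by (intro Bochner_Integration.integral_sum integrable_measure_pmf_finite)

lemma expect_add_finite:
  fixes f g :: "'a \<Rightarrow> real"
  assumes "finite (set_pmf M)"
  shows "expect M (\<lambda>x. f x + g x) = expect M f + expect M g"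
  using assms by (intro Bochner_Integration.integral_add integrable_measure_pmf_finite)

lemma expect_diff_finite:
  fixes f g :: "'a \<Rightarrow> real"
  assumes "finite (set_pmf M)"
  shows "expect M (\<lambda>x. f x - g x) = expect M f - expect M g"
  using assms by (intro Bochner_Integration.integral_diff integrable_measure_pmf_finite)

lemma sum_mset_eq_sum_count:
  fixes f :: "'a \<Rightarrow> real"
  assumes "finite A" "set_mset M \<subseteq> A"
  shows "(\<Sum>x\<in>#M. f x) = (\<Sum>x\<in>A. real (count M x) * f x)"
  using assms(2)
proof (induction M)
  case (add x M)
  have "(\<Sum>y\<in>A. real (count (add_mset x M) y) * f y) =
      (\<Sum>y\<in>A. real (count M y) * f y + (if y = x then f y else 0))"
    by (intro sum.cong) (auto simp: algebra_simps)
  also have "\<dots> = (\<Sum>y\<in>A. real (count M y) * f y) + f x"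
    using add.prems assms(1) by (simp add: sum.distrib)
  finally show ?case using add by simp
qed simp

lemma endpoints_attach:
  "endpoints (attach n ws G) = endpoints G + replicate_mset (length ws) n + mset ws"
  by (simp add: endpoints_def attach_def image_mset.compositionality comp_def image_mset_const_eq)

lemma deg_attach:
  "deg (attach n ws G) v = deg G v + count (mset ws) v + (if v = n then length ws else 0)"
  by (simp add: deg_def endpoints_attach)

lemma deg_outside:
  assumes "set_mset G \<subseteq> A \<times> A" "v \<notin> A"
  shows "deg G v = 0"
  using assms by (auto simp: deg_def endpoints_def count_eq_zero_iff)

text \<open>
  The indicator of the new degree is linearised in the number \<open>c\<close> of edges received. This is exact for \<open>c \<le> 1\<close>, so
  the error is controlled by \<open>c (c - 1)\<close>; it vanishes for vertices of degree above \<open>d\<close>, since degrees only grow.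
\<close>

lemma indicator_move_one:
  fixes e d c :: nat
  shows "\<bar>of_bool (e + c = d) - (of_bool (e = d) * (1 - real c) + of_bool (Suc e = d) * real c)\<bar>
     \<le> of_bool (e \<le> d) * (2 * (real c * (real c - 1)))"
proof -
  consider "c = 0" | "c = 1" | i where "c = i + 2" by (metis One_nat_def Suc_1 add.commute add_2_eq_Suc not0_implies_Suc)
  thus ?thesis
  proof cases
    case (3 i)
    have "real c * (real c - 1) = real i * real i + 3 * real i + 2" unfolding 3 by (simp add: algebra_simps)
    moreover have "real i * real i \<ge> 0" by simp
    ultimately show ?thesis using 3 by (auto simp: of_bool_def) 
  qed auto
qed

lemma indicator_move_two:
  fixes e d c e' d' c' :: nat
  shows "\<bar>of_bool (e + c = d \<and> e' + c' = d') - (of_bool (e = d \<and> e' = d') * (1 - real c - real c')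
       + of_bool (Suc e = d \<and> e' = d') * real c + of_bool (e = d \<and> Suc e' = d') * real c')\<bar>
     \<le> of_bool (e \<le> d \<and> e' \<le> d') * (3 * (real c * (real c - 1) + real c' * (real c' - 1) + real c * real c'))"
proof (cases "e \<le> d \<and> e' \<le> d'")
  case True
  have sq: "3 * (real i * (real i - 1)) \<ge> 1 + real i" if "i \<ge> 2" for i :: nat
  proof -
    have "real i * 1 \<le> real i * (real i - 1)" using that by (intro mult_left_mono) auto
    moreover have "real i \<ge> 2" using that by simp
    ultimately show ?thesis by linarith
  qed
  have nn: "real i * (real i - 1) \<ge> 0" for i :: nat by (cases i) auto
  have prod: "real i * real j \<ge> real j" if "i \<ge> 1" for i j :: nat
    using that mult_right_mono[of 1 "real i" "real j"] by simp
  consider "c = 0" "c' = 0" | "c = 0" "c' = 1" | "c = 1" "c' = 0" | "c = 1" "c' = 1" | "c \<ge> 2" "c' = 0" | "c = 0" "c' \<ge> 2"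
    | "c \<ge> 2" "c' \<ge> 1" | "c = 1" "c' \<ge> 2"
    by linarith
  thus ?thesis
  proof cases
    case 5
    thus ?thesis using True sq[of c] by (auto simp: of_bool_def)
  next
    case 6
    thus ?thesis using True sq[of c'] by (auto simp: of_bool_def)
  next
    case 7
    have "1 + real c + real c' \<le> 3 * (real c * (real c - 1) + real c' * (real c' - 1) + real c * real c')"
    proof -
      have "1 + real c \<le> 3 * (real c * (real c - 1))" "real c' \<le> real c * real c'" "0 \<le> real c * real c'"
        using sq[of c] prod[of c c'] 7 by auto
      thus ?thesis using nn[of c'] by (simp only: distrib_left)
    qed
    thus ?thesis using True by (auto simp: of_bool_def)
  next
    case 8
    have "1 + real c + real c' \<le> 3 * (real c * (real c - 1) + real c' * (real c' - 1) + real c * real c')"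
      using sq[of c'] nn[of c] 8 by (simp add: algebra_simps)
    thus ?thesis using True by (auto simp: of_bool_def)
  qed (use True in \<open>auto simp: of_bool_def\<close>)
qed (auto simp: of_bool_def)

lemma indicator_new_edge:
  fixes e d c :: nat
  shows "\<bar>real c * of_bool (e + c = d) - real c * of_bool (Suc e = d)\<bar>
     \<le> of_bool (e \<le> d) * (real c * (real c - 1))"
proof -
  consider "c = 0" | "c = 1" | "c \<ge> 2" by linarith
  thus ?thesis
  proof cases
    case 3
    have "real c * 1 \<le> real c * (real c - 1)" using 3 by (intro mult_left_mono) auto
    thus ?thesis by (auto simp: of_bool_def)
  qed auto
qed

definition vertex_count :: "nat \<Rightarrow> mgraph \<Rightarrow> nat \<Rightarrow> real" where
  "vertex_count n G d = (\<Sum>v\<in>{1..n}. of_bool (deg G v = d))"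

definition edge_count :: "nat \<Rightarrow> mgraph \<Rightarrow> nat \<Rightarrow> nat \<Rightarrow> real" where
  "edge_count s G d d' = (\<Sum>e\<in>#G. of_bool (s < fst e \<and> deg G (fst e) = d \<and> deg G (snd e) = d'))"

text \<open>
  The receivers \<open>ws\<close> of the next vertex are distributed so that, up to errors \<open>\<rho> / n\<close>, a vertex of bounded degree
  receives \<open>x (deg G v) / n\<close> edges on average, and neither two edges of the new vertex hit the same vertex nor do
  they hit two given vertices. Only a bounded range of degrees is considered, because the errors are not small for
  vertices of large degree.
\<close>

definition attaches_at_rate :: "(nat \<Rightarrow> real) \<Rightarrow> nat \<Rightarrow> mgraph \<Rightarrow> nat \<Rightarrow> real \<Rightarrow> nat list pmf \<Rightarrow> bool" where
  "attaches_at_rate x n G d \<rho> Q \<longleftrightarrow>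
     (\<forall>v\<in>{1..n}. deg G v \<le> d \<longrightarrow>
        \<bar>expect Q (\<lambda>ws. real (count (mset ws) v)) - x (deg G v) / real n\<bar> \<le> \<rho> / real n \<and>
        expect Q (\<lambda>ws. real (count (mset ws) v) * (real (count (mset ws) v) - 1)) \<le> \<rho> / real n \<and>
        (\<forall>w\<in>{1..n}. deg G w \<le> d \<longrightarrow> w \<noteq> v \<longrightarrow>
          expect Q (\<lambda>ws. real (count (mset ws) v) * real (count (mset ws) w)) \<le> \<rho> / real n))"

text \<open>
  The mean number of vertices of degree \<open>d\<close> after the next step, if vertices of degree \<open>i\<close> received exactly \<open>x i / n\<close>
  edges on average and at most one edge each.
\<close>

definition predicted_vertex_count :: "(nat \<Rightarrow> real) \<Rightarrow> nat \<Rightarrow> nat \<Rightarrow> mgraph \<Rightarrow> nat \<Rightarrow> real" where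
  "predicted_vertex_count x m n G d =
     (1 - x d / real n) * vertex_count n G d
     + (if d = 0 then 0 else x (d - 1) / real n * vertex_count n G (d - 1)) + of_bool (d = m)"

definition predicted_edge_count :: "(nat \<Rightarrow> real) \<Rightarrow> nat \<Rightarrow> nat \<Rightarrow> nat \<Rightarrow> mgraph \<Rightarrow> nat \<Rightarrow> nat \<Rightarrow> real" where
  "predicted_edge_count x m s n G d d' =
     (1 - (x d + x d') / real n) * edge_count s G d d'
     + (if d = 0 then 0 else x (d - 1) / real n * edge_count s G (d - 1) d')
     + (if d' = 0 then 0 else x (d' - 1) / real n * edge_count s G d (d' - 1))
     + of_bool (d = m) * (if d' = 0 then 0 else x (d' - 1) / real n * vertex_count n G (d' - 1))"

text \<open>
  One step from a fixed graph \<open>G\<close> on \<open>{1..n}\<close>; \<open>Q\<close> is the law of the receivers of the vertex \<open>n + 1\<close>. The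
  edge counts leave out the edges sent by the first \<open>s\<close> vertices, among which there may be loops.
\<close>

locale attachment_step =
  fixes m n s :: nat and G :: mgraph and Q :: "nat list pmf" and x :: "nat \<Rightarrow> real" and D :: nat and \<rho> :: real
  assumes G: "set_mset G \<subseteq> {1..n} \<times> {1..n}" and n: "n \<ge> 1" "s \<le> n"
    and no_loop: "\<And>e. e \<in># G \<Longrightarrow> s < fst e \<Longrightarrow> snd e \<noteq> fst e"
    and Q: "\<And>ws. ws \<in> set_pmf Q \<Longrightarrow> length ws = m \<and> set ws \<subseteq> {1..n}"
    and small: "attaches_at_rate x n G D \<rho> Q" and \<rho>: "\<rho> \<ge> 0"
begin

abbreviation c :: "nat list \<Rightarrow> nat \<Rightarrow> real" where "c ws v \<equiv> real (count (mset ws) v)"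

abbreviation "grown ws \<equiv> attach (Suc n) ws G"

lemma finite_Q: "finite (set_pmf Q)"
  by (rule finite_subset[OF _ finite_lists_length_eq[of "{1..n}" m]]) (use Q in auto)

lemma deg_old: "v \<in> {1..n} \<Longrightarrow> deg (grown ws) v = deg G v + count (mset ws) v"
  by (simp add: deg_attach)

lemma deg_new: "ws \<in> set_pmf Q \<Longrightarrow> deg (grown ws) (Suc n) = m"
  using Q[of ws] deg_outside[OF G, of "Suc n"] by (auto simp: deg_attach count_eq_zero_iff)

lemma mean: "v \<in> {1..n} \<Longrightarrow> deg G v \<le> D \<Longrightarrow> \<bar>expect Q (\<lambda>ws. c ws v) - x (deg G v) / real n\<bar> \<le> \<rho> / real n"
  and dup: "v \<in> {1..n} \<Longrightarrow> deg G v \<le> D \<Longrightarrow> expect Q (\<lambda>ws. c ws v * (c ws v - 1)) \<le> \<rho> / real n"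
  and both: "v \<in> {1..n} \<Longrightarrow> w \<in> {1..n} \<Longrightarrow> deg G v \<le> D \<Longrightarrow> deg G w \<le> D \<Longrightarrow> w \<noteq> v \<Longrightarrow>
     expect Q (\<lambda>ws. c ws v * c ws w) \<le> \<rho> / real n"
  using small unfolding attaches_at_rate_def by blast+

text \<open>
  Each of the \<open>n\<close> vertices contributes an error of order \<open>\<rho> / n\<close>.
\<close>

lemma vertex_count_step:
  assumes "d \<le> D"
  shows "\<bar>expect Q (\<lambda>ws. vertex_count (Suc n) (grown ws) d)
     - predicted_vertex_count x m n G d\<bar> \<le> 3 * \<rho>"
proof -
  define L where "L = (\<lambda>v ws. of_bool (deg G v = d) * (1 - c ws v) + of_bool (Suc (deg G v) = d) * c ws v)"
  define R where "R = (\<lambda>v ws. of_bool (deg G v \<le> d) * (2 * (c ws v * (c ws v - 1))))"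
  have "\<bar>expect Q (\<lambda>ws. vertex_count (Suc n) (grown ws) d) - expect Q (\<lambda>ws. (\<Sum>v\<in>{1..n}. L v ws) + of_bool (d = m))\<bar>
      \<le> expect Q (\<lambda>ws. \<Sum>v\<in>{1..n}. R v ws)"
  proof (rule expect_diff_bound[OF finite_Q])
    fix ws assume ws: "ws \<in> set_pmf Q"
    have "vertex_count (Suc n) (grown ws) d - ((\<Sum>v\<in>{1..n}. L v ws) + of_bool (d = m)) =
        (\<Sum>v\<in>{1..n}. of_bool (deg G v + count (mset ws) v = d) - L v ws)"
      using deg_new[OF ws] by (auto simp: vertex_count_def sum_subtractf deg_old)
    also have "\<bar>\<dots>\<bar> \<le> (\<Sum>v\<in>{1..n}. \<bar>of_bool (deg G v + count (mset ws) v = d) - L v ws\<bar>)" by (rule sum_abs)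
    also have "\<dots> \<le> (\<Sum>v\<in>{1..n}. R v ws)"
      unfolding L_def R_def by (intro sum_mono indicator_move_one)
    finally show "\<bar>vertex_count (Suc n) (grown ws) d - ((\<Sum>v\<in>{1..n}. L v ws) + of_bool (d = m))\<bar> \<le> (\<Sum>v\<in>{1..n}. R v ws)" .
  qed
  moreover have "expect Q (\<lambda>ws. \<Sum>v\<in>{1..n}. R v ws) \<le> 2 * \<rho>"
  proof -
    have "expect Q (\<lambda>ws. \<Sum>v\<in>{1..n}. R v ws) = (\<Sum>v\<in>{1..n}. expect Q (R v))"
      by (rule expect_linear_sum[OF finite_Q])
    also have "\<dots> \<le> (\<Sum>v\<in>{1..n}. 2 * (\<rho> / real n))"
    proof (rule sum_mono)
      fix v assume v: "v \<in> {1..n}"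
      have nn: "0 \<le> \<rho> / real n" using \<rho> by simp
      show "expect Q (R v) \<le> 2 * (\<rho> / real n)"
      proof (cases "deg G v \<le> d")
        case True
        thus ?thesis using dup[OF v] assms by (simp add: R_def)
      qed (use nn in \<open>simp add: R_def\<close>)
    qed
    finally show ?thesis using n by simp
  qed
  moreover have "\<bar>expect Q (\<lambda>ws. (\<Sum>v\<in>{1..n}. L v ws) + of_bool (d = m))
     - predicted_vertex_count x m n G d\<bar> \<le> \<rho>"
  proof -
    define L' where "L' v = of_bool (deg G v = d) * (1 - x (deg G v) / real n)
        + of_bool (Suc (deg G v) = d) * (x (deg G v) / real n)" for v
    have "(\<Sum>v\<in>{1..n}. L' v) = (1 - x d / real n) * vertex_count n G d
        + (if d = 0 then 0 else x (d - 1) / real n * vertex_count n G (d - 1))"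
    proof -
      have 1: "(1 - x d / real n) * vertex_count n G d = (\<Sum>v\<in>{1..n}. of_bool (deg G v = d) * (1 - x (deg G v) / real n))"
        unfolding vertex_count_def sum_distrib_left by (intro sum.cong refl) (auto simp: of_bool_def)
      have 2: "(if d = 0 then 0 else x (d - 1) / real n * vertex_count n G (d - 1)) =
          (\<Sum>v\<in>{1..n}. of_bool (Suc (deg G v) = d) * (x (deg G v) / real n))"
        unfolding vertex_count_def sum_distrib_left by (cases d) (auto intro!: sum.cong simp: of_bool_def)
      show ?thesis unfolding 1 2 L'_def by (simp only: sum.distrib)
    qed
    moreover have "expect Q (\<lambda>ws. (\<Sum>v\<in>{1..n}. L v ws) + of_bool (d = m)) = (\<Sum>v\<in>{1..n}. expect Q (L v)) + of_bool (d = m)"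
      using finite_Q by (simp add: expect_add_finite expect_linear_sum)
    ultimately have "expect Q (\<lambda>ws. (\<Sum>v\<in>{1..n}. L v ws) + of_bool (d = m))
     - predicted_vertex_count x m n G d
      = (\<Sum>v\<in>{1..n}. expect Q (L v) - L' v)" by (simp add: sum_subtractf predicted_vertex_count_def)
    also have "\<bar>\<dots>\<bar> \<le> (\<Sum>v\<in>{1..n}. \<rho> / real n)"
    proof (rule order_trans[OF sum_abs sum_mono])
      fix v assume v: "v \<in> {1..n}"
      have "expect Q (L v) = of_bool (deg G v = d) * (1 - expect Q (\<lambda>ws. c ws v))
          + of_bool (Suc (deg G v) = d) * expect Q (\<lambda>ws. c ws v)"
        unfolding L_def using finite_Q by (simp add: expect_add_finite expect_diff_finite)
      thus "\<bar>expect Q (L v) - L' v\<bar> \<le> \<rho> / real n"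
        using mean[OF v] assms \<rho> unfolding L'_def by (auto simp: of_bool_def abs_le_iff)
    qed
    finally show ?thesis using n by simp
  qed
  ultimately show ?thesis by linarith
qed

lemma edge_count_grown:
  assumes "ws \<in> set_pmf Q"
  shows "edge_count s (grown ws) d d' =
    (\<Sum>e\<in>{1..n} \<times> {1..n}. real (count G e) * of_bool (s < fst e \<and>
       deg G (fst e) + count (mset ws) (fst e) = d \<and> deg G (snd e) + count (mset ws) (snd e) = d'))
    + of_bool (d = m) * (\<Sum>w\<in>{1..n}. c ws w * of_bool (deg G w + count (mset ws) w = d'))"
proof -
  let ?f = "\<lambda>e. of_bool (s < fst e \<and> deg (grown ws) (fst e) = d \<and> deg (grown ws) (snd e) = d') :: real"
  have "edge_count s (grown ws) d d' = (\<Sum>e\<in>#G. ?f e) + (\<Sum>w\<in>#mset ws. ?f (Suc n, w))"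
    unfolding edge_count_def by (subst (3) attach_def) (simp add: image_mset.compositionality comp_def)
  also have "(\<Sum>e\<in>#G. ?f e) = (\<Sum>e\<in>{1..n} \<times> {1..n}. real (count G e) * ?f e)"
    using G by (intro sum_mset_eq_sum_count) auto
  also have "\<dots> = (\<Sum>e\<in>{1..n} \<times> {1..n}. real (count G e) * of_bool (s < fst e \<and>
       deg G (fst e) + count (mset ws) (fst e) = d \<and> deg G (snd e) + count (mset ws) (snd e) = d'))"
    by (intro sum.cong refl) (auto simp: deg_old)
  also have "(\<Sum>w\<in>#mset ws. ?f (Suc n, w)) = (\<Sum>w\<in>{1..n}. c ws w * ?f (Suc n, w))"
    using Q[OF assms] by (intro sum_mset_eq_sum_count) auto
  also have "\<dots> = of_bool (d = m) * (\<Sum>w\<in>{1..n}. c ws w * of_bool (deg G w + count (mset ws) w = d'))"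
    unfolding sum_distrib_left using n deg_new[OF assms] by (intro sum.cong refl) (auto simp: deg_old)
  finally show ?thesis .
qed

lemma sum_count_G: "(\<Sum>e\<in>{1..n} \<times> {1..n}. real (count G e)) = real (size G)"
  using sum_mset_eq_sum_count[of "{1..n} \<times> {1..n}" G "\<lambda>_. 1"] G by simp

text \<open>
  Each old edge contributes an error of order \<open>\<rho> / n\<close>, from its linearisation and from its mean. The new edges are
  summed over their receivers \<open>w\<close> instead, which gives \<open>n\<close> further errors of this order.
\<close>

lemma edge_count_step:
  assumes "d \<le> D" "d' \<le> D"
  shows "\<bar>expect Q (\<lambda>ws. edge_count s (grown ws) d d')
     - predicted_edge_count x m s n G d d'\<bar>
     \<le> 13 * (\<rho> / real n) * real (size G) + 2 * \<rho>"
proof -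
  let ?V = "{1..n} \<times> {1..n}"
  define L where "L = (\<lambda>e ws. of_bool (s < fst e) *
      (of_bool (deg G (fst e) = d \<and> deg G (snd e) = d') * (1 - c ws (fst e) - c ws (snd e))
       + of_bool (Suc (deg G (fst e)) = d \<and> deg G (snd e) = d') * c ws (fst e)
       + of_bool (deg G (fst e) = d \<and> Suc (deg G (snd e)) = d') * c ws (snd e)))"
  define R where "R = (\<lambda>e ws. of_bool (s < fst e) * (of_bool (deg G (fst e) \<le> d \<and> deg G (snd e) \<le> d') *
      (3 * (c ws (fst e) * (c ws (fst e) - 1) + c ws (snd e) * (c ws (snd e) - 1) + c ws (fst e) * c ws (snd e)))))"
  define N where "N = (\<lambda>w ws. c ws w * of_bool (Suc (deg G w) = d'))"
  define S where "S = (\<lambda>w ws. of_bool (deg G w \<le> d') * (c ws w * (c ws w - 1)))"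
  have bound: "\<bar>a * b\<bar> \<le> a * b'" if "a \<ge> 0" "\<bar>b\<bar> \<le> b'" for a b b' :: real
    using that by (simp add: abs_mult mult_left_mono)
  have "\<bar>expect Q (\<lambda>ws. edge_count s (grown ws) d d')
      - expect Q (\<lambda>ws. (\<Sum>e\<in>?V. real (count G e) * L e ws) + of_bool (d = m) * (\<Sum>w\<in>{1..n}. N w ws))\<bar>
      \<le> expect Q (\<lambda>ws. (\<Sum>e\<in>?V. real (count G e) * R e ws) + of_bool (d = m) * (\<Sum>w\<in>{1..n}. S w ws))"
  proof (rule expect_diff_bound[OF finite_Q])
    fix ws assume ws: "ws \<in> set_pmf Q"
    let ?i = "\<lambda>e. of_bool (s < fst e \<and>
       deg G (fst e) + count (mset ws) (fst e) = d \<and> deg G (snd e) + count (mset ws) (snd e) = d') :: real"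
    let ?j = "\<lambda>w. c ws w * of_bool (deg G w + count (mset ws) w = d')"
    have "\<bar>(\<Sum>e\<in>?V. real (count G e) * ?i e) - (\<Sum>e\<in>?V. real (count G e) * L e ws)\<bar> =
        \<bar>\<Sum>e\<in>?V. real (count G e) * (?i e - L e ws)\<bar>"
      by (simp add: sum_subtractf right_diff_distrib)
    also have "\<dots> \<le> (\<Sum>e\<in>?V. real (count G e) * R e ws)"
    proof (rule order_trans[OF sum_abs sum_mono])
      fix e
      show "\<bar>real (count G e) * (?i e - L e ws)\<bar> \<le> real (count G e) * R e ws"
      proof (rule bound)
        show "\<bar>?i e - L e ws\<bar> \<le> R e ws"
        proof (cases "s < fst e")
          case True
          thus ?thesis
            using indicator_move_two[of "deg G (fst e)" "count (mset ws) (fst e)" d "deg G (snd e)" "count (mset ws) (snd e)" d']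
            unfolding L_def R_def by simp
        qed (simp add: L_def R_def)
      qed simp
    qed
    finally have 1: "\<bar>(\<Sum>e\<in>?V. real (count G e) * ?i e) - (\<Sum>e\<in>?V. real (count G e) * L e ws)\<bar> \<le> \<dots>" .
    have "\<bar>(\<Sum>w\<in>{1..n}. ?j w) - (\<Sum>w\<in>{1..n}. N w ws)\<bar> \<le> (\<Sum>w\<in>{1..n}. S w ws)"
      unfolding sum_subtractf[symmetric] N_def S_def
      by (rule order_trans[OF sum_abs sum_mono]) (rule indicator_new_edge)
    hence "\<bar>of_bool (d = m) * ((\<Sum>w\<in>{1..n}. ?j w) - (\<Sum>w\<in>{1..n}. N w ws))\<bar> \<le> of_bool (d = m) * (\<Sum>w\<in>{1..n}. S w ws)"
      by (intro bound) auto
    thus "\<bar>edge_count s (grown ws) d d'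
        - ((\<Sum>e\<in>?V. real (count G e) * L e ws) + of_bool (d = m) * (\<Sum>w\<in>{1..n}. N w ws))\<bar>
      \<le> (\<Sum>e\<in>?V. real (count G e) * R e ws) + of_bool (d = m) * (\<Sum>w\<in>{1..n}. S w ws)"
      unfolding edge_count_grown[OF ws] using 1 by (simp only: right_diff_distrib)
  qed
  moreover have "expect Q (\<lambda>ws. (\<Sum>e\<in>?V. real (count G e) * R e ws) + of_bool (d = m) * (\<Sum>w\<in>{1..n}. S w ws))
      \<le> 9 * (\<rho> / real n) * real (size G) + \<rho>"
  proof -
    have "expect Q (\<lambda>ws. (\<Sum>e\<in>?V. real (count G e) * R e ws) + of_bool (d = m) * (\<Sum>w\<in>{1..n}. S w ws)) =
        (\<Sum>e\<in>?V. real (count G e) * expect Q (R e)) + of_bool (d = m) * (\<Sum>w\<in>{1..n}. expect Q (S w))"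
      using finite_Q by (simp add: expect_add_finite expect_linear_sum)
    moreover have "(\<Sum>e\<in>?V. real (count G e) * expect Q (R e)) \<le> (\<Sum>e\<in>?V. real (count G e) * (9 * (\<rho> / real n)))"
    proof (rule sum_mono)
      fix e assume e: "e \<in> ?V"
      show "real (count G e) * expect Q (R e) \<le> real (count G e) * (9 * (\<rho> / real n))"
      proof (cases "e \<in># G \<and> s < fst e \<and> deg G (fst e) \<le> d \<and> deg G (snd e) \<le> d'")
        case True
        have "expect Q (R e) = 3 * (expect Q (\<lambda>ws. c ws (fst e) * (c ws (fst e) - 1)) +
            expect Q (\<lambda>ws. c ws (snd e) * (c ws (snd e) - 1)) + expect Q (\<lambda>ws. c ws (fst e) * c ws (snd e)))"
          using True finite_Q by (simp add: R_def expect_add_finite)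
        also have "\<dots> \<le> 3 * (\<rho> / real n + \<rho> / real n + \<rho> / real n)"
          using e True assms no_loop[of e] by (intro mult_left_mono add_mono dup both) auto
        finally show ?thesis by (intro mult_left_mono) auto
      next
        case False
        hence "real (count G e) * expect Q (R e) = 0" by (auto simp: R_def count_eq_zero_iff)
        moreover have "0 \<le> real (count G e) * (9 * (\<rho> / real n))" using \<rho> by simp
        ultimately show ?thesis by linarith
      qed
    qed
    moreover have "(\<Sum>e\<in>?V. real (count G e) * (9 * (\<rho> / real n))) = 9 * (\<rho> / real n) * real (size G)"
      unfolding sum_distrib_right[symmetric] sum_count_G by simp
    moreover have "of_bool (d = m) * (\<Sum>w\<in>{1..n}. expect Q (S w)) \<le> \<rho>"
    proof -
      have "(\<Sum>w\<in>{1..n}. expect Q (S w)) \<le> (\<Sum>w\<in>{1..n}. \<rho> / real n)"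
        unfolding S_def using dup assms \<rho> by (intro sum_mono) (auto simp: of_bool_def)
      thus ?thesis using n \<rho> by (auto simp: of_bool_def)
    qed
    ultimately show ?thesis by linarith
  qed
  moreover have "\<bar>expect Q (\<lambda>ws. (\<Sum>e\<in>?V. real (count G e) * L e ws) + of_bool (d = m) * (\<Sum>w\<in>{1..n}. N w ws))
     - predicted_edge_count x m s n G d d'\<bar>
     \<le> 4 * (\<rho> / real n) * real (size G) + \<rho>"
  proof -
    let ?y = "\<lambda>v. x (deg G v) / real n"
    define L' where "L' e = of_bool (s < fst e) *
      (of_bool (deg G (fst e) = d \<and> deg G (snd e) = d') * (1 - ?y (fst e) - ?y (snd e))
       + of_bool (Suc (deg G (fst e)) = d \<and> deg G (snd e) = d') * ?y (fst e)
       + of_bool (deg G (fst e) = d \<and> Suc (deg G (snd e)) = d') * ?y (snd e))" for e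
    define N' where "N' w = ?y w * of_bool (Suc (deg G w) = d')" for w
    have E1: "expect Q (\<lambda>ws. (\<Sum>e\<in>?V. real (count G e) * L e ws) + of_bool (d = m) * (\<Sum>w\<in>{1..n}. N w ws)) =
        (\<Sum>e\<in>?V. real (count G e) * expect Q (L e)) + of_bool (d = m) * (\<Sum>w\<in>{1..n}. expect Q (N w))"
      using finite_Q by (simp add: expect_add_finite expect_linear_sum)
    have ec: "edge_count s G i j = (\<Sum>e\<in>?V. real (count G e) * of_bool (s < fst e \<and> deg G (fst e) = i \<and> deg G (snd e) = j))" for i j
      unfolding edge_count_def using G by (intro sum_mset_eq_sum_count) auto
    have A: "(\<Sum>e\<in>?V. real (count G e) * L' e) = (1 - (x d + x d') / real n) * edge_count s G d d'
        + (if d = 0 then 0 else x (d - 1) / real n * edge_count s G (d - 1) d')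
        + (if d' = 0 then 0 else x (d' - 1) / real n * edge_count s G d (d' - 1))"
    proof -
      have 1: "(1 - (x d + x d') / real n) * edge_count s G d d' = (\<Sum>e\<in>?V. real (count G e) * (of_bool (s < fst e) *
        (of_bool (deg G (fst e) = d \<and> deg G (snd e) = d') * (1 - ?y (fst e) - ?y (snd e)))))"
        unfolding ec sum_distrib_left by (intro sum.cong refl) (auto simp: of_bool_def diff_divide_distrib add_divide_distrib)
      have 2: "(if d = 0 then 0 else x (d - 1) / real n * edge_count s G (d - 1) d') = (\<Sum>e\<in>?V. real (count G e) * (of_bool (s < fst e) *
        (of_bool (Suc (deg G (fst e)) = d \<and> deg G (snd e) = d') * ?y (fst e))))"
        unfolding ec sum_distrib_left by (cases d) (auto intro!: sum.cong simp: of_bool_def)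
      have 3: "(if d' = 0 then 0 else x (d' - 1) / real n * edge_count s G d (d' - 1)) = (\<Sum>e\<in>?V. real (count G e) * (of_bool (s < fst e) *
        (of_bool (deg G (fst e) = d \<and> Suc (deg G (snd e)) = d') * ?y (snd e))))"
        unfolding ec sum_distrib_left by (cases d') (auto intro!: sum.cong simp: of_bool_def)
      show ?thesis unfolding 1 2 3 L'_def by (simp only: distrib_left sum.distrib)
    qed
    have B: "(\<Sum>w\<in>{1..n}. N' w) = (if d' = 0 then 0 else x (d' - 1) / real n * vertex_count n G (d' - 1))"
      unfolding N'_def vertex_count_def sum_distrib_left by (cases d') (auto intro!: sum.cong simp: of_bool_def)
    have "\<bar>(\<Sum>e\<in>?V. real (count G e) * expect Q (L e)) - (\<Sum>e\<in>?V. real (count G e) * L' e)\<bar>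
        \<le> 4 * (\<rho> / real n) * real (size G)"
    proof -
      have "\<bar>(\<Sum>e\<in>?V. real (count G e) * expect Q (L e)) - (\<Sum>e\<in>?V. real (count G e) * L' e)\<bar> =
        \<bar>\<Sum>e\<in>?V. real (count G e) * (expect Q (L e) - L' e)\<bar>"
        by (simp add: sum_subtractf right_diff_distrib)
      also have "\<dots> \<le> (\<Sum>e\<in>?V. real (count G e) * (4 * (\<rho> / real n)))"
      proof (rule order_trans[OF sum_abs sum_mono])
        fix e assume e: "e \<in> ?V"
        let ?v = "fst e" and ?w = "snd e"
        define p q where "p = expect Q (\<lambda>ws. c ws ?v)" and "q = expect Q (\<lambda>ws. c ws ?w)"
        have L: "expect Q (L e) = of_bool (s < ?v) *
          (of_bool (deg G ?v = d \<and> deg G ?w = d') * (1 - p - q)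
           + of_bool (Suc (deg G ?v) = d \<and> deg G ?w = d') * p
           + of_bool (deg G ?v = d \<and> Suc (deg G ?w) = d') * q)"
          unfolding L_def p_def q_def using finite_Q by (simp add: expect_add_finite expect_diff_finite)
        show "\<bar>real (count G e) * (expect Q (L e) - L' e)\<bar> \<le> real (count G e) * (4 * (\<rho> / real n))"
        proof (rule bound)
          have "\<rho> / real n \<ge> 0" using \<rho> by simp
          show "\<bar>expect Q (L e) - L' e\<bar> \<le> 4 * (\<rho> / real n)"
          proof (cases "deg G ?v \<le> d \<and> deg G ?w \<le> d'")
            case True
            have "\<bar>p - ?y ?v\<bar> \<le> \<rho> / real n" "\<bar>q - ?y ?w\<bar> \<le> \<rho> / real n"
              unfolding p_def q_def using e True assms by (auto intro!: mean)
            thus ?thesis unfolding L L'_def using \<open>\<rho> / real n \<ge> 0\<close> by (auto simp: of_bool_def)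
          next
            case False
            thus ?thesis unfolding L L'_def using \<open>\<rho> / real n \<ge> 0\<close> by (auto simp: of_bool_def)
          qed
        qed simp
      qed
      also have "\<dots> = 4 * (\<rho> / real n) * real (size G)"
        unfolding sum_distrib_right[symmetric] sum_count_G by simp
      finally show ?thesis .
    qed
    moreover have "\<bar>of_bool (d = m) * (\<Sum>w\<in>{1..n}. expect Q (N w)) - of_bool (d = m) * (\<Sum>w\<in>{1..n}. N' w)\<bar> \<le> \<rho>"
    proof -
      have "\<bar>(\<Sum>w\<in>{1..n}. expect Q (N w)) - (\<Sum>w\<in>{1..n}. N' w)\<bar> \<le> (\<Sum>w\<in>{1..n}. \<rho> / real n)"
        unfolding sum_subtractf[symmetric]
      proof (rule order_trans[OF sum_abs sum_mono])
        fix w assume w: "w \<in> {1..n}"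
        show "\<bar>expect Q (N w) - N' w\<bar> \<le> \<rho> / real n"
          using mean[OF w] assms \<rho> unfolding N_def N'_def by (auto simp: of_bool_def)
      qed
      thus ?thesis using n \<rho> by (auto simp: of_bool_def)
    qed
    ultimately show ?thesis unfolding E1 predicted_edge_count_def A[symmetric] B[symmetric] by linarith
  qed
  ultimately show ?thesis by linarith
qed

end

section \<open>Expected counts and the degree pair of a growing graph\<close>
text \<open>
  A probability mass function has countable support, so finite sets exhaust its mass.
\<close>

lemma pmf_tight:
  fixes L :: "'a pmf"
  assumes "\<epsilon> > 0"
  obtains A where "finite A" "measure_pmf.prob L (- A) < \<epsilon>"
proof -
  define A where "A n = from_nat_into (set_pmf L) ` {..n::nat}" for n
  have "(\<lambda>n. measure_pmf.prob L (A n)) \<longlonglongrightarrow> measure_pmf.prob L (\<Union>n. A n)"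
    by (intro measure_pmf.finite_Lim_measure_incseq) (auto simp: incseq_def A_def)
  moreover have "set_pmf L \<subseteq> (\<Union>n. A n)"
  proof
    fix x assume "x \<in> set_pmf L"
    hence "\<exists>n. from_nat_into (set_pmf L) n = x"
      by (metis countable_set_pmf from_nat_into_to_nat_on)
    thus "x \<in> (\<Union>n. A n)" by (auto simp: A_def)
  qed
  hence "measure_pmf.prob L (\<Union>n. A n) = 1"
    by (simp add: measure_pmf.prob_eq_1 AE_measure_pmf_iff subset_iff)
  ultimately have "(\<lambda>n. measure_pmf.prob L (A n)) \<longlonglongrightarrow> 1" by simp
  from order_tendstoD(1)[OF this, of "1 - \<epsilon>"] assms obtain n where "measure_pmf.prob L (A n) > 1 - \<epsilon>"
    by (auto simp: eventually_sequentially)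
  moreover have "measure_pmf.prob L (- A n) = 1 - measure_pmf.prob L (A n)"
    using measure_pmf.prob_compl[of "A n" L] by (simp add: Compl_eq_Diff_UNIV)
  ultimately show ?thesis using that[of "A n"] by (simp add: A_def)
qed

text \<open>
  This is Scheffe's lemma: the limit has full mass on a large finite set up to \<open>\<epsilon>\<close>, hence so do the \<open>M n\<close> eventually, and on
  the finite set pointwise convergence suffices.
\<close>

lemma converges_in_distribution_if_pmf:
  fixes M :: "nat \<Rightarrow> 'a::topological_space pmf"
  assumes "\<And>x. (\<lambda>n. pmf (M n) x) \<longlonglongrightarrow> pmf L x"
  shows "converges_in_distribution M L"
  unfolding converges_in_distribution_def
proof (intro allI impI)
  fix f :: "'a \<Rightarrow> real" assume "bounded (range f)"
  then obtain B where B: "B > 0" "\<And>x. \<bar>f x\<bar> \<le> B" by (auto simp: bounded_pos)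
  have split: "\<bar>expect N f - (\<Sum>x\<in>A. f x * pmf N x)\<bar> \<le> B * (1 - (\<Sum>x\<in>A. pmf N x))" if "finite A" for N A
  proof -
    have int: "integrable (measure_pmf N) g" if "\<And>x. \<bar>g x\<bar> \<le> B" for g :: "'a \<Rightarrow> real"
      using that by (intro measure_pmf.integrable_const_bound[where B = B]) auto
    have "expect N (\<lambda>x. f x * indicator A x) = (\<Sum>x\<in>A. f x * indicator A x * pmf N x)"
      using that by (intro integral_measure_pmf_real) (auto simp: indicator_def split: if_splits)
    also have "\<dots> = (\<Sum>x\<in>A. f x * pmf N x)" by (intro sum.cong) auto
    finally have "expect N f - (\<Sum>x\<in>A. f x * pmf N x) = expect N (\<lambda>x. f x - f x * indicator A x)"
      using B by (subst Bochner_Integration.integral_diff[OF int int]) (auto simp: indicator_def abs_mult)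
    also have "\<bar>\<dots>\<bar> \<le> expect N (\<lambda>x. \<bar>f x - f x * indicator A x\<bar>)" by (rule integral_abs_bound)
    also have "\<dots> \<le> expect N (\<lambda>x. B * indicator (- A) x)"
      using B by (intro integral_mono int integrable_mult_right integrable_real_indicator) (auto simp: indicator_def less_imp_le)
    also have "\<dots> = B * measure_pmf.prob N (- A)" by simp
    also have "measure_pmf.prob N (- A) = 1 - measure_pmf.prob N A"
      using measure_pmf.prob_compl[of A N] by (simp add: Compl_eq_Diff_UNIV)
    also have "measure_pmf.prob N A = (\<Sum>x\<in>A. pmf N x)" using that by (rule measure_measure_pmf_finite)
    finally show ?thesis .
  qed
  show "(\<lambda>n. expect (M n) f) \<longlonglongrightarrow> expect L f"
  proof (rule LIMSEQ_I)
    fix \<epsilon> :: real assume \<epsilon>: "\<epsilon> > 0"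
    obtain A where A: "finite A" "measure_pmf.prob L (- A) < \<epsilon> / (4 * B)"
      using pmf_tight[of "\<epsilon> / (4 * B)" L] \<epsilon> B by auto
    have LA: "1 - (\<Sum>x\<in>A. pmf L x) < \<epsilon> / (4 * B)"
      using A measure_pmf.prob_compl[of A L] measure_measure_pmf_finite[OF A(1), of L] by (simp add: Compl_eq_Diff_UNIV)
    have "(\<lambda>n. (\<Sum>x\<in>A. f x * pmf (M n) x) - (\<Sum>x\<in>A. f x * pmf L x) + B * (1 - (\<Sum>x\<in>A. pmf (M n) x))) \<longlonglongrightarrow>
        (\<Sum>x\<in>A. f x * pmf L x) - (\<Sum>x\<in>A. f x * pmf L x) + B * (1 - (\<Sum>x\<in>A. pmf L x))"
      by (intro tendsto_intros assms)
    note lim1 = this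
    have lim2: "(\<lambda>n. (\<Sum>x\<in>A. f x * pmf L x) - (\<Sum>x\<in>A. f x * pmf (M n) x) + B * (1 - (\<Sum>x\<in>A. pmf (M n) x))) \<longlonglongrightarrow>
        (\<Sum>x\<in>A. f x * pmf L x) - (\<Sum>x\<in>A. f x * pmf L x) + B * (1 - (\<Sum>x\<in>A. pmf L x))"
      by (intro tendsto_intros assms)
    have small: "(\<Sum>x\<in>A. f x * pmf L x) - (\<Sum>x\<in>A. f x * pmf L x) + B * (1 - (\<Sum>x\<in>A. pmf L x)) < \<epsilon> / 2"
    proof -
      have "B * (1 - (\<Sum>x\<in>A. pmf L x)) < B * (\<epsilon> / (4 * B))" using LA B by (intro mult_strict_left_mono)
      also have "\<dots> \<le> \<epsilon> / 2" using B \<epsilon> by simp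
      finally show ?thesis by simp
    qed
    from order_tendstoD(2)[OF lim1 small] order_tendstoD(2)[OF lim2 small]
    have "\<forall>\<^sub>F n in sequentially. norm (expect (M n) f - expect L f) < \<epsilon>"
    proof eventually_elim
      case (elim n)
      have "B * (1 - (\<Sum>x\<in>A. pmf L x)) \<le> B * (\<epsilon> / (4 * B))" using LA B by (intro mult_left_mono) auto
      also have "\<dots> = \<epsilon> / 4" using B by simp
      finally show ?case using elim split[OF A(1), of "M n"] split[OF A(1), of L] \<epsilon> by (simp only: real_norm_def)
    qed
    thus "\<exists>no. \<forall>n\<ge>no. norm (expect (M n) f - expect L f) < \<epsilon>" by (simp add: eventually_sequentially)
  qed
qed

text \<open>
  What all versions of the process share: after the first \<open>s\<close> vertices, each new vertex sends \<open>m\<close> edges to older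
  vertices.
\<close>

locale growing_graph =
  fixes m s :: nat and choice :: "nat \<Rightarrow> mgraph \<Rightarrow> nat list pmf" and init :: "nat \<Rightarrow> mgraph"
  assumes m_ge_1: "m \<ge> 1" and s_ge_1: "s \<ge> 1"
    and init_range: "set_mset (init s) \<subseteq> {1..s} \<times> {1..s}"
    and choice_range: "\<And>n G ws. s \<le> n \<Longrightarrow> set_mset G \<subseteq> {1..n} \<times> {1..n} \<Longrightarrow> ws \<in> set_pmf (choice (Suc n) G) \<Longrightarrow>
        length ws = m \<and> set ws \<subseteq> {1..n}"
begin

abbreviation law :: "nat \<Rightarrow> mgraph pmf" where "law \<equiv> grow choice init s"

lemma law_Suc:
  assumes "s \<le> n"
  shows "law (Suc n) = law n \<bind> (\<lambda>G. map_pmf (\<lambda>ws. attach (Suc n) ws G) (choice (Suc n) G))"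
  using assms by (simp add: map_pmf_def)

lemma law_start: "law s = return_pmf (init s)"
  using s_ge_1 by (cases s) auto

lemma law_induct [consumes 2, case_names start grow]:
  assumes "s \<le> n" "G \<in> set_pmf (law n)"
    and start: "P s (init s)"
    and step: "\<And>n G ws. s \<le> n \<Longrightarrow> G \<in> set_pmf (law n) \<Longrightarrow> ws \<in> set_pmf (choice (Suc n) G) \<Longrightarrow> P n G \<Longrightarrow>
        P (Suc n) (attach (Suc n) ws G)"
  shows "P n G"
  using assms(1,2)
proof (induction n arbitrary: G rule: dec_induct)
  case base
  thus ?case using start by (simp add: law_start)
next
  case (step n)
  thus ?case using assms(4) by (auto simp: law_Suc simp del: grow.simps)
qed

lemma graph_range:
  assumes "s \<le> n" "G \<in> set_pmf (law n)"
  shows "set_mset G \<subseteq> {1..n} \<times> {1..n}"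
  using assms
proof (induction rule: law_induct)
  case start
  show ?case by (rule init_range)
next
  case (grow n G ws)
  have "set ws \<subseteq> {1..n}" using choice_range[OF grow(1,4,3)] by simp
  thus ?case using grow(4) by (fastforce simp: attach_def)
qed

lemma choice_law:
  assumes "s \<le> n" "G \<in> set_pmf (law n)" "ws \<in> set_pmf (choice (Suc n) G)"
  shows "length ws = m" "set ws \<subseteq> {1..n}"
  using choice_range[OF assms(1) graph_range[OF assms(1,2)] assms(3)] by auto

lemma finite_choice:
  assumes "s \<le> n" "G \<in> set_pmf (law n)"
  shows "finite (set_pmf (choice (Suc n) G))"
  by (rule finite_subset[OF _ finite_lists_length_eq[of "{1..n}" m]]) (use choice_law[OF assms] in auto)

lemma finite_law:
  assumes "s \<le> n"
  shows "finite (set_pmf (law n))"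
  using assms
proof (induction n rule: dec_induct)
  case base
  show ?case by (simp add: law_start)
next
  case (step n)
  thus ?case using finite_choice by (simp add: law_Suc del: grow.simps)
qed

lemma expect_law_Suc:
  assumes "s \<le> n"
  shows "expect (law (Suc n)) f = expect (law n) (\<lambda>G. expect (choice (Suc n) G) (\<lambda>ws. f (attach (Suc n) ws G) :: real))"
  unfolding law_Suc[OF assms] using finite_law[OF assms] finite_choice[OF assms]
  by (subst expect_bind_finite) auto

lemma size_graph:
  assumes "s \<le> n" "G \<in> set_pmf (law n)"
  shows "size G = size (init s) + m * (n - s)"
  using assms
proof (induction rule: law_induct)
  case (grow n G ws)
  thus ?case using choice_law[OF grow(1-3)] by (simp add: attach_def Suc_diff_le)
qed simp

lemma edges_point_back:
  assumes "s \<le> n" "G \<in> set_pmf (law n)"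
  shows "\<forall>e\<in>#G. s < fst e \<longrightarrow> snd e < fst e"
  using assms
proof (induction rule: law_induct)
  case start
  thus ?case using init_range by fastforce
next
  case (grow n G ws)
  thus ?case using choice_law[OF grow(1-3)] by (fastforce simp: attach_def)
qed

lemma size_receivers:
  assumes "s \<le> n" "G \<in> set_pmf (law n)"
  shows "\<forall>v\<in>{s<..n}. size (receivers G v) = m"
  using assms
proof (induction rule: law_induct)
  case (grow n G ws)
  have "filter_mset (\<lambda>e. fst e = Suc n) G = {#}"
    using graph_range[OF grow(1,2)] by auto
  hence old: "receivers G (Suc n) = {#}" by (simp only: receivers_def image_mset_empty)
  have new: "filter_mset (\<lambda>e. fst e = v) (image_mset (Pair (Suc n)) M) = (if v = Suc n then image_mset (Pair (Suc n)) M else {#})" for v M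
    by (induction M) auto
  have "receivers (attach (Suc n) ws G) v = receivers G v + (if v = Suc n then mset ws else {#})" for v
    unfolding receivers_def attach_def filter_union_mset image_mset_union new
    by (simp add: image_mset.compositionality comp_def)
  with old have "receivers (attach (Suc n) ws G) v = (if v = Suc n then mset ws else receivers G v)" for v
    by simp
  thus ?case using grow choice_law[OF grow(1-3)] by auto
qed simp

lemma sum_edges_by_sender:
  fixes g :: "nat \<Rightarrow> nat \<Rightarrow> real"
  assumes "s \<le> n" "G \<in> set_pmf (law n)"
  shows "(\<Sum>v\<in>{s<..n}. \<Sum>w\<in>#receivers G v. g v w) = (\<Sum>e\<in>#G. of_bool (s < fst e) * g (fst e) (snd e))"
proof -
  let ?A = "{1..n} \<times> {1..n}"
  have "(\<Sum>w\<in>#receivers G v. g v w) = (\<Sum>e\<in>#G. of_bool (fst e = v) * g (fst e) (snd e))" for v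
    unfolding receivers_def by (induction G) auto
  also have "\<dots> v = (\<Sum>e\<in>?A. real (count G e) * (of_bool (fst e = v) * g (fst e) (snd e)))" for v
    using graph_range[OF assms] by (intro sum_mset_eq_sum_count) auto
  finally have "(\<Sum>v\<in>{s<..n}. \<Sum>w\<in>#receivers G v. g v w) =
      (\<Sum>v\<in>{s<..n}. \<Sum>e\<in>?A. real (count G e) * (of_bool (fst e = v) * g (fst e) (snd e)))" by simp
  also have "\<dots> = (\<Sum>e\<in>?A. \<Sum>v\<in>{s<..n}. real (count G e) * (of_bool (fst e = v) * g (fst e) (snd e)))"
    by (rule sum.swap)
  also have "\<dots> = (\<Sum>e\<in>?A. real (count G e) * (of_bool (s < fst e) * g (fst e) (snd e)))"
  proof (rule sum.cong[OF refl])
    fix e assume e: "e \<in> ?A"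
    have "(\<Sum>v\<in>{s<..n}. of_bool (fst e = v) :: real) = of_bool (s < fst e)"
      using e by (auto simp: of_bool_def)
    moreover have "(\<Sum>v\<in>{s<..n}. real (count G e) * (of_bool (fst e = v) * g (fst e) (snd e))) =
        real (count G e) * ((\<Sum>v\<in>{s<..n}. of_bool (fst e = v)) * g (fst e) (snd e))"
      by (simp only: sum_distrib_left sum_distrib_right)
    ultimately show "(\<Sum>v\<in>{s<..n}. real (count G e) * (of_bool (fst e = v) * g (fst e) (snd e))) =
        real (count G e) * (of_bool (s < fst e) * g (fst e) (snd e))" by (simp only:)
  qed
  also have "\<dots> = (\<Sum>e\<in>#G. of_bool (s < fst e) * g (fst e) (snd e))"
    using graph_range[OF assms] by (intro sum_mset_eq_sum_count[symmetric]) auto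
  finally show ?thesis .
qed

definition pair_law :: "nat \<Rightarrow> (nat \<times> nat) pmf" where
  "pair_law n = law n \<bind> (\<lambda>G.
       pmf_of_set {1..n} \<bind> (\<lambda>v0.
         (if receivers G v0 = {#} then return_pmf 0
          else map_pmf (deg G) (pmf_of_multiset (receivers G v0))) \<bind> (\<lambda>d'.
           return_pmf (deg G v0, d'))))"

text \<open>
  If the chosen vertex is not an initial one, then it is the sender, together with the chosen receiver, of a
  uniformly distributed edge among the \<open>m\<close> edges of each vertex. Initial vertices have probability at most \<open>s / n\<close>.
\<close>

lemma pair_law_edge_count:
  assumes "s \<le> n"
  shows "\<bar>pmf (pair_law n) (d, d') - expect (law n) (\<lambda>G. edge_count s G d d') / real n / real m\<bar> \<le> real s / real n"
proof -
  define f where "f = (\<lambda>G v. (if receivers G v = {#} then return_pmf 0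
          else map_pmf (deg G) (pmf_of_multiset (receivers G v))) \<bind> (\<lambda>d'. return_pmf (deg G v, d')))"
  have n: "real n > 0" using assms s_ge_1 by simp
  have "\<bar>expect (law n) (\<lambda>G. pmf (pmf_of_set {1..n} \<bind> f G) (d, d'))
      - expect (law n) (\<lambda>G. edge_count s G d d' / real n / real m)\<bar> \<le> expect (law n) (\<lambda>_. real s / real n)"
  proof (rule expect_diff_bound[OF finite_law[OF assms]])
    fix G assume G: "G \<in> set_pmf (law n)"
    have f_new: "pmf (f G v) (d, d') = (\<Sum>w\<in>#receivers G v. of_bool (deg G v = d \<and> deg G w = d')) / real m"
      if v: "v \<in> {s<..n}" for v
    proof -
      have sz: "size (receivers G v) = m" using size_receivers[OF assms G] v by auto
      hence ne: "receivers G v \<noteq> {#}" using m_ge_1 by auto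
      have "pmf (f G v) (d, d') = expect (pmf_of_multiset (receivers G v)) (\<lambda>w. of_bool (deg G v = d \<and> deg G w = d'))"
        using ne by (simp add: f_def pmf_bind pmf_return indicator_def of_bool_def)
      also have "\<dots> = (\<Sum>w\<in>set_mset (receivers G v). of_bool (deg G v = d \<and> deg G w = d') * (real (count (receivers G v) w) / real m))"
        using ne sz by (subst integral_measure_pmf_real[of "set_mset (receivers G v)"]) auto
      also have "\<dots> = (\<Sum>w\<in>set_mset (receivers G v). real (count (receivers G v) w) * of_bool (deg G v = d \<and> deg G w = d')) / real m"
        by (simp only: sum_divide_distrib) (simp add: mult_ac)
      also have "\<dots> = (\<Sum>w\<in>#receivers G v. of_bool (deg G v = d \<and> deg G w = d')) / real m"
        by (subst sum_mset_eq_sum_count[of "set_mset (receivers G v)"]) auto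
      finally show ?thesis .
    qed
    have "pmf (pmf_of_set {1..n} \<bind> f G) (d, d') = (\<Sum>v\<in>{1..n}. pmf (f G v) (d, d')) / real n"
      using n by (subst pmf_bind_pmf_of_set) auto
    also have "(\<Sum>v\<in>{1..n}. pmf (f G v) (d, d')) = (\<Sum>v\<in>{1..s}. pmf (f G v) (d, d')) + (\<Sum>v\<in>{s<..n}. pmf (f G v) (d, d'))"
    proof -
      have "{1..n} = {1..s} \<union> {s<..n}" using assms s_ge_1 by auto
      thus ?thesis by (simp only:) (intro sum.union_disjoint, auto)
    qed
    also have "(\<Sum>v\<in>{s<..n}. pmf (f G v) (d, d')) = (\<Sum>v\<in>{s<..n}. \<Sum>w\<in>#receivers G v. of_bool (deg G v = d \<and> deg G w = d')) / real m"
      by (simp add: f_new sum_divide_distrib)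
    also have "(\<Sum>v\<in>{s<..n}. \<Sum>w\<in>#receivers G v. of_bool (deg G v = d \<and> deg G w = d')) = edge_count s G d d'"
      unfolding sum_edges_by_sender[OF assms G] edge_count_def by (intro arg_cong[where f = sum_mset] image_mset_cong) auto
    finally have "pmf (pmf_of_set {1..n} \<bind> f G) (d, d') - edge_count s G d d' / real n / real m =
        (\<Sum>v\<in>{1..s}. pmf (f G v) (d, d')) / real n" by (simp add: add_divide_distrib mult.commute)
    moreover have "(\<Sum>v\<in>{1..s}. pmf (f G v) (d, d')) \<le> (\<Sum>v\<in>{1..s}. 1)" by (intro sum_mono pmf_le_1)
    moreover have "0 \<le> (\<Sum>v\<in>{1..s}. pmf (f G v) (d, d'))" by (intro sum_nonneg) auto
    ultimately show "\<bar>pmf (pmf_of_set {1..n} \<bind> f G) (d, d') - edge_count s G d d' / real n / real m\<bar> \<le> real s / real n"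
      using n by (simp add: divide_right_mono)
  qed
  thus ?thesis by (simp add: pair_law_def pmf_bind[of "law n"] f_def)
qed

end

text \<open>
  The error may depend on the graph \<open>G\<close>, as it only has to vanish on average. This is used for the conditional model,
  where the error involves the probability of a collision among independent receivers.
\<close>

locale rate_driven_graph = limit_law m a \<beta> + growing_graph m s choice init
  for m a \<beta> s choice init +
  fixes err :: "nat \<Rightarrow> nat \<Rightarrow> mgraph \<Rightarrow> real"
  assumes err_nonneg: "\<And>d n G. 0 \<le> err d n G"
    and err_vanishes: "\<And>d. (\<lambda>n. expect (law n) (err d n)) \<longlonglongrightarrow> 0"
    and at_rate: "\<And>d. \<forall>\<^sub>F n in sequentially. \<forall>G\<in>set_pmf (law n).
        attaches_at_rate rate n G d (err d n G) (choice (Suc n) G)"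
begin

lemma attachment_step_at:
  assumes "s \<le> n" "G \<in> set_pmf (law n)" "attaches_at_rate rate n G D (err D n G) (choice (Suc n) G)"
  shows "attachment_step m n s G (choice (Suc n) G) rate D (err D n G)"
proof
  show "set_mset G \<subseteq> {1..n} \<times> {1..n}" by (rule graph_range[OF assms(1,2)])
  show "n \<ge> 1" "s \<le> n" using assms(1) s_ge_1 by auto
  show "snd e \<noteq> fst e" if "e \<in># G" "s < fst e" for e using edges_point_back[OF assms(1,2)] that by fastforce
  show "length ws = m \<and> set ws \<subseteq> {1..n}" if "ws \<in> set_pmf (choice (Suc n) G)" for ws
    using choice_law[OF assms(1,2) that] by simp
qed (use assms(3) err_nonneg in auto)

definition V :: "nat \<Rightarrow> nat \<Rightarrow> real" where "V d n = expect (law n) (\<lambda>G. vertex_count n G d)"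
definition F :: "nat \<Rightarrow> nat \<Rightarrow> nat \<Rightarrow> real" where "F d d' n = expect (law n) (\<lambda>G. edge_count s G d d')"

lemma tendsto_perturbed:
  fixes u t e :: "nat \<Rightarrow> real"
  assumes "\<forall>\<^sub>F n in sequentially. \<bar>u n - t n\<bar> \<le> C * e n" "e \<longlonglongrightarrow> 0" "t \<longlonglongrightarrow> l"
  shows "u \<longlonglongrightarrow> l"
proof -
  have "(\<lambda>n. C * e n) \<longlonglongrightarrow> 0" using tendsto_mult_left[OF assms(2), of C] by simp
  hence "(\<lambda>n. u n - t n) \<longlonglongrightarrow> 0" by (rule Lim_null_comparison[rotated]) (use assms(1) in simp)
  from tendsto_add[OF this assms(3)] show ?thesis by simp
qed

lemma tendsto_unless:
  fixes f :: "nat \<Rightarrow> real"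
  shows "(\<not> P \<Longrightarrow> f \<longlonglongrightarrow> l) \<Longrightarrow> (\<lambda>n. if P then 0 else f n) \<longlonglongrightarrow> (if P then 0 else l)"
  by (cases P) auto

text \<open>
  Averaging the one-step estimate gives a rate equation with an inhomogeneity that converges by the induction
  hypothesis for \<open>d - 1\<close>.
\<close>

lemma vertex_limit: "(\<lambda>n. V d n / real n) \<longlonglongrightarrow> vertex_density d"
proof (induction d)
  have step: "(\<lambda>n. V d n / real n) \<longlonglongrightarrow> vertex_density d"
    if IH: "d > 0 \<Longrightarrow> (\<lambda>n. V (d - 1) n / real n) \<longlonglongrightarrow> vertex_density (d - 1)" for d
  proof -
    define b where "b n = V d (Suc n) - (1 - rate d / real n) * V d n" for n
    define t where "t n = (if d = 0 then 0 else rate (d - 1) * (V (d - 1) n / real n)) + of_bool (d = m)" for n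
    show ?thesis
    proof (rule rate_equation_limit[OF rate_nonneg[of d]])
      show "\<forall>\<^sub>F n in sequentially. V d (Suc n) = (1 - rate d / real n) * V d n + b n" by (simp add: b_def)
      have "b \<longlonglongrightarrow> (if d = 0 then 0 else rate (d - 1) * vertex_density (d - 1)) + of_bool (d = m)"
      proof (rule tendsto_perturbed[OF _ err_vanishes[of d]])
        show "t \<longlonglongrightarrow> (if d = 0 then 0 else rate (d - 1) * vertex_density (d - 1)) + of_bool (d = m)"
          unfolding t_def by (intro tendsto_add tendsto_mult tendsto_const tendsto_unless IH) auto
        show "\<forall>\<^sub>F n in sequentially. \<bar>b n - t n\<bar> \<le> 3 * expect (law n) (err d n)"
          using at_rate[of d] eventually_ge_at_top[of s]
        proof eventually_elim
          case (elim n)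
          note fin = finite_law[OF elim(2)]
          have "\<bar>V d (Suc n) - expect (law n) (\<lambda>G. predicted_vertex_count rate m n G d)\<bar>
              \<le> expect (law n) (\<lambda>G. 3 * err d n G)"
            unfolding V_def expect_law_Suc[OF elim(2)]
          proof (rule expect_diff_bound[OF fin])
            fix G assume Gl: "G \<in> set_pmf (law n)"
            interpret attachment_step m n s G "choice (Suc n) G" rate d "err d n G"
              using attachment_step_at[OF elim(2) Gl] elim(1) Gl by blast
            show "\<bar>expect (choice (Suc n) G) (\<lambda>ws. vertex_count (Suc n) (attach (Suc n) ws G) d)
               - predicted_vertex_count rate m n G d\<bar> \<le> 3 * err d n G"
              by (rule vertex_count_step) simp
          qed
          moreover have "expect (law n) (\<lambda>G. predicted_vertex_count rate m n G d)
              = (1 - rate d / real n) * V d n + t n"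
            unfolding predicted_vertex_count_def using fin by (cases "d = 0") (simp_all add: expect_add_finite V_def t_def)
          ultimately show ?case by (simp add: b_def algebra_simps)
        qed
      qed
      thus "b \<longlonglongrightarrow> (1 + rate d) * vertex_density d"
        using vertex_density_rate_equation[of d] by (simp add: mult.commute)
    qed
  qed
  case 0
  show ?case by (rule step) simp
  case (Suc d)
  show ?case by (rule step) (use Suc in simp)
qed

text \<open>
  As for vertices, now by induction on \<open>d + d'\<close>, because the predicted edge count refers to one smaller degree in
  either coordinate. The number of edges is at most a multiple of \<open>n\<close>, so that the total error in a step is a
  multiple of \<open>err D n\<close>.
\<close>

lemma edge_limit: "(\<lambda>n. F d d' n / real n) \<longlonglongrightarrow> edge_density d d'"
proof (induction "d + d'" arbitrary: d d' rule: less_induct)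
  case less
  have IH1: "(\<lambda>n. F (d - 1) d' n / real n) \<longlonglongrightarrow> edge_density (d - 1) d'" if "d > 0"
    using less[of "d - 1" d'] that by simp
  have IH2: "(\<lambda>n. F d (d' - 1) n / real n) \<longlonglongrightarrow> edge_density d (d' - 1)" if "d' > 0"
    using less[of d "d' - 1"] that by simp
  define D where "D = max d d'"
  define C where "C = 13 * real (size (init s) + m) + 2"
  define b where "b n = F d d' (Suc n) - (1 - (rate d + rate d') / real n) * F d d' n" for n
  define t where "t n = (if d = 0 then 0 else rate (d - 1) * (F (d - 1) d' n / real n)) +
     (if d' = 0 then 0 else rate (d' - 1) * (F d (d' - 1) n / real n)) +
     of_bool (d = m) * (if d' = 0 then 0 else rate (d' - 1) * (V (d' - 1) n / real n))" for n
  define l where "l = (if d = 0 then 0 else rate (d - 1) * edge_density (d - 1) d') +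
     (if d' = 0 then 0 else rate (d' - 1) * edge_density d (d' - 1)) +
     of_bool (d = m) * (if d' = 0 then 0 else rate (d' - 1) * vertex_density (d' - 1))"
  show ?case
  proof (rule rate_equation_limit)
    show "0 \<le> rate d + rate d'" using rate_nonneg by simp
    show "\<forall>\<^sub>F n in sequentially. F d d' (Suc n) = (1 - (rate d + rate d') / real n) * F d d' n + b n" by (simp add: b_def)
    have "b \<longlonglongrightarrow> l"
    proof (rule tendsto_perturbed[OF _ err_vanishes[of D]])
      show "t \<longlonglongrightarrow> l"
        unfolding t_def l_def
        by (intro tendsto_add tendsto_mult tendsto_const tendsto_unless IH1 IH2 vertex_limit) auto
      show "\<forall>\<^sub>F n in sequentially. \<bar>b n - t n\<bar> \<le> C * expect (law n) (err D n)"
        using at_rate[of D] eventually_ge_at_top[of s]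
      proof eventually_elim
        case (elim n)
        note fin = finite_law[OF elim(2)]
        let ?g = "\<lambda>G. predicted_edge_count rate m s n G d d'"
        have "\<bar>F d d' (Suc n) - expect (law n) ?g\<bar> \<le> expect (law n) (\<lambda>G. C * err D n G)"
          unfolding F_def expect_law_Suc[OF elim(2)]
        proof (rule expect_diff_bound[OF fin])
          fix G assume Gl: "G \<in> set_pmf (law n)"
          interpret attachment_step m n s G "choice (Suc n) G" rate D "err D n G"
            using attachment_step_at[OF elim(2) Gl] elim(1) Gl by blast
          have "\<bar>expect (choice (Suc n) G) (\<lambda>ws. edge_count s (attach (Suc n) ws G) d d') - ?g G\<bar>
              \<le> 13 * (err D n G / real n) * real (size G) + 2 * err D n G"
            by (rule edge_count_step) (auto simp: D_def)
          also have "\<dots> \<le> C * err D n G"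
          proof -
            have "size G \<le> (size (init s) + m) * n"
            proof -
              have "size (init s) * 1 \<le> size (init s) * n" "m * (n - s) \<le> m * n" using n by (intro mult_le_mono; simp)+
              thus ?thesis using size_graph[OF elim(2) Gl] by (simp only: add_mult_distrib)
            qed
            hence "real (size G) \<le> real (size (init s) + m) * real n" by (metis of_nat_le_iff of_nat_mult)
            hence "13 * (err D n G / real n) * real (size G) \<le> 13 * (err D n G / real n) * (real (size (init s) + m) * real n)"
              using err_nonneg by (intro mult_left_mono) auto
            also have "\<dots> = 13 * real (size (init s) + m) * err D n G" using n by simp
            finally show ?thesis by (simp add: C_def algebra_simps)
          qed
          finally show "\<bar>expect (choice (Suc n) G) (\<lambda>ws. edge_count s (attach (Suc n) ws G) d d') - ?g G\<bar> \<le> C * err D n G" .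
        qed
        moreover have "expect (law n) ?g = (1 - (rate d + rate d') / real n) * F d d' n + t n"
          unfolding predicted_edge_count_def using fin
          by (cases "d = 0"; cases "d' = 0") (simp_all add: expect_add_finite F_def V_def t_def)
        ultimately show ?case by (simp add: b_def algebra_simps)
      qed
    qed
    thus "b \<longlonglongrightarrow> (1 + (rate d + rate d')) * edge_density d d'"
      using edge_density_rate_equation[of d d'] by (simp add: l_def mult.commute)
  qed
qed

theorem pair_law_limit: "(\<lambda>n. pmf (pair_law n) (d, d')) \<longlonglongrightarrow> edge_density d d' / real m"
proof (rule tendsto_perturbed[of _ "\<lambda>n. F d d' n / real n / real m" "real s" "\<lambda>n. 1 / real n"])
  show "\<forall>\<^sub>F n in sequentially. \<bar>pmf (pair_law n) (d, d') - F d d' n / real n / real m\<bar> \<le> real s * (1 / real n)"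
    using eventually_ge_at_top[of s] by eventually_elim (use pair_law_edge_count in \<open>simp add: F_def\<close>)
  show "(\<lambda>n. 1 / real n) \<longlonglongrightarrow> 0" by (rule lim_1_over_n)
  show "(\<lambda>n. F d d' n / real n / real m) \<longlonglongrightarrow> edge_density d d' / real m"
    using m_ge_1 by (intro tendsto_divide edge_limit tendsto_const) auto
qed

end

section \<open>Receivers drawn one after another\<close>
lemma pmf_choose_vertex:
  assumes "0 \<le> p" "p \<le> 1" "n \<ge> 1" "M \<noteq> {#}"
  shows "pmf (choose_vertex p (Suc n) M) v = p * (of_bool (v \<in> {1..n}) / real n) + (1 - p) * (real (count M v) / real (size M))"
proof -
  have "{1..<Suc n} = {1..n}" by auto
  moreover have "pmf (pmf_of_set {1..n}) v = of_bool (v \<in> {1..n}) / real n"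
    using assms by (subst pmf_of_set) (auto simp: indicator_def)
  ultimately show ?thesis
    using assms unfolding choose_vertex_def by (simp add: pmf_bind)
qed

lemma set_pmf_choose_vertex:
  assumes "n \<ge> 1" "set_mset M \<subseteq> {1..n}"
  shows "set_pmf (choose_vertex p (Suc n) M) \<subseteq> {1..n}"
proof -
  have "set_pmf (pmf_of_set {1..<Suc n}) = {1..n}" using assms by (subst set_pmf_of_set) auto
  thus ?thesis using assms unfolding choose_vertex_def by (auto split: if_splits)
qed

lemma endpoints_range: "set_mset G \<subseteq> A \<times> A \<Longrightarrow> set_mset (endpoints G) \<subseteq> A"
  by (auto simp: endpoints_def)

lemma size_endpoints: "size (endpoints G) = 2 * size G"
  by (simp add: endpoints_def)

lemma replicate_pmf_Suc_append:
  "replicate_pmf (Suc i) P = replicate_pmf i P \<bind> (\<lambda>ws. P \<bind> (\<lambda>w. return_pmf (ws @ [w])))"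
  using replicate_pmf_distrib[of i 1 P]
  by (simp add: replicate_pmf_1 map_pmf_def bind_assoc_pmf bind_return_pmf)

lemma count_append_one: "real (count (mset (ws @ [w])) v) = real (count (mset ws) v) + of_bool (w = v)"
  by simp

lemma expect_of_bool_eq: "expect M (\<lambda>w. of_bool (w = v)) = pmf M v"
proof -
  have "expect M (\<lambda>w. of_bool (w = v) :: real) = expect M (indicator {v})"
    by (intro expect_cong) (auto simp: indicator_def)
  thus ?thesis by (simp add: pmf.rep_eq)
qed

text \<open>
  The receivers are drawn successively, and \<open>K i ws\<close> is the law of the next one after the \<open>i\<close> receivers \<open>ws\<close>.
\<close>

locale appended_law =
  fixes m :: nat and B :: "nat set" and S :: "nat \<Rightarrow> nat list pmf" and K :: "nat \<Rightarrow> nat list \<Rightarrow> nat pmf"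
  assumes finite_B: "finite B"
    and S_0: "S 0 = return_pmf []"
    and S_Suc: "\<And>i. S (Suc i) = S i \<bind> (\<lambda>ws. K i ws \<bind> (\<lambda>w. return_pmf (ws @ [w])))"
    and K_range: "\<And>i ws. length ws = i \<Longrightarrow> set ws \<subseteq> B \<Longrightarrow> set_pmf (K i ws) \<subseteq> B"
begin

abbreviation c :: "nat list \<Rightarrow> nat \<Rightarrow> real" where "c ws v \<equiv> real (count (mset ws) v)"

lemma S_range: "ws \<in> set_pmf (S i) \<Longrightarrow> length ws = i \<and> set ws \<subseteq> B"
proof (induction i arbitrary: ws)
  case (Suc i)
  then obtain us w where us: "us \<in> set_pmf (S i)" "w \<in> set_pmf (K i us)" "ws = us @ [w]"
    by (auto simp: S_Suc)
  thus ?case using Suc.IH[OF us(1)] K_range[of us i] by auto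
qed (simp add: S_0)

lemma finite_S: "finite (set_pmf (S i))"
  by (rule finite_subset[OF _ finite_lists_length_eq[OF finite_B, of i]]) (use S_range in auto)

lemma finite_K: "ws \<in> set_pmf (S i) \<Longrightarrow> finite (set_pmf (K i ws))"
  using S_range K_range finite_B finite_subset by metis

lemma expect_S_Suc: "expect (S (Suc i)) f = expect (S i) (\<lambda>ws. expect (K i ws) (\<lambda>w. f (ws @ [w]) :: real))"
proof -
  have "S (Suc i) = S i \<bind> (\<lambda>ws. map_pmf (\<lambda>w. ws @ [w]) (K i ws))" by (simp add: S_Suc map_pmf_def)
  thus ?thesis using finite_S finite_K by (simp add: expect_bind_finite)
qed

lemma count_le: "ws \<in> set_pmf (S i) \<Longrightarrow> c ws v \<le> real i"
  using S_range[of ws i] count_le_size[of "mset ws" v] by simp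

text \<open>
  These three recurrences follow how an appended receiver changes \<open>c\<close>, \<open>c (c - 1)\<close> and the product of two
  counts.
\<close>

lemma mean_Suc:
  "expect (S (Suc i)) (\<lambda>ws. c ws v) = expect (S i) (\<lambda>ws. c ws v) + expect (S i) (\<lambda>ws. pmf (K i ws) v)"
proof -
  have "expect (S (Suc i)) (\<lambda>ws. c ws v) = expect (S i) (\<lambda>ws. c ws v + pmf (K i ws) v)"
    unfolding expect_S_Suc
  proof (rule expect_cong)
    fix ws assume "ws \<in> set_pmf (S i)"
    thus "expect (K i ws) (\<lambda>w. c (ws @ [w]) v) = c ws v + pmf (K i ws) v"
      unfolding count_append_one using finite_K by (simp add: expect_add_finite expect_of_bool_eq)
  qed
  thus ?thesis using finite_S by (simp add: expect_add_finite)
qed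

lemma dup_Suc:
  "expect (S (Suc i)) (\<lambda>ws. c ws v * (c ws v - 1)) = expect (S i) (\<lambda>ws. c ws v * (c ws v - 1))
     + 2 * expect (S i) (\<lambda>ws. c ws v * pmf (K i ws) v)"
proof -
  have "expect (S (Suc i)) (\<lambda>ws. c ws v * (c ws v - 1)) = expect (S i) (\<lambda>ws. c ws v * (c ws v - 1) + 2 * (c ws v * pmf (K i ws) v))"
    unfolding expect_S_Suc
  proof (rule expect_cong)
    fix ws assume ws: "ws \<in> set_pmf (S i)"
    have "c (ws @ [w]) v * (c (ws @ [w]) v - 1) = c ws v * (c ws v - 1) + 2 * c ws v * of_bool (w = v)" for w
      by (simp add: algebra_simps)
    hence "expect (K i ws) (\<lambda>w. c (ws @ [w]) v * (c (ws @ [w]) v - 1)) =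
        expect (K i ws) (\<lambda>w. c ws v * (c ws v - 1) + 2 * c ws v * of_bool (w = v))" by (simp only:)
    also have "\<dots> = c ws v * (c ws v - 1) + 2 * (c ws v * pmf (K i ws) v)"
      using finite_K[OF ws] by (simp add: expect_add_finite expect_of_bool_eq)
    finally show "expect (K i ws) (\<lambda>w. c (ws @ [w]) v * (c (ws @ [w]) v - 1)) =
        c ws v * (c ws v - 1) + 2 * (c ws v * pmf (K i ws) v)" .
  qed
  thus ?thesis using finite_S by (simp add: expect_add_finite)
qed

lemma both_Suc:
  assumes "v \<noteq> u"
  shows "expect (S (Suc i)) (\<lambda>ws. c ws v * c ws u) = expect (S i) (\<lambda>ws. c ws v * c ws u)
     + expect (S i) (\<lambda>ws. c ws v * pmf (K i ws) u) + expect (S i) (\<lambda>ws. c ws u * pmf (K i ws) v)"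
proof -
  have "expect (S (Suc i)) (\<lambda>ws. c ws v * c ws u) =
     expect (S i) (\<lambda>ws. c ws v * c ws u + c ws v * pmf (K i ws) u + c ws u * pmf (K i ws) v)"
    unfolding expect_S_Suc
  proof (rule expect_cong)
    fix ws assume ws: "ws \<in> set_pmf (S i)"
    have "c (ws @ [w]) v * c (ws @ [w]) u = c ws v * c ws u + c ws v * of_bool (w = u) + c ws u * of_bool (w = v)" for w
      using assms by (simp add: algebra_simps)
    hence "expect (K i ws) (\<lambda>w. c (ws @ [w]) v * c (ws @ [w]) u) =
        expect (K i ws) (\<lambda>w. c ws v * c ws u + c ws v * of_bool (w = u) + c ws u * of_bool (w = v))" by (simp only:)
    also have "\<dots> = c ws v * c ws u + c ws v * pmf (K i ws) u + c ws u * pmf (K i ws) v"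
      using finite_K[OF ws] by (simp add: expect_add_finite expect_of_bool_eq)
    finally show "expect (K i ws) (\<lambda>w. c (ws @ [w]) v * c (ws @ [w]) u) =
        c ws v * c ws u + c ws v * pmf (K i ws) u + c ws u * pmf (K i ws) v" .
  qed
  thus ?thesis using finite_S by (simp add: expect_add_finite)
qed

text \<open>
  Suppose that every draw hits \<open>v\<close> with probability close to \<open>y v\<close>, where \<open>\<kappa>\<close> is of order \<open>1 / n\<close> and \<open>\<delta>\<close> of order
  \<open>1 / n\<^sup>2\<close>. The term \<open>\<kappa> * c ws v\<close> allows for edges that \<open>v\<close> has already received in the current step; since \<open>c ws v\<close>
  has mean of order \<open>\<kappa>\<close>, it changes means by \<open>\<kappa>\<^sup>2\<close> only.
\<close>

context
  fixes y :: "nat \<Rightarrow> real" and T :: "nat set" and \<delta> \<kappa> :: real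
  assumes near: "\<And>i ws v. i < m \<Longrightarrow> length ws = i \<Longrightarrow> set ws \<subseteq> B \<Longrightarrow> v \<in> T \<Longrightarrow> \<bar>pmf (K i ws) v - y v\<bar> \<le> \<delta> + \<kappa> * c ws v"
    and y: "\<And>v. v \<in> T \<Longrightarrow> 0 \<le> y v" "\<And>v. v \<in> T \<Longrightarrow> y v \<le> \<kappa>"
    and \<delta>: "0 \<le> \<delta>" "\<delta> \<le> \<kappa>" and \<kappa>: "\<kappa> \<le> 1"
begin

lemma near': "i < m \<Longrightarrow> ws \<in> set_pmf (S i) \<Longrightarrow> v \<in> T \<Longrightarrow> \<bar>pmf (K i ws) v - y v\<bar> \<le> \<delta> + \<kappa> * c ws v"
  using near S_range by blast

lemma mean_bound:
  assumes "v \<in> T"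
  shows "i \<le> m \<Longrightarrow> expect (S i) (\<lambda>ws. c ws v) \<le> 2 * \<kappa> * (2 ^ i - 1)"
proof (induction i)
  case (Suc i)
  have "expect (S i) (\<lambda>ws. pmf (K i ws) v) \<le> expect (S i) (\<lambda>ws. 2 * \<kappa> + c ws v)"
  proof (rule expect_mono_finite[OF finite_S])
    fix ws assume ws: "ws \<in> set_pmf (S i)"
    have "\<kappa> * c ws v \<le> c ws v" using \<kappa> by (simp add: mult_left_le_one_le mult_right_le_one_le \<delta> order_trans[OF \<delta>])
    thus "pmf (K i ws) v \<le> 2 * \<kappa> + c ws v" using near'[OF _ ws assms] Suc.prems y[OF assms] \<delta> by linarith
  qed
  also have "\<dots> = 2 * \<kappa> + expect (S i) (\<lambda>ws. c ws v)" using finite_S by (simp add: expect_add_finite)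
  finally show ?case using Suc unfolding mean_Suc by (simp add: algebra_simps)
qed (simp add: S_0)

lemma mean_bound': "v \<in> T \<Longrightarrow> i \<le> m \<Longrightarrow> expect (S i) (\<lambda>ws. c ws v) \<le> 2 ^ (m + 1) * \<kappa>"
proof -
  assume v: "v \<in> T" and i: "i \<le> m"
  have "\<kappa> \<ge> 0" using \<delta> by linarith
  have "(2::real) ^ i \<le> 2 ^ m" using i by (intro power_increasing) auto
  hence "2 * \<kappa> * (2 ^ i - 1) \<le> 2 * \<kappa> * 2 ^ m"
    by (intro mult_left_mono) (use \<open>\<kappa> \<ge> 0\<close> in linarith)+
  thus ?thesis using mean_bound[OF v i] by (simp add: mult_ac)
qed

lemma mean_near:
  assumes "v \<in> T"
  shows "i \<le> m \<Longrightarrow> \<bar>expect (S i) (\<lambda>ws. c ws v) - real i * y v\<bar> \<le> real i * (\<delta> + 2 ^ (m + 1) * \<kappa>\<^sup>2)"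
proof (induction i)
  case (Suc i)
  have "\<kappa> \<ge> 0" using \<delta> by linarith
  have "\<bar>expect (S i) (\<lambda>ws. pmf (K i ws) v) - expect (S i) (\<lambda>_. y v)\<bar> \<le> expect (S i) (\<lambda>ws. \<delta> + \<kappa> * c ws v)"
    using Suc.prems by (intro expect_diff_bound finite_S near' assms) auto
  also have "\<dots> = \<delta> + \<kappa> * expect (S i) (\<lambda>ws. c ws v)" using finite_S by (simp add: expect_add_finite)
  also have "\<dots> \<le> \<delta> + \<kappa> * (2 ^ (m + 1) * \<kappa>)"
    using Suc.prems by (intro add_left_mono mult_left_mono mean_bound' assms \<open>\<kappa> \<ge> 0\<close>) auto
  finally have "\<bar>expect (S i) (\<lambda>ws. pmf (K i ws) v) - y v\<bar> \<le> \<delta> + 2 ^ (m + 1) * \<kappa>\<^sup>2"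
    by (simp add: power2_eq_square mult_ac)
  moreover have "\<bar>expect (S i) (\<lambda>ws. c ws v) - real i * y v\<bar> \<le> real i * (\<delta> + 2 ^ (m + 1) * \<kappa>\<^sup>2)"
    using Suc by simp
  moreover have "\<bar>p + q - real (Suc i) * y v\<bar> \<le> real (Suc i) * X"
    if "\<bar>q - y v\<bar> \<le> X" "\<bar>p - real i * y v\<bar> \<le> real i * X" for p q X
    using that by (simp add: abs_le_iff algebra_simps)
  ultimately show ?case unfolding mean_Suc by blast
qed (simp add: S_0)

lemma weighted_bound:
  assumes "v \<in> T" "u \<in> T" "i < m"
  shows "expect (S i) (\<lambda>ws. c ws v * pmf (K i ws) u) \<le> (real m + 2) * 2 ^ (m + 1) * \<kappa>\<^sup>2"
proof -
  have "\<kappa> \<ge> 0" using \<delta> by linarith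
  have "expect (S i) (\<lambda>ws. c ws v * pmf (K i ws) u) \<le> expect (S i) (\<lambda>ws. (real m + 2) * \<kappa> * c ws v)"
  proof (rule expect_mono_finite[OF finite_S])
    fix ws assume ws: "ws \<in> set_pmf (S i)"
    have "c ws u \<le> real m" using count_le[OF ws, of u] assms(3) by linarith
    hence "\<kappa> * c ws u \<le> \<kappa> * real m" using \<open>\<kappa> \<ge> 0\<close> by (intro mult_left_mono) auto
    hence "pmf (K i ws) u \<le> (real m + 2) * \<kappa>"
      using near'[OF assms(3) ws assms(2)] y[OF assms(2)] \<delta> by (simp add: algebra_simps)
    hence "c ws v * pmf (K i ws) u \<le> c ws v * ((real m + 2) * \<kappa>)" by (intro mult_left_mono) auto
    thus "c ws v * pmf (K i ws) u \<le> (real m + 2) * \<kappa> * c ws v" by (simp add: mult_ac)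
  qed
  also have "\<dots> = (real m + 2) * \<kappa> * expect (S i) (\<lambda>ws. c ws v)" by simp
  also have "\<dots> \<le> (real m + 2) * \<kappa> * (2 ^ (m + 1) * \<kappa>)"
    using assms \<open>\<kappa> \<ge> 0\<close> by (intro mult_left_mono mean_bound') auto
  finally show ?thesis by (simp add: power2_eq_square mult_ac)
qed

lemma dup_bound:
  assumes "v \<in> T"
  shows "i \<le> m \<Longrightarrow> expect (S i) (\<lambda>ws. c ws v * (c ws v - 1)) \<le> real i * (2 * ((real m + 2) * 2 ^ (m + 1) * \<kappa>\<^sup>2))"
proof (induction i)
  case (Suc i)
  have step: "p + 2 * q \<le> real (Suc i) * (2 * X)" if "q \<le> X" "p \<le> real i * (2 * X)" for p q X
    using that by (simp add: algebra_simps)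
  show ?case unfolding dup_Suc
    by (rule step[OF weighted_bound[OF assms assms] Suc.IH]) (use Suc.prems in auto)
qed (simp add: S_0)

lemma both_bound:
  assumes "v \<in> T" "u \<in> T" "v \<noteq> u"
  shows "i \<le> m \<Longrightarrow> expect (S i) (\<lambda>ws. c ws v * c ws u) \<le> real i * (2 * ((real m + 2) * 2 ^ (m + 1) * \<kappa>\<^sup>2))"
proof (induction i)
  case (Suc i)
  have step: "p + q + r \<le> real (Suc i) * (2 * X)" if "q \<le> X" "r \<le> X" "p \<le> real i * (2 * X)" for p q r X
    using that by (simp add: algebra_simps)
  show ?case unfolding both_Suc[OF assms(3)]
    by (rule step[OF weighted_bound[OF assms(1,2)] weighted_bound[OF assms(2,1)] Suc.IH]) (use Suc.prems in auto)
qed (simp add: S_0)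

end

end

text \<open>
  The sum of the constants in the bounds for the mean and for double hits, where \<open>\<kappa> = k / n\<close> and \<open>\<delta> = k / n\<^sup>2\<close>.
\<close>

definition near_constant :: "nat \<Rightarrow> nat \<Rightarrow> real" where
  "near_constant m d = (let k = 2 * real m + 2 * real d + 2 in
     real m * (k + 2 ^ (m + 1) * k\<^sup>2) + real m * (2 * ((real m + 2) * 2 ^ (m + 1) * k\<^sup>2)))"

lemma near_constant_nonneg: "0 \<le> near_constant m d"
  by (simp add: near_constant_def Let_def)

lemma attaches_at_rate_if_near:
  assumes law: "appended_law {1..n} S K" and n: "n \<ge> 1" "real n \<ge> 2 * real m + 2 * real d + 2" and m: "m \<ge> 1"
    and x: "\<And>e. e \<le> d \<Longrightarrow> 0 \<le> x e" "\<And>e. e \<le> d \<Longrightarrow> x e \<le> real m * (1 + real d)"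
    and near: "\<And>i ws v. i < m \<Longrightarrow> length ws = i \<Longrightarrow> set ws \<subseteq> {1..n} \<Longrightarrow> v \<in> {1..n} \<Longrightarrow> deg G v \<le> d \<Longrightarrow>
       \<bar>pmf (K i ws) v - x (deg G v) / (real m * real n)\<bar>
         \<le> (2 * real m + 2 * real d) / (real n)\<^sup>2 + 2 / real n * real (count (mset ws) v)"
  shows "attaches_at_rate x n G d (near_constant m d / real n) (S m)"
proof -
  interpret appended_law m "{1..n}" S K by (rule law)
  define k where "k = 2 * real m + 2 * real d + 2"
  define T where "T = {v \<in> {1..n}. deg G v \<le> d}"
  define \<kappa> \<delta> where "\<kappa> = k / real n" and "\<delta> = k / (real n)\<^sup>2"
  define y where "y v = x (deg G v) / (real m * real n)" for v
  have n1: "real n \<ge> 1" "real n > 0" using n by auto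
  have k2: "k \<ge> 2" by (simp add: k_def)
  have near_T: "\<bar>pmf (K i ws) v - y v\<bar> \<le> \<delta> + \<kappa> * real (count (mset ws) v)"
    if "i < m" "length ws = i" "set ws \<subseteq> {1..n}" "v \<in> T" for i ws v
  proof -
    have "\<bar>pmf (K i ws) v - y v\<bar> \<le> (2 * real m + 2 * real d) / (real n)\<^sup>2 + 2 / real n * real (count (mset ws) v)"
      unfolding y_def using that by (intro near) (auto simp: T_def)
    also have "\<dots> \<le> \<delta> + \<kappa> * real (count (mset ws) v)"
      unfolding \<delta>_def \<kappa>_def using k2 n1 by (intro add_mono mult_right_mono divide_right_mono) (auto simp: k_def)
    finally show ?thesis .
  qed
  have y_T: "0 \<le> y v" "y v \<le> \<kappa>" if "v \<in> T" for v
  proof -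
    show "0 \<le> y v" using that x by (auto simp: y_def T_def)
    have "y v \<le> real m * (1 + real d) / (real m * real n)"
      unfolding y_def using that x n1 by (intro divide_right_mono) (auto simp: T_def)
    also have "\<dots> = (1 + real d) / real n" using m by simp
    also have "\<dots> \<le> \<kappa>" unfolding \<kappa>_def using n1 by (intro divide_right_mono) (auto simp: k_def)
    finally show "y v \<le> \<kappa>" .
  qed
  have \<delta>: "0 \<le> \<delta>" "\<delta> \<le> \<kappa>" and \<kappa>: "\<kappa> \<le> 1"
  proof -
    show "0 \<le> \<delta>" using k2 by (simp add: \<delta>_def)
    have "real n * 1 \<le> real n * real n" using n1 by (intro mult_left_mono) auto
    thus "\<delta> \<le> \<kappa>" unfolding \<delta>_def \<kappa>_def using k2 n1 by (intro divide_left_mono) (auto simp: power2_eq_square)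
    show "\<kappa> \<le> 1" using n n1 by (simp add: \<kappa>_def k_def)
  qed
  note hyps = near_T y_T(1) y_T(2) \<delta> \<kappa>
  have sq: "\<kappa>\<^sup>2 = k\<^sup>2 / (real n)\<^sup>2" by (simp add: \<kappa>_def power_divide)
  define R1 where "R1 = real m * (k + 2 ^ (m + 1) * k\<^sup>2)"
  define R2 where "R2 = real m * (2 * ((real m + 2) * 2 ^ (m + 1) * k\<^sup>2))"
  have R: "near_constant m d = R1 + R2" by (simp add: near_constant_def Let_def k_def R1_def R2_def)
  have R_nonneg: "R1 \<ge> 0" "R2 \<ge> 0" using k2 by (auto simp: R1_def R2_def)
  have b1: "real m * (\<delta> + 2 ^ (m + 1) * \<kappa>\<^sup>2) = R1 / (real n)\<^sup>2"
    unfolding sq \<delta>_def R1_def by (simp add: add_divide_distrib distrib_left)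
  have b2: "real m * (2 * ((real m + 2) * 2 ^ (m + 1) * \<kappa>\<^sup>2)) = R2 / (real n)\<^sup>2"
    unfolding sq R2_def by simp
  have fin: "near_constant m d / real n / real n = R1 / (real n)\<^sup>2 + R2 / (real n)\<^sup>2"
    by (simp add: R power2_eq_square add_divide_distrib)
  have pos: "R1 / (real n)\<^sup>2 \<ge> 0" "R2 / (real n)\<^sup>2 \<ge> 0" using R_nonneg by auto
  show ?thesis
    unfolding attaches_at_rate_def fin
  proof (intro ballI impI conjI)
    fix v assume v: "v \<in> {1..n}" "deg G v \<le> d"
    hence vT: "v \<in> T" by (simp add: T_def)
    have "\<bar>expect (S m) (\<lambda>ws. real (count (mset ws) v)) - real m * y v\<bar> \<le> R1 / (real n)\<^sup>2"
      unfolding b1[symmetric] by (rule mean_near[OF hyps vT order_refl])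
    moreover have "real m * y v = x (deg G v) / real n" using m by (simp add: y_def)
    ultimately show "\<bar>expect (S m) (\<lambda>ws. real (count (mset ws) v)) - x (deg G v) / real n\<bar> \<le> R1 / (real n)\<^sup>2 + R2 / (real n)\<^sup>2"
      using pos by simp
    have "expect (S m) (\<lambda>ws. c ws v * (c ws v - 1)) \<le> R2 / (real n)\<^sup>2"
      unfolding b2[symmetric] by (rule dup_bound[OF hyps vT order_refl])
    thus "expect (S m) (\<lambda>ws. c ws v * (c ws v - 1)) \<le> R1 / (real n)\<^sup>2 + R2 / (real n)\<^sup>2" using pos by simp
    fix u assume u: "u \<in> {1..n}" "deg G u \<le> d" "u \<noteq> v"
    hence uT: "u \<in> T" by (simp add: T_def)
    have "expect (S m) (\<lambda>ws. c ws v * c ws u) \<le> R2 / (real n)\<^sup>2"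
      unfolding b2[symmetric] by (rule both_bound[OF hyps vT uT u(3)[symmetric] order_refl])
    thus "expect (S m) (\<lambda>ws. c ws v * c ws u) \<le> R1 / (real n)\<^sup>2 + R2 / (real n)\<^sup>2" using pos by simp
  qed
qed

lemma near_constant_vanishes: "(\<lambda>n. near_constant m d / real n) \<longlonglongrightarrow> 0"
  using tendsto_mult_left[OF lim_1_over_n, of "near_constant m d"] by simp

text \<open>
  With \<open>u = \<alpha> / (1 - \<alpha>)\<close> one has \<open>1 / \<psi> = 1 + 2 u = (1 + \<alpha>) / (1 - \<alpha>)\<close> and \<open>m + 2 m u = m \<beta>\<close>.
\<close>

locale pa_parameters =
  fixes m :: nat and \<alpha> \<beta> a :: real
  assumes m_ge_2: "m \<ge> 2" and \<alpha>: "0 \<le> \<alpha>" "\<alpha> < 1"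
    and \<beta>_def: "\<beta> = (1 + \<alpha>) / (1 - \<alpha>)" and a_def: "a = real m * \<beta>"

sublocale pa_parameters \<subseteq> limit_law m a \<beta>
  using m_ge_2 \<alpha> by unfold_locales (auto simp: \<beta>_def a_def field_simps)

context pa_parameters
begin

text \<open>
  So \<open>rate d / n\<close> is \<open>m\<close> times the probability \<open>\<alpha> / n + (1 - \<alpha>) d / (2 m n)\<close> to be chosen by one edge.
\<close>

lemma rate_eq: "rate d = real m * \<alpha> + (1 - \<alpha>) * real d / 2"
proof -
  have "1 + \<beta> = 2 / (1 - \<alpha>)" using \<alpha> by (simp add: \<beta>_def field_simps)
  have "rate d = (real d - real m + a) / (1 + \<beta>)" by (rule rate_def)
  also have "\<dots> = (real d - real m + real m * \<beta>) * (1 - \<alpha>) / 2"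
    unfolding \<open>1 + \<beta> = 2 / (1 - \<alpha>)\<close> unfolding a_def by simp
  also have "(real d - real m + real m * \<beta>) * (1 - \<alpha>) / 2 = ((real d - real m) * (1 - \<alpha>) + real m * (1 + \<alpha>)) / 2"
  proof -
    have "\<beta> * (1 - \<alpha>) = 1 + \<alpha>" using \<alpha> by (simp add: \<beta>_def)
    thus ?thesis by (simp only: distrib_right mult.assoc)
  qed
  finally have "2 * rate d = (real d - real m) * (1 - \<alpha>) + real m * (1 + \<alpha>)" by simp
  also have "\<dots> = 2 * (real m * \<alpha>) + (1 - \<alpha>) * real d" by (simp add: algebra_simps)
  finally show ?thesis by simp
qed

lemma rate_le: "e \<le> d \<Longrightarrow> rate e \<le> real m * (1 + real d)"
proof -
  assume e: "e \<le> d"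
  have "real m * \<alpha> \<le> real m * 1" using \<alpha> by (intro mult_left_mono) auto
  moreover have "(1 - \<alpha>) * real e \<le> 1 * real d" using \<alpha> e by (intro mult_mono) auto
  moreover have "real d \<le> real m * real d" using m_ge_2 mult_right_mono[of 1 "real m" "real d"] by simp
  ultimately show ?thesis unfolding rate_eq by (simp add: distrib_left)
qed

lemma first_graphs_range: "set_mset (first_graphs m 2) \<subseteq> {1..2} \<times> {1..2}"
  by (auto simp: first_graphs_def)

lemma size_first_graph: "size (first_graphs m 2) = m"
  by (simp add: first_graphs_def)

lemma independent_appended_law:
  assumes "n \<ge> 1" "set_mset G \<subseteq> {1..n} \<times> {1..n}"
  shows "appended_law {1..n} (\<lambda>i. replicate_pmf i (choose_vertex \<alpha> (Suc n) (endpoints G)))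
     (\<lambda>i ws. choose_vertex \<alpha> (Suc n) (endpoints G))"
  by unfold_locales
    (use set_pmf_choose_vertex[OF assms(1) endpoints_range[OF assms(2)]] in
      \<open>auto simp: replicate_pmf_Suc_append simp del: replicate_pmf.simps(2)\<close>)

lemma sequential_appended_law:
  assumes "n \<ge> 1" "set_mset G \<subseteq> {1..n} \<times> {1..n}"
  shows "appended_law {1..n} (sequential_choice m \<alpha> (Suc n) G)
     (\<lambda>i ws. choose_vertex (alpha_tilde m \<alpha> (Suc n) (Suc i)) (Suc n) (endpoints G + mset ws))"
proof
  fix i :: nat and ws :: "nat list" assume "set ws \<subseteq> {1..n}"
  thus "set_pmf (choose_vertex (alpha_tilde m \<alpha> (Suc n) (Suc i)) (Suc n) (endpoints G + mset ws)) \<subseteq> {1..n}"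
    using endpoints_range[OF assms(2)] by (intro set_pmf_choose_vertex assms) auto
qed auto

text \<open>
  The part that the independent and the sequential model have in common.
\<close>

lemma multi_edge_rate_driven:
  fixes S :: "nat \<Rightarrow> mgraph \<Rightarrow> nat \<Rightarrow> nat list pmf" and K :: "nat \<Rightarrow> mgraph \<Rightarrow> nat \<Rightarrow> nat list \<Rightarrow> nat pmf"
  assumes law: "\<And>n G. n \<ge> 1 \<Longrightarrow> set_mset G \<subseteq> {1..n} \<times> {1..n} \<Longrightarrow> appended_law {1..n} (S n G) (K n G)"
    and choice: "\<And>n G. choice (Suc n) G = S n G m"
    and near: "\<And>n G d i ws v. n \<ge> 2 \<Longrightarrow> real (size (endpoints G)) = 2 * real m * (real n - 1) \<Longrightarrow> i < m \<Longrightarrow>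
       length ws = i \<Longrightarrow> v \<in> {1..n} \<Longrightarrow> deg G v \<le> d \<Longrightarrow>
       \<bar>pmf (K n G i ws) v - rate (deg G v) / (real m * real n)\<bar>
         \<le> (2 * real m + 2 * real d) / (real n)\<^sup>2 + 2 / real n * real (count (mset ws) v)"
  shows "rate_driven_graph m a \<beta> 2 choice (first_graphs m) (\<lambda>d n _. near_constant m d / real n)"
proof -
  have g: "growing_graph m 2 choice (first_graphs m)"
  proof
    fix n G ws assume *: "2 \<le> n" "set_mset G \<subseteq> {1..n} \<times> {1..n}" "ws \<in> set_pmf (choice (Suc n) G)"
    interpret appended_law m "{1..n}" "S n G" "K n G" using * by (intro law) auto
    show "length ws = m \<and> set ws \<subseteq> {1..n}" using S_range *(3) by (simp add: choice)
  qed (use m_ge_2 first_graphs_range in auto)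
  interpret growing_graph m 2 choice "first_graphs m" by (rule g)
  show ?thesis
  proof (intro rate_driven_graph.intro rate_driven_graph_axioms.intro g)
    show "limit_law m a \<beta>" by unfold_locales
    show "0 \<le> near_constant m d / real n" for d n using near_constant_nonneg by simp
    show "(\<lambda>n. expect (law n) (\<lambda>_. near_constant m d / real n)) \<longlonglongrightarrow> 0" for d
      using near_constant_vanishes by simp
    fix d
    have "\<forall>\<^sub>F n in sequentially. real n \<ge> 2 * real m + 2 * real d + 2" by real_asymp
    thus "\<forall>\<^sub>F n in sequentially. \<forall>G\<in>set_pmf (law n).
        attaches_at_rate rate n G d (near_constant m d / real n) (choice (Suc n) G)"
      using eventually_ge_at_top[of 2]
    proof (eventually_elim, intro ballI)
      fix n G assume n: "real n \<ge> 2 * real m + 2 * real d + 2" "2 \<le> n" and G: "G \<in> set_pmf (law n)"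
      have "size G = m * (n - 1)"
        using size_graph[OF n(2) G] n(2) size_first_graph by (cases n) (auto simp: algebra_simps)
      hence sz: "real (size (endpoints G)) = 2 * real m * (real n - 1)" using n(2) by (simp add: size_endpoints of_nat_diff)
      show "attaches_at_rate rate n G d (near_constant m d / real n) (choice (Suc n) G)"
        unfolding choice
        by (rule attaches_at_rate_if_near[OF assms(1)])
          (use n sz near graph_range[OF n(2) G] m_ge_2 rate_nonneg rate_le in auto)
    qed
  qed
qed

text \<open>
  The sum of the degrees is \<open>2 m (n - 1)\<close>, and replacing it by \<open>2 m n\<close> changes the probability by order \<open>1 / n\<^sup>2\<close>.
\<close>

lemma independent_near:
  assumes n: "n \<ge> 2" and sz: "real (size (endpoints G)) = 2 * real m * (real n - 1)"
    and v: "v \<in> {1..n}" "deg G v \<le> d"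
  shows "\<bar>pmf (choose_vertex \<alpha> (Suc n) (endpoints G)) v - rate (deg G v) / (real m * real n)\<bar>
    \<le> (2 * real m + 2 * real d) / (real n)\<^sup>2 + 2 / real n * real (count (mset ws) v)"
proof -
  have ne: "endpoints G \<noteq> {#}" using sz m_ge_2 n by force
  have "pmf (choose_vertex \<alpha> (Suc n) (endpoints G)) v - rate (deg G v) / (real m * real n) =
      (1 - \<alpha>) * (real (deg G v) / (2 * real m)) * (1 / (real n - 1) - 1 / real n)"
    using v n m_ge_2 \<alpha> ne unfolding rate_eq
    by (subst pmf_choose_vertex) (auto simp: sz deg_def[symmetric] field_simps)
  also have "1 / (real n - 1) - 1 / real n = 1 / ((real n - 1) * real n)"
    using n by (simp add: divide_simps)
  also have "\<bar>(1 - \<alpha>) * (real (deg G v) / (2 * real m)) * (1 / ((real n - 1) * real n))\<bar>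
      \<le> 1 * real d * (2 / (real n)\<^sup>2)"
  proof -
    have "real (deg G v) / (2 * real m) \<le> real d / 1" using v m_ge_2 by (intro frac_le) auto
    moreover have "1 / ((real n - 1) * real n) \<le> 2 / (real n)\<^sup>2" using n
      by (simp add: divide_simps power2_eq_square)
    ultimately show ?thesis using \<alpha> n unfolding abs_mult
      by (intro mult_mono) auto
  qed
  also have "1 * real d * (2 / (real n)\<^sup>2) = (2 * real d) / (real n)\<^sup>2" by simp
  also have "\<dots> \<le> (2 * real m + 2 * real d) / (real n)\<^sup>2" by (intro divide_right_mono) auto
  finally show "\<bar>pmf (choose_vertex \<alpha> (Suc n) (endpoints G)) v - rate (deg G v) / (real m * real n)\<bar>
      \<le> (2 * real m + 2 * real d) / (real n)\<^sup>2 + 2 / real n * real (count (mset ws) v)"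
    by (simp add: add_increasing2)
qed

text \<open>
  Thanks to the modified mixing weight, the probability of a vertex with current degree \<open>h\<close> is a single quotient
  \<open>(2 m \<alpha> + (1 - \<alpha>) h) / E\<close> whose denominator differs from \<open>2 m n\<close> by at most a constant.
\<close>

lemma sequential_near:
  assumes n: "n \<ge> 2" and sz: "real (size (endpoints G)) = 2 * real m * (real n - 1)"
    and i: "i < m" "length ws = i" and v: "v \<in> {1..n}" "deg G v \<le> d"
  shows "\<bar>pmf (choose_vertex (alpha_tilde m \<alpha> (Suc n) (Suc i)) (Suc n) (endpoints G + mset ws)) v
      - rate (deg G v) / (real m * real n)\<bar>
    \<le> (2 * real m + 2 * real d) / (real n)\<^sup>2 + 2 / real n * real (count (mset ws) v)"
proof -
  have ne: "endpoints G \<noteq> {#}" using sz m_ge_2 n by force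
  define Z where "Z = 2 * real m * (real n - 1) + real i"
  define E where "E = 2 * real m * (real n - 1) + 2 * real m * \<alpha> + (1 - \<alpha>) * real i"
  define h where "h = real (deg G v) + real (count (mset ws) v)"
  have base: "2 * real m * (real n - 1) > 0" using m_ge_2 n by simp
  have E_ge: "E \<ge> 2 * real m * (real n - 1)" using \<alpha> by (simp add: E_def)
  have E0: "E > 0" "Z > 0" using base E_ge by (auto simp: Z_def)
  have at: "alpha_tilde m \<alpha> (Suc n) (Suc i) = 2 * real m * real n * \<alpha> / E"
    by (simp add: alpha_tilde_def E_def algebra_simps)
  \<comment> \<open>This is what the correction of the mixing weight is for: the two branches add up to a single quotient.\<close>
  have EZ: "E - 2 * real m * real n * \<alpha> = (1 - \<alpha>) * Z" by (simp add: E_def Z_def algebra_simps)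
  have "0 \<le> (1 - \<alpha>) * Z" using \<alpha> E0 by simp
  hence le1: "2 * real m * real n * \<alpha> / E \<le> 1" using E0 EZ by (simp add: divide_le_eq)
  have ge0: "0 \<le> 2 * real m * real n * \<alpha> / E" using \<alpha> E0 by simp
  have szw: "real (size (endpoints G + mset ws)) = Z" using i sz by (simp add: Z_def)
  have "pmf (choose_vertex (alpha_tilde m \<alpha> (Suc n) (Suc i)) (Suc n) (endpoints G + mset ws)) v =
      2 * real m * real n * \<alpha> / E * (1 / real n) + (1 - 2 * real m * real n * \<alpha> / E) * (h / Z)"
    unfolding at using v n ne le1 ge0 by (subst pmf_choose_vertex) (auto simp: szw[simplified] h_def deg_def)
  also have "1 - 2 * real m * real n * \<alpha> / E = (1 - \<alpha>) * Z / E"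
    unfolding EZ[symmetric] using E0 by (simp add: diff_divide_distrib)
  also have "2 * real m * real n * \<alpha> / E * (1 / real n) + (1 - \<alpha>) * Z / E * (h / Z) = (2 * real m * \<alpha> + (1 - \<alpha>) * h) / E"
    using E0 n by (simp add: add_divide_distrib)
  finally have p: "pmf (choose_vertex (alpha_tilde m \<alpha> (Suc n) (Suc i)) (Suc n) (endpoints G + mset ws)) v =
      (2 * real m * \<alpha> + (1 - \<alpha>) * real (deg G v)) / E + (1 - \<alpha>) * real (count (mset ws) v) / E"
    by (simp add: h_def add_divide_distrib distrib_left)
  define A where "A = 2 * real m * \<alpha> + (1 - \<alpha>) * real (deg G v)"
  have A: "0 \<le> A" "A \<le> 2 * real m + real d"
  proof -
    show "0 \<le> A" using \<alpha> by (simp add: A_def)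
    have "2 * real m * \<alpha> \<le> 2 * real m * 1" using \<alpha> by (intro mult_left_mono) auto
    moreover have "(1 - \<alpha>) * real (deg G v) \<le> 1 * real d" using \<alpha> v by (intro mult_mono) auto
    ultimately show "A \<le> 2 * real m + real d" by (simp add: A_def)
  qed
  have r: "rate (deg G v) / (real m * real n) = A / (2 * real m * real n)"
    using m_ge_2 n by (simp add: rate_eq A_def field_simps)
  have "\<bar>A / E - A / (2 * real m * real n)\<bar> = A * (\<bar>2 * real m * real n - E\<bar> / (E * (2 * real m * real n)))"
  proof -
    have nz: "2 * real m * real n > 0" using m_ge_2 n by simp
    have "A / E - A / Y = A * ((Y - E) / (E * Y))" if "Y > 0" for Y
      using that E0 by (simp add: diff_frac_eq right_diff_distrib)
    from this[OF nz]
    have "A / E - A / (2 * real m * real n) = A * ((2 * real m * real n - E) / (E * (2 * real m * real n)))" .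
    thus ?thesis using A E0 nz by (simp add: abs_mult)
  qed
  also have "\<dots> \<le> (2 * real m + real d) * (1 / (real n)\<^sup>2)"
  proof (rule mult_mono)
    have "2 * real m * real n - E = 2 * real m * (1 - \<alpha>) - (1 - \<alpha>) * real i" by (simp add: E_def algebra_simps)
    also have "\<dots> = (1 - \<alpha>) * (2 * real m - real i)" by (simp add: algebra_simps)
    also have "\<bar>\<dots>\<bar> \<le> 1 * (2 * real m)" unfolding abs_mult using \<alpha> i by (intro mult_mono) auto
    finally have "\<bar>2 * real m * real n - E\<bar> / (E * (2 * real m * real n)) \<le>
        (2 * real m) / (2 * real m * (real n - 1) * (2 * real m * real n))"
      using E_ge base m_ge_2 n by (intro frac_le mult_right_mono mult_pos_pos) auto
    also have "\<dots> = 1 / (2 * real m * ((real n - 1) * real n))" using m_ge_2 n by (simp add: field_simps)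
    also have "\<dots> \<le> 1 / (real n)\<^sup>2"
    proof (rule divide_left_mono)
      have "real n \<le> 2 * (real n - 1)" using n by simp
      also have "\<dots> \<le> 2 * real m * (real n - 1)" using m_ge_2 n by (intro mult_right_mono) auto
      finally have "real n * real n \<le> 2 * real m * (real n - 1) * real n" by (intro mult_right_mono) auto
      thus "(real n)\<^sup>2 \<le> 2 * real m * ((real n - 1) * real n)" by (simp add: power2_eq_square mult.assoc)
    qed (use m_ge_2 n in auto)
    finally show "\<bar>2 * real m * real n - E\<bar> / (E * (2 * real m * real n)) \<le> 1 / (real n)\<^sup>2" .
  qed (use A E0 in auto)
  finally have 1: "\<bar>A / E - A / (2 * real m * real n)\<bar> \<le> (2 * real m + real d) * (1 / (real n)\<^sup>2)" .
  have "real n \<le> E"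
  proof -
    have "real n \<le> 2 * (real n - 1)" using n by simp
    also have "\<dots> \<le> 2 * real m * (real n - 1)" using m_ge_2 n by (intro mult_right_mono) auto
    finally show ?thesis using E_ge by linarith
  qed
  hence 2: "(1 - \<alpha>) * real (count (mset ws) v) / E \<le> (1 * real (count (mset ws) v)) / real n"
    using \<alpha> n by (intro frac_le mult_right_mono) auto
  show "\<bar>pmf (choose_vertex (alpha_tilde m \<alpha> (Suc n) (Suc i)) (Suc n) (endpoints G + mset ws)) v
      - rate (deg G v) / (real m * real n)\<bar>
      \<le> (2 * real m + 2 * real d) / (real n)\<^sup>2 + 2 / real n * real (count (mset ws) v)"
  proof -
    have "(2 * real m + real d) * (1 / (real n)\<^sup>2) \<le> (2 * real m + 2 * real d) / (real n)\<^sup>2"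
      by (simp add: divide_right_mono)
    moreover have "(1 * real (count (mset ws) v)) / real n \<le> 2 / real n * real (count (mset ws) v)"
      by (simp add: divide_right_mono)
    moreover have "0 \<le> (1 - \<alpha>) * real (count (mset ws) v) / E" using \<alpha> E0 by simp
    ultimately show ?thesis using 1 2 unfolding p r A_def[symmetric] by linarith
  qed
qed

lemma independent_rate_driven:
  "rate_driven_graph m a \<beta> 2 (independent_choice m \<alpha>) (first_graphs m) (\<lambda>d n _. near_constant m d / real n)"
  by (rule multi_edge_rate_driven[OF independent_appended_law _ independent_near])
    (auto simp: independent_choice_def)

lemma sequential_rate_driven:
  "rate_driven_graph m a \<beta> 2 (\<lambda>k G. sequential_choice m \<alpha> k G m) (first_graphs m)
     (\<lambda>d n _. near_constant m d / real n)"
  by (rule multi_edge_rate_driven[OF sequential_appended_law _ sequential_near]) auto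

end

section \<open>Independent receivers conditioned on being distinct\<close>
text \<open>
  Receivers drawn independently from \<open>P\<close>; the conditional model conditions their law on distinctness.
\<close>

locale iid_law =
  fixes P :: "nat pmf" and B :: "nat set"
  assumes fin_B: "finite B" and P_range: "set_pmf P \<subseteq> B"

sublocale iid_law \<subseteq> appended_law m B "\<lambda>i. replicate_pmf i P" "\<lambda>i ws. P" for m
  using fin_B P_range by unfold_locales (simp_all add: replicate_pmf_Suc_append del: replicate_pmf.simps(2))

context iid_law
begin

abbreviation "S i \<equiv> replicate_pmf i P"
abbreviation "p \<equiv> pmf P"

text \<open>
  The probability that two independent draws agree.
\<close>

definition collision :: real where "collision = (\<Sum>x\<in>B. (p x)\<^sup>2)"

definition distinct_prob :: "nat \<Rightarrow> real" where
  "distinct_prob i = expect (S i) (\<lambda>ws. of_bool (distinct ws))"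

lemma collision_nonneg: "0 \<le> collision"
  unfolding collision_def by (intro sum_nonneg) auto

lemma expect_P: "expect P f = (\<Sum>x\<in>B. f x * p x)" for f :: "nat \<Rightarrow> real"
  using fin_B P_range by (intro integral_measure_pmf_real) auto

lemma iid_mean: "expect (S i) (\<lambda>ws. c ws v) = real i * p v"
proof (induction i)
  case (Suc i)
  show ?case unfolding mean_Suc Suc by (simp add: algebra_simps)
qed (simp add: S_0 del: replicate_pmf.simps(2))

lemma iid_dup: "expect (S i) (\<lambda>ws. c ws v * (c ws v - 1)) \<le> (real i)\<^sup>2 * (p v)\<^sup>2"
proof (induction i)
  case (Suc i)
  have "expect (S (Suc i)) (\<lambda>ws. c ws v * (c ws v - 1)) =
      expect (S i) (\<lambda>ws. c ws v * (c ws v - 1)) + 2 * (real i * p v * p v)"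
    unfolding dup_Suc by (simp add: iid_mean)
  also have "\<dots> \<le> (real i)\<^sup>2 * (p v)\<^sup>2 + 2 * (real i * p v * p v)" using Suc by simp
  also have "\<dots> \<le> (real (Suc i))\<^sup>2 * (p v)\<^sup>2" by (simp add: power2_eq_square algebra_simps)
  finally show ?case .
qed simp

lemma iid_both: "v \<noteq> x \<Longrightarrow> expect (S i) (\<lambda>ws. c ws v * c ws x) \<le> (real i)\<^sup>2 * (p v * p x)"
proof (induction i)
  case (Suc i)
  have "expect (S (Suc i)) (\<lambda>ws. c ws v * c ws x) = expect (S i) (\<lambda>ws. c ws v * c ws x) + 2 * (real i * (p v * p x))"
    unfolding both_Suc[OF Suc.prems] by (simp add: iid_mean mult_ac)
  also have "\<dots> \<le> (real i)\<^sup>2 * (p v * p x) + 2 * (real i * (p v * p x))" using Suc by simp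
  also have "\<dots> \<le> (real (Suc i))\<^sup>2 * (p v * p x)" by (simp add: power2_eq_square algebra_simps)
  finally show ?case .
qed simp

lemma iid_product: "expect (S i) (\<lambda>ws. c ws v * c ws x) \<le> (real i)\<^sup>2 * (p v * p x) + of_bool (x = v) * (real i * p v)"
proof (cases "x = v")
  case True
  have "expect (S i) (\<lambda>ws. c ws v * c ws v) = expect (S i) (\<lambda>ws. c ws v * (c ws v - 1) + c ws v)"
    by (simp add: algebra_simps)
  also have "\<dots> = expect (S i) (\<lambda>ws. c ws v * (c ws v - 1)) + real i * p v"
    using finite_S by (simp add: expect_add_finite iid_mean)
  finally show ?thesis using iid_dup[of i v] True by (simp add: power2_eq_square)
qed (use iid_both[of v x i] in simp)

lemma weighted_count: "expect (S i) (\<lambda>ws. f ws * expect P (\<lambda>w. c ws w)) = (\<Sum>x\<in>B. p x * expect (S i) (\<lambda>ws. f ws * c ws x))"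
proof -
  have "(\<lambda>ws. f ws * expect P (\<lambda>w. c ws w)) = (\<lambda>ws. \<Sum>x\<in>B. p x * (f ws * c ws x))"
    unfolding expect_P sum_distrib_left by (simp add: mult_ac)
  thus ?thesis using finite_S by (simp add: expect_linear_sum)
qed

lemma not_distinct_append:
  "of_bool (\<not> distinct (ws @ [w])) \<le> of_bool (\<not> distinct ws) + c ws w"
proof (cases "w \<in> set ws")
  case True
  hence "count (mset ws) w \<ge> 1" by (simp add: Suc_le_eq)
  thus ?thesis by (auto simp: of_bool_def)
qed auto

lemma collision_prob: "expect (S i) (\<lambda>ws. of_bool (\<not> distinct ws)) \<le> (real i)\<^sup>2 * collision"
proof (induction i)
  case (Suc i)
  have "expect (S (Suc i)) (\<lambda>ws. of_bool (\<not> distinct ws)) \<le>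
      expect (S i) (\<lambda>ws. of_bool (\<not> distinct ws) + 1 * expect P (\<lambda>w. c ws w))"
    unfolding expect_S_Suc
  proof (rule expect_mono_finite[OF finite_S])
    fix ws assume ws: "ws \<in> set_pmf (S i)"
    have "expect P (\<lambda>w. of_bool (\<not> distinct (ws @ [w]))) \<le> expect P (\<lambda>w. of_bool (\<not> distinct ws) + c ws w)"
      by (intro expect_mono_finite not_distinct_append) (use finite_K[OF ws] in auto)
    also have "\<dots> = of_bool (\<not> distinct ws) + 1 * expect P (\<lambda>w. c ws w)"
      using finite_K[OF ws] by (simp add: expect_add_finite)
    finally show "expect P (\<lambda>w. of_bool (\<not> distinct (ws @ [w]))) \<le> of_bool (\<not> distinct ws) + 1 * expect P (\<lambda>w. c ws w)" .
  qed
  also have "\<dots> = expect (S i) (\<lambda>ws. of_bool (\<not> distinct ws)) + (\<Sum>x\<in>B. p x * (real i * p x))"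
    using finite_S weighted_count[of i "\<lambda>_. 1"] by (simp add: expect_add_finite iid_mean)
  also have "(\<Sum>x\<in>B. p x * (real i * p x)) = real i * collision"
    unfolding collision_def sum_distrib_left by (simp add: power2_eq_square mult_ac)
  also have "expect (S i) (\<lambda>ws. of_bool (\<not> distinct ws)) + real i * collision \<le> (real i)\<^sup>2 * collision + real i * collision"
    using Suc by simp
  also have "\<dots> \<le> (real (Suc i))\<^sup>2 * collision"
    using collision_nonneg by (simp add: power2_eq_square algebra_simps)
  finally show ?case .
qed simp

text \<open>
  If \<open>v\<close> is drawn and some pair of draws agrees, then either \<open>v\<close> is drawn twice, or \<open>v\<close> is drawn and two other draws
  agree. Both cases come out of a recursion over the appended draws.
\<close>

lemma count_collision:
  assumes "v \<in> B"
  shows "i \<le> m \<Longrightarrow> expect (S i) (\<lambda>ws. c ws v * of_bool (\<not> distinct ws)) \<le> real i * (2 * (real m)\<^sup>2 * (p v * collision + (p v)\<^sup>2))"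
proof (induction i)
  case (Suc i)
  let ?nd = "\<lambda>ws. of_bool (\<not> distinct ws) :: real"
  have "expect (S (Suc i)) (\<lambda>ws. c ws v * ?nd ws) \<le>
      expect (S i) (\<lambda>ws. c ws v * ?nd ws + c ws v * expect P (\<lambda>w. c ws w) + p v * ?nd ws + p v * c ws v)"
    unfolding expect_S_Suc
  proof (rule expect_mono_finite[OF finite_S])
    fix ws assume ws: "ws \<in> set_pmf (S i)"
    have "expect P (\<lambda>w. c (ws @ [w]) v * ?nd (ws @ [w])) \<le>
       expect P (\<lambda>w. c ws v * ?nd ws + c ws v * c ws w + of_bool (w = v) * (?nd ws + c ws v))"
    proof (rule expect_mono_finite)
      show "finite (set_pmf P)" using finite_K[OF ws] .
      fix w
      have "c (ws @ [w]) v * ?nd (ws @ [w]) = c ws v * ?nd (ws @ [w]) + of_bool (w = v) * ?nd (ws @ [w])"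
        unfolding count_append_one by (simp add: distrib_right)
      also have "\<dots> \<le> c ws v * (?nd ws + c ws w) + of_bool (w = v) * (?nd ws + c ws w)"
        by (intro add_mono mult_left_mono not_distinct_append) auto
      also have "\<dots> = c ws v * ?nd ws + c ws v * c ws w + of_bool (w = v) * (?nd ws + c ws v)"
        by (cases "w = v") (simp_all add: distrib_left)
      finally show "c (ws @ [w]) v * ?nd (ws @ [w]) \<le> c ws v * ?nd ws + c ws v * c ws w + of_bool (w = v) * (?nd ws + c ws v)" .
    qed
    also have "\<dots> = c ws v * ?nd ws + c ws v * expect P (\<lambda>w. c ws w) + p v * ?nd ws + p v * c ws v"
      using finite_K[OF ws] by (simp add: expect_add_finite expect_of_bool_eq distrib_left)
    finally show "expect P (\<lambda>w. c (ws @ [w]) v * ?nd (ws @ [w])) \<le>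
        c ws v * ?nd ws + c ws v * expect P (\<lambda>w. c ws w) + p v * ?nd ws + p v * c ws v" .
  qed
  also have "\<dots> = expect (S i) (\<lambda>ws. c ws v * ?nd ws) + (\<Sum>x\<in>B. p x * expect (S i) (\<lambda>ws. c ws v * c ws x))
      + p v * expect (S i) ?nd + p v * (real i * p v)"
    using finite_S by (simp add: expect_add_finite iid_mean weighted_count)
  also have "(\<Sum>x\<in>B. p x * expect (S i) (\<lambda>ws. c ws v * c ws x)) \<le>
      (\<Sum>x\<in>B. p x * ((real i)\<^sup>2 * (p v * p x) + of_bool (x = v) * (real i * p v)))"
    by (intro sum_mono mult_left_mono iid_product) auto
  also have "\<dots> = (real i)\<^sup>2 * p v * collision + real i * (p v)\<^sup>2"
  proof -
    have "(\<Sum>x\<in>B. p x * (of_bool (x = v) * (real i * p v))) = (\<Sum>x\<in>B. if x = v then p x * (real i * p v) else 0)"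
      by (intro sum.cong) auto
    also have "\<dots> = real i * (p v)\<^sup>2" using fin_B assms by (simp add: power2_eq_square)
    finally have 1: "(\<Sum>x\<in>B. p x * (of_bool (x = v) * (real i * p v))) = real i * (p v)\<^sup>2" .
    have 2: "(\<Sum>x\<in>B. p x * ((real i)\<^sup>2 * (p v * p x))) = (real i)\<^sup>2 * p v * collision"
      unfolding collision_def sum_distrib_left by (simp add: power2_eq_square mult_ac)
    show ?thesis by (simp only: distrib_left sum.distrib 1 2)
  qed
  also have "p v * expect (S i) ?nd \<le> p v * ((real i)\<^sup>2 * collision)"
    by (intro mult_left_mono collision_prob) auto
  also have "expect (S i) (\<lambda>ws. c ws v * ?nd ws) + ((real i)\<^sup>2 * p v * collision + real i * (p v)\<^sup>2)
       + p v * ((real i)\<^sup>2 * collision) + p v * (real i * p v)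
     = expect (S i) (\<lambda>ws. c ws v * ?nd ws) + (2 * (real i)\<^sup>2 * (p v * collision) + 2 * real i * (p v)\<^sup>2)"
    by (simp add: power2_eq_square)
  also have "\<dots> \<le> real i * (2 * (real m)\<^sup>2 * (p v * collision + (p v)\<^sup>2)) + (2 * (real m)\<^sup>2 * (p v * collision) + 2 * (real m)\<^sup>2 * (p v)\<^sup>2)"
  proof -
    have "(real i)\<^sup>2 \<le> (real m)\<^sup>2" using Suc.prems by (intro power_mono) auto
    moreover have "real i \<le> (real m)\<^sup>2"
      using Suc.prems mult_mono[of 1 "real m" "real i" "real m"] by (simp add: power2_eq_square)
    ultimately show ?thesis using Suc collision_nonneg
      by (intro add_mono mult_right_mono mult_left_mono) auto
  qed
  also have "\<dots> = real (Suc i) * (2 * (real m)\<^sup>2 * (p v * collision + (p v)\<^sup>2))" by (simp add: algebra_simps)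
  finally show ?case by simp
qed simp

text \<open>
  The last draw avoids \<open>i\<close> distinct values, each of probability at most \<open>q\<close>.
\<close>

lemma distinct_prob_Suc:
  assumes "\<And>v. p v \<le> q"
  shows "distinct_prob (Suc i) \<ge> (1 - real i * q) * distinct_prob i"
proof -
  have "(1 - real i * q) * distinct_prob i = expect (S i) (\<lambda>ws. (1 - real i * q) * of_bool (distinct ws))"
    by (simp add: distinct_prob_def)
  also have "\<dots> \<le> expect (S i) (\<lambda>ws. expect P (\<lambda>w. of_bool (distinct (ws @ [w]))))"
  proof (rule expect_mono_finite[OF finite_S])
    fix ws assume ws: "ws \<in> set_pmf (S i)"
    show "(1 - real i * q) * of_bool (distinct ws) \<le> expect P (\<lambda>w. of_bool (distinct (ws @ [w])))"
    proof (cases "distinct ws")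
      case True
      have "(\<lambda>w. of_bool (distinct (ws @ [w])) :: real) = (\<lambda>w. 1 - indicator (set ws) w)"
        using True by (auto simp: fun_eq_iff indicator_def)
      hence "expect P (\<lambda>w. of_bool (distinct (ws @ [w]))) = 1 - measure_pmf.prob P (set ws)"
        using finite_K[OF ws] by (simp add: expect_diff_finite)
      moreover have "measure_pmf.prob P (set ws) = (\<Sum>x\<in>set ws. p x)" by (rule measure_measure_pmf_finite) simp
      moreover have "\<dots> \<le> (\<Sum>x\<in>set ws. q)" by (intro sum_mono assms)
      moreover have "card (set ws) = i" using True S_range[OF ws] distinct_card by metis
      ultimately show ?thesis using True by simp
    qed (simp add: expect_nonneg)
  qed
  also have "\<dots> = distinct_prob (Suc i)" unfolding distinct_prob_def expect_S_Suc ..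
  finally show ?thesis .
qed

lemma distinct_prob_0: "distinct_prob 0 = 1"
  by (simp add: distinct_prob_def)

lemma distinct_prob_lower:
  assumes "\<And>v. p v \<le> q" "0 \<le> q" "(real m - 1) * q \<le> 1 / 2"
  shows "i \<le> m \<Longrightarrow> distinct_prob i \<ge> 1 / 2 ^ i"
proof (induction i)
  case (Suc i)
  have "real i * q \<le> (real m - 1) * q" using Suc.prems assms by (intro mult_right_mono) auto
  hence "1 / 2 \<le> 1 - real i * q" using assms by simp
  hence "1 / 2 * (1 / 2 ^ i) \<le> (1 - real i * q) * distinct_prob i" using Suc by (intro mult_mono) auto
  thus ?case using distinct_prob_Suc[OF assms(1), of i] by simp
qed (simp add: distinct_prob_0)

text \<open>
  Independent draws are exchangeable, and cyclic shifts suffice to bring any position to the end.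
\<close>

lemma rotate_invariant: "expect (S i) (\<lambda>ws. f (rotate k ws)) = expect (S i) f" for f :: "nat list \<Rightarrow> real"
proof -
  have "map_pmf rotate1 (S i) = S i"
  proof (cases i)
    case (Suc j)
    have "map_pmf rotate1 (S (Suc j)) = P \<bind> (\<lambda>x. S j \<bind> (\<lambda>xs. return_pmf (xs @ [x])))"
      by (simp add: map_bind_pmf)
    also have "\<dots> = S j \<bind> (\<lambda>xs. P \<bind> (\<lambda>x. return_pmf (xs @ [x])))" by (rule bind_commute_pmf)
    also have "\<dots> = S (Suc j)" by (rule replicate_pmf_Suc_append[symmetric])
    finally show ?thesis using Suc by simp
  qed simp
  hence inv: "expect (S i) (\<lambda>ws. g (rotate1 ws)) = expect (S i) g" for g :: "nat list \<Rightarrow> real"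
    by (metis integral_map_pmf)
  show ?thesis
  proof (induction k)
    case (Suc k)
    have "expect (S i) (\<lambda>ws. f (rotate (Suc k) ws)) = expect (S i) (\<lambda>ws. f (rotate k (rotate1 ws)))"
      by (simp add: rotate1_rotate_swap)
    also have "\<dots> = expect (S i) (\<lambda>ws. f (rotate k ws))" by (rule inv[of "\<lambda>ws. f (rotate k ws)"])
    finally show ?case using Suc by simp
  qed simp
qed

lemma count_eq_sum_nth: "c ws v = (\<Sum>l<length ws. of_bool (ws ! l = v))"
proof (induction ws rule: rev_induct)
  case (snoc w ws)
  have "(\<Sum>l<length ws. of_bool ((ws @ [w]) ! l = v) :: real) = (\<Sum>l<length ws. of_bool (ws ! l = v))"
    by (intro sum.cong) (auto simp: nth_append)
  thus ?case using snoc by (simp add: nth_append)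
qed simp

text \<open>
  By rotation each of the \<open>Suc i\<close> positions contributes as much as the last one, for which the other \<open>i\<close> draws have to be
  distinct among themselves.
\<close>

lemma distinct_mean_le:
  "expect (S (Suc i)) (\<lambda>ws. c ws v * of_bool (distinct ws)) \<le> real (Suc i) * (p v * distinct_prob i)"
proof -
  define g where "g ws = (of_bool (ws ! i = v) * of_bool (distinct ws) :: real)" for ws
  have g: "expect (S (Suc i)) g \<le> p v * distinct_prob i"
  proof -
    have "expect (S (Suc i)) g \<le> expect (S i) (\<lambda>ws. p v * of_bool (distinct ws))"
      unfolding expect_S_Suc
    proof (rule expect_mono_finite[OF finite_S])
      fix ws assume ws: "ws \<in> set_pmf (S i)"
      have "expect P (\<lambda>w. g (ws @ [w])) \<le> expect P (\<lambda>w. of_bool (w = v) * of_bool (distinct ws))"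
        using S_range[OF ws] finite_K[OF ws] by (intro expect_mono_finite) (auto simp: g_def nth_append)
      thus "expect P (\<lambda>w. g (ws @ [w])) \<le> p v * of_bool (distinct ws)" by (simp add: expect_of_bool_eq)
    qed
    thus ?thesis by (simp add: distinct_prob_def)
  qed
  have "expect (S (Suc i)) (\<lambda>ws. c ws v * of_bool (distinct ws)) =
      expect (S (Suc i)) (\<lambda>ws. \<Sum>l<Suc i. g (rotate (Suc l) ws))"
  proof (rule expect_cong)
    fix ws assume "ws \<in> set_pmf (S (Suc i))"
    hence len: "length ws = Suc i" using S_range by blast
    have "rotate (Suc l) ws ! i = ws ! l" if "l < Suc i" for l
    proof -
      have "rotate (Suc l) ws ! i = ws ! ((Suc l + i) mod Suc i)"
        using nth_rotate[of i ws "Suc l"] len by simp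
      also have "(Suc l + i) mod Suc i = l" using that by (simp add: mod_if)
      finally show ?thesis .
    qed
    hence "(\<Sum>l<Suc i. g (rotate (Suc l) ws)) = (\<Sum>l<Suc i. of_bool (ws ! l = v) * of_bool (distinct ws))"
      unfolding g_def by (intro sum.cong) (simp_all only: distinct_rotate lessThan_iff)
    thus "c ws v * of_bool (distinct ws) = (\<Sum>l<Suc i. g (rotate (Suc l) ws))"
      unfolding count_eq_sum_nth len sum_distrib_right by simp
  qed
  also have "\<dots> = (\<Sum>l<Suc i. expect (S (Suc i)) (\<lambda>ws. g (rotate (Suc l) ws)))"
    by (rule expect_linear_sum[OF finite_S])
  also have "\<dots> = (\<Sum>l<Suc i. expect (S (Suc i)) g)" by (simp only: rotate_invariant)
  also have "\<dots> = real (Suc i) * expect (S (Suc i)) g" by simp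
  also have "\<dots> \<le> real (Suc i) * (p v * distinct_prob i)" using g by (intro mult_left_mono) auto
  finally show ?thesis .
qed

lemma expect_cond:
  assumes "distinct_prob i > 0"
  shows "expect (cond_pmf (S i) {ws. distinct ws}) f = expect (S i) (\<lambda>ws. f ws * of_bool (distinct ws)) / distinct_prob i"
    and "set_pmf (S i) \<inter> {ws. distinct ws} \<noteq> {}"
    and "set_pmf (cond_pmf (S i) {ws. distinct ws}) = set_pmf (S i) \<inter> {ws. distinct ws}"
proof -
  show ne: "set_pmf (S i) \<inter> {ws. distinct ws} \<noteq> {}"
  proof
    assume "set_pmf (S i) \<inter> {ws. distinct ws} = {}"
    hence "distinct_prob i = expect (S i) (\<lambda>_. 0)" unfolding distinct_prob_def by (intro expect_cong) auto
    thus False using assms by simp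
  qed
  show set: "set_pmf (cond_pmf (S i) {ws. distinct ws}) = set_pmf (S i) \<inter> {ws. distinct ws}"
    by (rule set_cond_pmf[OF ne])
  have ind: "(\<lambda>ws. of_bool (distinct ws) :: real) = indicator {ws. distinct ws}" by (auto simp: fun_eq_iff indicator_def)
  have prob: "distinct_prob i = measure_pmf.prob (S i) {ws. distinct ws}" unfolding distinct_prob_def ind by simp
  have "expect (cond_pmf (S i) {ws. distinct ws}) f =
      (\<Sum>ws\<in>set_pmf (S i). f ws * pmf (cond_pmf (S i) {ws. distinct ws}) ws)"
    using finite_S set by (intro integral_measure_pmf_real) auto
  also have "\<dots> = (\<Sum>ws\<in>set_pmf (S i). f ws * of_bool (distinct ws) * pmf (S i) ws) / distinct_prob i"
    unfolding sum_divide_distrib by (intro sum.cong) (auto simp: pmf_cond[OF ne] prob)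
  also have "(\<Sum>ws\<in>set_pmf (S i). f ws * of_bool (distinct ws) * pmf (S i) ws) = expect (S i) (\<lambda>ws. f ws * of_bool (distinct ws))"
    using finite_S by (intro integral_measure_pmf_real[symmetric]) auto
  finally show "expect (cond_pmf (S i) {ws. distinct ws}) f = expect (S i) (\<lambda>ws. f ws * of_bool (distinct ws)) / distinct_prob i" .
qed

context
  fixes m :: nat and q :: real
  assumes m: "m \<ge> 1" and p_le: "\<And>v. p v \<le> q" and q: "0 \<le> q" "(real m - 1) * q \<le> 1 / 2"
begin

abbreviation "Q \<equiv> cond_pmf (S m) {ws. distinct ws}"

lemma distinct_prob_ge: "distinct_prob m \<ge> 1 / 2 ^ m" "distinct_prob m > 0"
proof -
  show "distinct_prob m \<ge> 1 / 2 ^ m" using distinct_prob_lower[OF p_le q, of m] by simp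
  moreover have "1 / 2 ^ m > (0::real)" by simp
  ultimately show "distinct_prob m > 0" by linarith
qed

text \<open>
  This bound holds for all vertices, including those of large degree. It compares the probability that all \<open>m\<close> draws are
  distinct with the one for \<open>m - 1\<close> draws only, which keeps the factor on the right at most \<open>2\<close>, whereas dividing by the probability of
  distinctness alone would cost \<open>2 ^ m\<close>. The growth of the sum of the squared degrees is governed by this factor.
\<close>

lemma cond_mean_le: "expect Q (\<lambda>ws. c ws v) \<le> real m * p v / (1 - (real m - 1) * q)"
proof -
  obtain i where i: "m = Suc i" using m by (cases m) auto
  have r: "1 - (real m - 1) * q > 0" using q by linarith
  have "(1 - (real m - 1) * q) * distinct_prob i \<le> distinct_prob m"
    using distinct_prob_Suc[OF p_le, of i] by (simp add: i)
  hence "distinct_prob i \<le> distinct_prob m / (1 - (real m - 1) * q)" using r by (simp add: pos_le_divide_eq mult.commute)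
  hence "real m * (p v * distinct_prob i) \<le> real m * (p v * (distinct_prob m / (1 - (real m - 1) * q)))"
    by (intro mult_left_mono) auto
  hence "expect (S m) (\<lambda>ws. c ws v * of_bool (distinct ws)) \<le> real m * p v / (1 - (real m - 1) * q) * distinct_prob m"
    using distinct_mean_le[of i v] by (simp add: i)
  thus ?thesis unfolding expect_cond(1)[OF distinct_prob_ge(2)] using distinct_prob_ge(2) by (simp only: pos_divide_le_eq)
qed

lemma div_distinct_prob_le: "0 \<le> y \<Longrightarrow> y / distinct_prob m \<le> 2 ^ m * y"
proof -
  assume y: "0 \<le> y"
  have "y / distinct_prob m \<le> y / (1 / 2 ^ m)"
    using y distinct_prob_ge by (intro divide_left_mono) auto
  thus ?thesis by (simp add: mult.commute)
qed

text \<open>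
  Conditioning changes the mean \<open>m p v\<close> by the contribution of lists with repetitions to the mean, and by the
  normalisation, that is by the probability of a repetition.
\<close>

lemma cond_mean_near:
  assumes "v \<in> B"
  shows "\<bar>expect Q (\<lambda>ws. c ws v) - real m * p v\<bar> \<le> 2 ^ m * (3 * real m ^ 3 * (p v * collision + (p v)\<^sup>2))"
proof -
  define E where "E = expect (S m) (\<lambda>ws. c ws v * of_bool (\<not> distinct ws))"
  define N :: real where "N = expect (S m) (\<lambda>ws. of_bool (\<not> distinct ws))"
  have "real m * p v = expect (S m) (\<lambda>ws. c ws v * of_bool (distinct ws) + c ws v * of_bool (\<not> distinct ws))"
    unfolding iid_mean[symmetric] by (intro expect_cong) auto
  also have "\<dots> = expect (S m) (\<lambda>ws. c ws v * of_bool (distinct ws)) + E"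
    unfolding E_def using finite_S by (simp add: expect_add_finite)
  finally have 1: "expect (S m) (\<lambda>ws. c ws v * of_bool (distinct ws)) = real m * p v - E" by simp
  have "1 = expect (S m) (\<lambda>_. 1 :: real)" by simp
  also have "\<dots> = expect (S m) (\<lambda>ws. of_bool (distinct ws) + of_bool (\<not> distinct ws))"
    by (intro expect_cong) auto
  also have "\<dots> = distinct_prob m + N"
    unfolding N_def distinct_prob_def using finite_S by (intro expect_add_finite)
  finally have 2: "distinct_prob m = 1 - N" by simp
  have nz: "distinct_prob m > 0" by (rule distinct_prob_ge)
  have E0: "0 \<le> E" "0 \<le> N" unfolding E_def N_def by (intro expect_nonneg; simp)+
  have "expect Q (\<lambda>ws. c ws v) - real m * p v = (real m * p v * N - E) / distinct_prob m"
    unfolding expect_cond(1)[OF nz] 1 using nz by (simp add: field_simps) (simp add: 2 algebra_simps)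
  also have "\<bar>\<dots>\<bar> = \<bar>real m * p v * N - E\<bar> / distinct_prob m" using nz by simp
  also have "\<dots> \<le> (real m * p v * N + E) / distinct_prob m"
  proof (rule divide_right_mono)
    have "0 \<le> real m * p v * N" using E0 by simp
    thus "\<bar>real m * p v * N - E\<bar> \<le> real m * p v * N + E" using E0 by linarith
  qed (use nz in simp)
  also have "\<dots> \<le> 2 ^ m * (real m * p v * N + E)" using E0 by (intro div_distinct_prob_le) simp
  also have "\<dots> \<le> 2 ^ m * (real m * p v * ((real m)\<^sup>2 * collision) + real m * (2 * (real m)\<^sup>2 * (p v * collision + (p v)\<^sup>2)))"
    using collision_prob[of m] count_collision[OF assms, of m m]
    by (intro mult_left_mono add_mono) (auto simp: E_def N_def)
  also have "\<dots> \<le> 2 ^ m * (3 * real m ^ 3 * (p v * collision + (p v)\<^sup>2))"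
  proof (rule mult_left_mono)
    have "real m * p v * ((real m)\<^sup>2 * collision) + real m * (2 * (real m)\<^sup>2 * (p v * collision + (p v)\<^sup>2))
       = 3 * real m ^ 3 * (p v * collision + (p v)\<^sup>2) - real m ^ 3 * (p v)\<^sup>2"
      by (simp add: power2_eq_square power3_eq_cube algebra_simps)
    moreover have "0 \<le> real m ^ 3 * (p v)\<^sup>2" by simp
    ultimately show "real m * p v * ((real m)\<^sup>2 * collision) + real m * (2 * (real m)\<^sup>2 * (p v * collision + (p v)\<^sup>2))
      \<le> 3 * real m ^ 3 * (p v * collision + (p v)\<^sup>2)" by linarith
  qed simp
  finally show ?thesis .
qed

lemma cond_dup: "expect Q (\<lambda>ws. c ws v * (c ws v - 1)) = 0"
proof -
  have "expect Q (\<lambda>ws. c ws v * (c ws v - 1)) = expect Q (\<lambda>_. 0)"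
  proof (rule expect_cong)
    fix ws assume "ws \<in> set_pmf Q"
    hence "distinct ws" using expect_cond(3)[OF distinct_prob_ge(2)] by auto
    thus "c ws v * (c ws v - 1) = 0" by (simp add: distinct_count_atmost_1)
  qed
  thus ?thesis by simp
qed

lemma cond_both: "v \<noteq> x \<Longrightarrow> expect Q (\<lambda>ws. c ws v * c ws x) \<le> 2 ^ m * ((real m)\<^sup>2 * (p v * p x))"
proof -
  assume vx: "v \<noteq> x"
  have "expect (S m) (\<lambda>ws. c ws v * c ws x * of_bool (distinct ws)) \<le> expect (S m) (\<lambda>ws. c ws v * c ws x)"
    using finite_S by (intro expect_mono_finite) auto
  also have "\<dots> \<le> (real m)\<^sup>2 * (p v * p x)" by (rule iid_both[OF vx])
  finally have "expect (S m) (\<lambda>ws. c ws v * c ws x * of_bool (distinct ws)) / distinct_prob m \<le> (real m)\<^sup>2 * (p v * p x) / distinct_prob m"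
    using distinct_prob_ge(2) by (intro divide_right_mono) auto
  also have "\<dots> \<le> 2 ^ m * ((real m)\<^sup>2 * (p v * p x))" by (intro div_distinct_prob_le) simp
  finally show ?thesis unfolding expect_cond(1)[OF distinct_prob_ge(2)] .
qed

end

end

section \<open>The conditional model\<close>
lemma ratio_tendsto:
  fixes A B C D :: real
  assumes "C \<noteq> 0"
  shows "(\<lambda>n. (A * real n + B) / (C * real n + D)) \<longlonglongrightarrow> A / C"
proof -
  have "(\<lambda>n. (A + B * (1 / real n)) / (C + D * (1 / real n))) \<longlonglongrightarrow> (A + B * 0) / (C + D * 0)"
    using assms by (intro tendsto_intros lim_1_over_n) auto
  moreover have "\<forall>\<^sub>F n in sequentially. (A + B * (1 / real n)) / (C + D * (1 / real n)) = (A * real n + B) / (C * real n + D)"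
    using eventually_gt_at_top[of 0]
  proof eventually_elim
    case (elim n)
    have "(A * real n + B) / (C * real n + D) = (real n * (A + B * (1 / real n))) / (real n * (C + D * (1 / real n)))"
      using elim by (simp add: distrib_left mult.commute)
    thus ?case using elim by simp
  qed
  ultimately show ?thesis by (simp add: tendsto_cong)
qed

locale conditional_graph = pa_parameters +
  fixes H :: mgraph
  assumes H: "set_mset H \<subseteq> {1..m} \<times> {1..m}"
begin

lemma conditional_choice_cases:
  assumes "m \<le> n" "set_mset G \<subseteq> {1..n} \<times> {1..n}" "ws \<in> set_pmf (conditional_choice m \<alpha> (Suc n) G)"
  shows "length ws = m \<and> set ws \<subseteq> {1..n} \<and> distinct ws"
proof -
  have n1: "n \<ge> 1" using assms m_ge_2 by simp
  interpret appended_law m "{1..n}" "\<lambda>i. replicate_pmf i (choose_vertex \<alpha> (Suc n) (endpoints G))"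
      "\<lambda>i ws. choose_vertex \<alpha> (Suc n) (endpoints G)"
    by (intro independent_appended_law n1 assms)
  show ?thesis
  proof (cases "set_pmf (independent_choice m \<alpha> (Suc n) G) \<inter> {ws. distinct ws} \<noteq> {}")
    case True
    thus ?thesis using assms(3) S_range[of ws m] by (auto simp: conditional_choice_def independent_choice_def)
  next
    case False
    define X where "X = {ws. length ws = m \<and> distinct ws \<and> set ws \<subseteq> {1..<Suc n}}"
    have "finite X"
      by (rule finite_subset[OF _ finite_lists_length_eq[of "{1..<Suc n}" m]]) (auto simp: X_def)
    moreover have "[1..<Suc m] \<in> X" using assms(1) by (auto simp: X_def)
    ultimately have "set_pmf (pmf_of_set X) = X" by (intro set_pmf_of_set) auto
    thus ?thesis using assms(3) False by (auto simp: conditional_choice_def X_def)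
  qed
qed

sublocale growing_graph m m "conditional_choice m \<alpha>" "\<lambda>_. H"
proof
  show "length ws = m \<and> set ws \<subseteq> {1..n}" if "m \<le> n" "set_mset G \<subseteq> {1..n} \<times> {1..n}"
    "ws \<in> set_pmf (conditional_choice m \<alpha> (Suc n) G)" for n G ws
    using conditional_choice_cases[OF that] by simp
qed (use m_ge_2 H in auto)

text \<open>
  Distinct receivers increase a degree by at most one per step. As the degrees sum up to about \<open>2 m n\<close>, no vertex is drawn
  with probability much above \<open>1 / (2 m)\<close>.
\<close>

lemma deg_bound:
  assumes "m \<le> n" "G \<in> set_pmf (law n)"
  shows "\<forall>v. deg G v \<le> n + 2 * size H"
  using assms
proof (induction rule: law_induct)
  case start
  have "deg H v \<le> 2 * size H" for v
    using count_le_size[of "endpoints H" v] by (simp add: deg_def size_endpoints)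
  thus ?case by (meson le_add2 order_trans)
next
  case (grow n G ws)
  have ws: "length ws = m" "set ws \<subseteq> {1..n}" "distinct ws"
    using conditional_choice_cases[OF grow(1) graph_range[OF grow(1,2)] grow(3)] by auto
  show ?case
  proof
    fix v
    have "count (mset ws) v \<le> 1" using ws(3) by (simp add: distinct_count_atmost_1)
    moreover have "deg G v = 0 \<and> count (mset ws) v = 0" if "v = Suc n"
      using that deg_outside[OF graph_range[OF grow(1,2)], of v] ws(2) by (auto simp: count_eq_zero_iff)
    ultimately show "deg (attach (Suc n) ws G) v \<le> Suc n + 2 * size H"
      using grow(4)[rule_format, of v] grow(1) ws(1) by (cases "v = Suc n") (auto simp: deg_attach)
  qed
qed

text \<open>
  \<open>Z n\<close> is the sum of the degrees in the graph on \<open>n\<close> vertices, and \<open>q\<close> a bound for the probability of any vertex, slightly above the limiting bound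
  \<open>1 / (2 m)\<close>. The slack in \<open>q\<close> is such that \<open>g\<close>, the factor by which conditioning can increase means, stays below \<open>2\<close>,
  and \<open>\<theta>\<close> lies strictly between \<open>g\<close> and \<open>2\<close>.
\<close>

definition Z :: "nat \<Rightarrow> real" where "Z n = 2 * (real (size H) + real m * (real n - real m))"
definition q :: real where "q = 1 / (2 * real m - 1 / 2)"
definition g :: real where "g = 1 / (1 - (real m - 1) * q)"
definition \<theta> :: real where "\<theta> = (g + 2) / 2"

text \<open>
  The sum of the squared degrees controls the collision probability.
\<close>

definition squares :: "nat \<Rightarrow> mgraph \<Rightarrow> real" where
  "squares n G = (\<Sum>v\<in>{1..n}. (real (deg G v))\<^sup>2)"

definition large :: "nat \<Rightarrow> bool" where
  "large n \<longleftrightarrow> m \<le> n \<and> real n \<le> Z n \<and> 1 / real n + (real n + 2 * real (size H)) / Z n \<le> q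
     \<and> 2 * real m * g / Z n \<le> \<theta> / real n"

lemma q_facts: "0 \<le> q" "(real m - 1) * q \<le> 1 / 2" "g = (2 * real m - 1 / 2) / (real m + 1 / 2)" "0 < g" "g < 2" "1 / (2 * real m) < q"
proof -
  have m2: "real m \<ge> 2" using m_ge_2 by simp
  show "0 \<le> q" using m2 by (simp add: q_def)
  show "(real m - 1) * q \<le> 1 / 2" using m2 by (simp add: q_def divide_simps)
  show g: "g = (2 * real m - 1 / 2) / (real m + 1 / 2)" using m2 by (simp add: g_def q_def divide_simps) (simp add: algebra_simps)
  show "0 < g" "g < 2" using m2 unfolding g by (auto simp: divide_simps)
  show "1 / (2 * real m) < q" using m2 unfolding q_def by (intro divide_strict_left_mono) auto
qed

text \<open>
  Since \<open>Z n / n\<close> tends to \<open>2 m\<close>, the left-hand sides of the last two conditions, the latter multiplied by \<open>n\<close>, tend to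
  \<open>1 / (2 m) < q\<close> and \<open>g < \<theta>\<close>.
\<close>

lemma eventually_large: "\<forall>\<^sub>F n in sequentially. large n"
proof -
  have m2: "real m \<ge> 2" using m_ge_2 by simp
  have Zlin: "Z n = (2 * real m) * real n + (2 * real (size H) - 2 * real m * real m)" for n
    by (simp add: Z_def algebra_simps)
  have 1: "\<forall>\<^sub>F n in sequentially. real n \<le> Z n"
    using eventually_ge_at_top[of "2 * m"]
  proof eventually_elim
    case (elim n)
    have "2 * (real n - real m) \<le> real m * (real n - real m)" using m2 elim by (intro mult_right_mono) auto
    moreover have "real n \<ge> 2 * real m" using elim by (metis of_nat_le_iff of_nat_mult of_nat_numeral)
    ultimately show ?case by (simp add: Z_def)
  qed
  have "(\<lambda>n. 1 / real n + (1 * real n + 2 * real (size H)) / ((2 * real m) * real n + (2 * real (size H) - 2 * real m * real m)))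
      \<longlonglongrightarrow> 0 + 1 / (2 * real m)"
    using m2 by (intro tendsto_add lim_1_over_n ratio_tendsto) auto
  from order_tendstoD(2)[OF this, of q] q_facts(6)
  have 2: "\<forall>\<^sub>F n in sequentially. 1 / real n + (real n + 2 * real (size H)) / Z n \<le> q"
    unfolding Zlin by (auto elim!: eventually_mono)
  have "(\<lambda>n. (2 * real m * g * real n + 0) / ((2 * real m) * real n + (2 * real (size H) - 2 * real m * real m))) \<longlonglongrightarrow> 2 * real m * g / (2 * real m)"
    using m2 by (intro ratio_tendsto) auto
  moreover have "2 * real m * g / (2 * real m) < \<theta>" using m2 q_facts(5) by (simp add: \<theta>_def)
  ultimately have "\<forall>\<^sub>F n in sequentially. (2 * real m * g * real n + 0) / ((2 * real m) * real n + (2 * real (size H) - 2 * real m * real m)) < \<theta>"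
    by (rule order_tendstoD(2))
  hence 3: "\<forall>\<^sub>F n in sequentially. 2 * real m * g / Z n \<le> \<theta> / real n"
    using eventually_gt_at_top[of 0] unfolding Zlin
    by eventually_elim (simp add: pos_le_divide_eq)
  show ?thesis
    using 1 2 3 eventually_ge_at_top[of m] unfolding large_def by eventually_elim auto
qed

context
  fixes n G assumes n: "large n" and G: "G \<in> set_pmf (law n)"
begin

abbreviation "P \<equiv> choose_vertex \<alpha> (Suc n) (endpoints G)"

lemma mn: "m \<le> n" "n \<ge> 1" "real n > 0" "Z n > 0" "real n \<le> Z n"
  using n m_ge_2 by (auto simp: large_def)

lemma size_endpoints_Z: "real (size (endpoints G)) = Z n"
  using size_graph[OF mn(1) G] mn(1) by (simp add: size_endpoints Z_def of_nat_diff)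

lemma pmf_P: "v \<in> {1..n} \<Longrightarrow> pmf P v = \<alpha> / real n + (1 - \<alpha>) * (real (deg G v) / Z n)"
proof -
  assume v: "v \<in> {1..n}"
  have "endpoints G \<noteq> {#}" using size_endpoints_Z mn(4) by force
  thus ?thesis using v mn \<alpha> by (subst pmf_choose_vertex) (auto simp: size_endpoints_Z deg_def)
qed

lemma P_iid: "iid_law P {1..n}"
  by unfold_locales (use set_pmf_choose_vertex[OF mn(2) endpoints_range[OF graph_range[OF mn(1) G]]] in auto)

lemma P_le: "v \<in> {1..n} \<Longrightarrow> pmf P v \<le> 1 / real n + real (deg G v) / Z n"
proof -
  assume v: "v \<in> {1..n}"
  have "\<alpha> / real n \<le> 1 / real n" using \<alpha> mn by (intro divide_right_mono) auto
  moreover have "(1 - \<alpha>) * (real (deg G v) / Z n) \<le> 1 * (real (deg G v) / Z n)"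
    using \<alpha> mn by (intro mult_right_mono) auto
  ultimately show ?thesis unfolding pmf_P[OF v] by linarith
qed

lemma P_le_q: "pmf P v \<le> q"
proof (cases "v \<in> {1..n}")
  case True
  have "real (deg G v) \<le> real n + 2 * real (size H)"
    using deg_bound[OF mn(1) G] by (metis of_nat_add of_nat_le_iff of_nat_mult of_nat_numeral)
  hence "real (deg G v) / Z n \<le> (real n + 2 * real (size H)) / Z n" using mn by (intro divide_right_mono) auto
  thus ?thesis using P_le[OF True] n by (auto simp: large_def)
next
  case False
  hence "pmf P v = 0" using iid_law.P_range[OF P_iid] by (auto simp: set_pmf_iff)
  thus ?thesis using q_facts(1) by simp
qed

text \<open>
  In a large graph distinct receivers have positive probability, so the definition of the choice conditions on them.
\<close>

lemma choice_eq: "conditional_choice m \<alpha> (Suc n) G = cond_pmf (replicate_pmf m P) {ws. distinct ws}"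
proof -
  interpret iid_law P "{1..n}" by (rule P_iid)
  have "m \<ge> 1" using m_ge_2 by simp
  note ne = expect_cond(2)[OF distinct_prob_ge(2)[OF this P_le_q q_facts(1,2)]]
  show ?thesis using ne by (simp add: conditional_choice_def independent_choice_def)
qed

lemma sum_deg: "(\<Sum>v\<in>{1..n}. real (deg G v)) = Z n"
  using sum_mset_eq_sum_count[of "{1..n}" "endpoints G" "\<lambda>_. 1"] endpoints_range[OF graph_range[OF mn(1) G]]
  by (simp add: deg_def size_endpoints_Z)

lemma collision_le: "iid_law.collision P {1..n} \<le> 2 * (1 / real n + squares n G / (real n)\<^sup>2)"
proof -
  have "iid_law.collision P {1..n} = (\<Sum>v\<in>{1..n}. (pmf P v)\<^sup>2)"
    by (rule iid_law.collision_def[OF P_iid])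
  also have "\<dots> \<le> (\<Sum>v\<in>{1..n}. 2 * (1 / (real n)\<^sup>2 + (real (deg G v))\<^sup>2 / (real n)\<^sup>2))"
  proof (rule sum_mono)
    fix v assume v: "v \<in> {1..n}"
    have "real (deg G v) / Z n \<le> real (deg G v) / real n" using mn by (intro divide_left_mono) auto
    hence "pmf P v \<le> 1 / real n + real (deg G v) / real n" using P_le[OF v] by linarith
    hence "(pmf P v)\<^sup>2 \<le> (1 / real n + real (deg G v) / real n)\<^sup>2" by (intro power_mono) auto
    also have "\<dots> \<le> 2 * ((1 / real n)\<^sup>2 + (real (deg G v) / real n)\<^sup>2)"
      using sum_squares_bound[of "1 / real n" "real (deg G v) / real n"] by (simp add: power2_sum)
    finally show "(pmf P v)\<^sup>2 \<le> 2 * (1 / (real n)\<^sup>2 + (real (deg G v))\<^sup>2 / (real n)\<^sup>2)" by (simp add: power_divide)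
  qed
  also have "\<dots> = 2 * (real n * (1 / (real n)\<^sup>2) + squares n G / (real n)\<^sup>2)"
    unfolding squares_def sum_distrib_left[symmetric] sum.distrib sum_divide_distrib[symmetric] by simp
  also have "real n * (1 / (real n)\<^sup>2) = 1 / real n" using mn by (simp add: power2_eq_square)
  finally show ?thesis .
qed

text \<open>
  A vertex of degree \<open>d\<close> that receives an edge adds \<open>2 d + 1\<close> to the sum, and its probability to do so is at most \<open>g m\<close> times
  the probability of a single unconditioned draw, which is at most about \<open>d / (2 m n)\<close>. So the expected increase is at most about \<open>g / n\<close> times the sum.
\<close>

lemma squares_step:
  "expect (conditional_choice m \<alpha> (Suc n) G) (\<lambda>ws. squares (Suc n) (attach (Suc n) ws G))
     \<le> (1 + \<theta> / real n) * squares n G + (2 * (4 * real m * (real (size H) + real m) + 2 * real m) + (real m)\<^sup>2)"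
proof -
  interpret iid_law P "{1..n}" by (rule P_iid)
  have m1: "m \<ge> 1" using m_ge_2 by simp
  note D = m1 P_le_q q_facts(1,2)
  let ?Q = "conditional_choice m \<alpha> (Suc n) G"
  let ?s = "\<lambda>v. 2 * real (deg G v) + 1"
  note fin = finite_choice[OF mn(1) G]
  have "expect ?Q (\<lambda>ws. squares (Suc n) (attach (Suc n) ws G)) =
      expect ?Q (\<lambda>ws. squares n G + (\<Sum>v\<in>{1..n}. ?s v * c ws v) + (real m)\<^sup>2)"
  proof (rule expect_cong)
    fix ws assume "ws \<in> set_pmf ?Q"
    hence ws: "length ws = m" "set ws \<subseteq> {1..n}" "distinct ws"
      using conditional_choice_cases[OF mn(1) graph_range[OF mn(1) G]] by auto
    have new: "deg (attach (Suc n) ws G) (Suc n) = m"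
      using ws deg_outside[OF graph_range[OF mn(1) G], of "Suc n"] by (auto simp: deg_attach count_eq_zero_iff)
    have "(real (deg (attach (Suc n) ws G) v))\<^sup>2 = (real (deg G v))\<^sup>2 + ?s v * c ws v" if "v \<in> {1..n}" for v
    proof -
      have "deg (attach (Suc n) ws G) v = deg G v + count (mset ws) v" using that by (simp add: deg_attach)
      moreover have "count (mset ws) v = 0 \<or> count (mset ws) v = 1" using ws(3) by (simp add: distinct_count_atmost_1)
      ultimately show ?thesis by (auto simp: power2_eq_square algebra_simps)
    qed
    thus "squares (Suc n) (attach (Suc n) ws G) = squares n G + (\<Sum>v\<in>{1..n}. ?s v * c ws v) + (real m)\<^sup>2"
      unfolding squares_def using new by (simp add: sum.distrib[symmetric])
  qed
  also have "\<dots> = squares n G + (\<Sum>v\<in>{1..n}. ?s v * expect ?Q (\<lambda>ws. c ws v)) + (real m)\<^sup>2"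
    using fin by (simp add: expect_add_finite expect_linear_sum)
  also have "(\<Sum>v\<in>{1..n}. ?s v * expect ?Q (\<lambda>ws. c ws v)) \<le>
      (\<Sum>v\<in>{1..n}. ?s v * (g * (real m / real n + real m * (real (deg G v) / Z n))))"
  proof (rule sum_mono)
    fix v assume v: "v \<in> {1..n}"
    have "expect ?Q (\<lambda>ws. c ws v) \<le> real m * pmf P v / (1 - (real m - 1) * q)"
      unfolding choice_eq by (rule cond_mean_le[OF D])
    also have "\<dots> = g * (real m * pmf P v)" by (simp add: g_def)
    also have "\<dots> \<le> g * (real m * (1 / real n + real (deg G v) / Z n))"
      using q_facts(4) by (intro mult_left_mono P_le[OF v]) auto
    also have "\<dots> = g * (real m / real n + real m * (real (deg G v) / Z n))" by (simp add: distrib_left)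
    finally show "?s v * expect ?Q (\<lambda>ws. c ws v) \<le> ?s v * (g * (real m / real n + real m * (real (deg G v) / Z n)))"
      by (intro mult_left_mono) auto
  qed
  also have "\<dots> = g * (real m / real n * (2 * Z n + real n) + real m / Z n * (2 * squares n G + Z n))"
  proof -
    have eq: "?s v * (g * (real m / real n + real m * (real (deg G v) / Z n))) =
        g * (real m / real n) * (2 * real (deg G v) + 1) + g * (real m / Z n) * (2 * (real (deg G v))\<^sup>2 + real (deg G v))" for v
      by (simp add: algebra_simps power2_eq_square add_divide_distrib)
    have "(\<Sum>v\<in>{1..n}. ?s v * (g * (real m / real n + real m * (real (deg G v) / Z n)))) =
        g * (real m / real n) * (2 * (\<Sum>v\<in>{1..n}. real (deg G v)) + real n)
        + g * (real m / Z n) * (2 * squares n G + (\<Sum>v\<in>{1..n}. real (deg G v)))"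
      unfolding eq sum.distrib sum_distrib_left[symmetric] squares_def by simp
    thus ?thesis unfolding sum_deg by (simp add: distrib_left)
  qed
  also have "\<dots> = g * (2 * real m * (Z n / real n) + 2 * real m) + 2 * real m * g / Z n * squares n G"
    using mn by (simp add: field_simps)
  also have "\<dots> \<le> 2 * (4 * real m * (real (size H) + real m) + 2 * real m) + \<theta> / real n * squares n G"
  proof (rule add_mono)
    have "Z n \<le> 2 * (real (size H) + real m) * real n"
    proof -
      have "real (size H) * 1 \<le> real (size H) * real n" using mn(2) by (intro mult_left_mono) auto
      moreover have "real m * (real n - real m) \<le> real m * real n" by (intro mult_left_mono) auto
      ultimately show ?thesis unfolding Z_def by (simp add: distrib_right)
    qed
    hence "Z n / real n \<le> 2 * (real (size H) + real m)" using mn by (simp add: pos_divide_le_eq)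
    hence "2 * real m * (Z n / real n) \<le> 2 * real m * (2 * (real (size H) + real m))" by (intro mult_left_mono) auto
    hence "2 * real m * (Z n / real n) + 2 * real m \<le> 4 * real m * (real (size H) + real m) + 2 * real m" by (simp add: mult_ac)
    thus "g * (2 * real m * (Z n / real n) + 2 * real m) \<le> 2 * (4 * real m * (real (size H) + real m) + 2 * real m)"
      using q_facts(4,5) mn by (intro mult_mono) auto
    show "2 * real m * g / Z n * squares n G \<le> \<theta> / real n * squares n G"
      using n by (intro mult_right_mono) (auto simp: large_def squares_def intro!: sum_nonneg)
  qed
  finally show ?thesis by (simp add: distrib_right)
qed

end

lemma squares_nonneg: "0 \<le> squares n G"
  unfolding squares_def by (intro sum_nonneg) auto

text \<open>
  Hence the expected collision probability tends to \<open>0\<close>.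
\<close>

lemma squares_subquadratic: "(\<lambda>n. expect (law n) (squares n) / (real n)\<^sup>2) \<longlonglongrightarrow> 0"
proof (rule subquadratic_growth)
  let ?C = "2 * (4 * real m * (real (size H) + real m) + 2 * real m) + (real m)\<^sup>2"
  show "0 \<le> expect (law n) (squares n)" for n by (intro expect_nonneg squares_nonneg)
  show "0 \<le> \<theta>" "\<theta> < 2" using q_facts by (auto simp: \<theta>_def)
  show "\<forall>\<^sub>F n in sequentially. expect (law (Suc n)) (squares (Suc n)) \<le> (1 + \<theta> / real n) * expect (law n) (squares n) + ?C"
    using eventually_large
  proof eventually_elim
    case (elim n)
    have mn: "m \<le> n" using elim by (simp add: large_def)
    have "expect (law (Suc n)) (squares (Suc n)) \<le> expect (law n) (\<lambda>G. (1 + \<theta> / real n) * squares n G + ?C)"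
      unfolding expect_law_Suc[OF mn] by (intro expect_mono_finite finite_law mn squares_step elim)
    also have "\<dots> = (1 + \<theta> / real n) * expect (law n) (squares n) + ?C"
      using finite_law[OF mn] by (simp add: expect_add_finite)
    finally show ?case .
  qed
qed

definition err_constant :: "nat \<Rightarrow> real" where
  "err_constant d = real d * ((real m)\<^sup>2 + real (size H)) + 2 ^ m * (10 * real m ^ 3 * (1 + real d)\<^sup>2)"

text \<open>
  Of the order of the collision probability; the summand \<open>1 / n\<close> covers the errors of the unconditioned probabilities.
\<close>

definition err :: "nat \<Rightarrow> nat \<Rightarrow> mgraph \<Rightarrow> real" where
  "err d n G = err_constant d * (1 / real n + squares n G / (real n)\<^sup>2)"

lemma err_constant_nonneg: "0 \<le> err_constant d"
  by (simp add: err_constant_def)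

text \<open>
  For vertices of bounded degree the conditioned mean is close to \<open>m\<close> times the unconditioned probability, which is close to
  \<open>rate (deg G v) / n\<close> because \<open>Z n - 2 m n\<close> is constant.
\<close>

lemma conditional_at_rate:
  assumes n: "large n" and G: "G \<in> set_pmf (law n)"
  shows "attaches_at_rate rate n G d (err d n G) (conditional_choice m \<alpha> (Suc n) G)"
proof -
  let ?P = "choose_vertex \<alpha> (Suc n) (endpoints G)"
  interpret iid_law ?P "{1..n}" by (rule P_iid[OF n G])
  have m1: "m \<ge> 1" using m_ge_2 by simp
  note mn = mn[OF n G]
  note D = m1 P_le_q[OF n G] q_facts(1,2)
  define X where "X = 1 / real n + squares n G / (real n)\<^sup>2"
  have X: "1 / real n \<le> X" "0 \<le> X" using mn squares_nonneg by (auto simp: X_def)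
  have p_le: "pmf ?P v \<le> (1 + real d) / real n" if "v \<in> {1..n}" "deg G v \<le> d" for v
  proof -
    have "real (deg G v) / Z n \<le> real d / real n" using that mn by (intro frac_le) auto
    thus ?thesis using P_le[OF n G that(1)] by (simp add: add_divide_distrib)
  qed
  have const: "2 ^ m * (10 * real m ^ 3 * (1 + real d)\<^sup>2) * X / real n \<le> err d n G / real n"
  proof (rule divide_right_mono)
    have "2 ^ m * (10 * real m ^ 3 * (1 + real d)\<^sup>2) \<le> err_constant d" by (simp add: err_constant_def)
    thus "2 ^ m * (10 * real m ^ 3 * (1 + real d)\<^sup>2) * X \<le> err d n G"
      unfolding err_def X_def[symmetric] using X by (intro mult_right_mono) auto
  qed simp
  have err0: "0 \<le> err d n G" using err_constant_nonneg X by (simp add: err_def X_def[symmetric])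
  show ?thesis
    unfolding attaches_at_rate_def
  proof (intro ballI impI conjI)
    fix v assume v: "v \<in> {1..n}" "deg G v \<le> d"
    show "expect (conditional_choice m \<alpha> (Suc n) G) (\<lambda>ws. c ws v * (c ws v - 1)) \<le> err d n G / real n"
      unfolding choice_eq[OF n G] cond_dup[OF D] using err0 by simp
    have near1: "\<bar>expect (conditional_choice m \<alpha> (Suc n) G) (\<lambda>ws. c ws v) - real m * pmf ?P v\<bar>
        \<le> 2 ^ m * (10 * real m ^ 3 * (1 + real d)\<^sup>2) * X / real n"
    proof -
      have "\<bar>expect (conditional_choice m \<alpha> (Suc n) G) (\<lambda>ws. c ws v) - real m * pmf ?P v\<bar>
          \<le> 2 ^ m * (3 * real m ^ 3 * (pmf ?P v * collision + (pmf ?P v)\<^sup>2))"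
        unfolding choice_eq[OF n G] by (rule cond_mean_near[OF D v(1)])
      also have "\<dots> \<le> 2 ^ m * (3 * real m ^ 3 * ((1 + real d)\<^sup>2 * (3 * X) / real n))"
      proof (intro mult_left_mono)
        have k: "1 + real d \<le> (1 + real d)\<^sup>2" by (simp add: power2_eq_square algebra_simps)
        have coll: "collision \<le> 2 * X" using collision_le[OF n G] by (simp add: X_def)
        have "pmf ?P v * collision \<le> (1 + real d) / real n * (2 * X)"
          using p_le[OF v] coll collision_nonneg by (intro mult_mono) auto
        also have "\<dots> \<le> (1 + real d)\<^sup>2 / real n * (2 * X)"
          using k X mn by (intro mult_right_mono divide_right_mono) auto
        finally have 1: "pmf ?P v * collision \<le> (1 + real d)\<^sup>2 / real n * (2 * X)" .
        have "(pmf ?P v)\<^sup>2 \<le> ((1 + real d) / real n)\<^sup>2" using p_le[OF v] by (intro power_mono) auto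
        also have "\<dots> = (1 + real d)\<^sup>2 / real n * (1 / real n)" by (simp add: power_divide power2_eq_square)
        also have "\<dots> \<le> (1 + real d)\<^sup>2 / real n * X" using X by (intro mult_left_mono) auto
        finally have "pmf ?P v * collision + (pmf ?P v)\<^sup>2 \<le> (1 + real d)\<^sup>2 / real n * (2 * X) + (1 + real d)\<^sup>2 / real n * X"
          using 1 by linarith
        thus "pmf ?P v * collision + (pmf ?P v)\<^sup>2 \<le> (1 + real d)\<^sup>2 * (3 * X) / real n" by (simp add: algebra_simps)
      qed auto
      also have "\<dots> = 2 ^ m * (9 * real m ^ 3 * (1 + real d)\<^sup>2) * X / real n" by simp
      also have "\<dots> \<le> 2 ^ m * (10 * real m ^ 3 * (1 + real d)\<^sup>2) * X / real n"
        using X by (intro divide_right_mono mult_right_mono mult_left_mono) auto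
      finally show ?thesis .
    qed
    have near2: "\<bar>real m * pmf ?P v - rate (deg G v) / real n\<bar> \<le> real d * ((real m)\<^sup>2 + real (size H)) * X / real n"
    proof -
      define k where "k = (1 - \<alpha>) * real (deg G v)"
      have k: "0 \<le> k" "k \<le> real d" using \<alpha> v mult_mono[of "1 - \<alpha>" 1 "real (deg G v)" "real d"] by (auto simp: k_def)
      have "real m * pmf ?P v - rate (deg G v) / real n = k * (real m / Z n - 1 / (2 * real n))"
        unfolding pmf_P[OF n G v(1)] rate_eq k_def by (simp add: algebra_simps add_divide_distrib diff_divide_distrib)
      also have "real m / Z n - 1 / (2 * real n) = ((real m)\<^sup>2 - real (size H)) / (Z n * real n)"
      proof -
        have "real m / Z n - 1 / (2 * real n) = (2 * real m * real n - Z n) / (Z n * (2 * real n))"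
          using mn by (subst diff_frac_eq) auto
        also have "2 * real m * real n - Z n = 2 * ((real m)\<^sup>2 - real (size H))" by (simp add: Z_def power2_eq_square algebra_simps)
        also have "2 * A / (z * (2 * y)) = A / (z * y)" for A z y :: real by simp
        finally show ?thesis .
      qed
      also have "\<bar>k * (((real m)\<^sup>2 - real (size H)) / (Z n * real n))\<bar> = k * (\<bar>(real m)\<^sup>2 - real (size H)\<bar> / (Z n * real n))"
        using k mn by (simp add: abs_mult)
      also have "\<dots> \<le> real d * (((real m)\<^sup>2 + real (size H)) / (real n * real n))"
      proof -
        have "\<bar>(real m)\<^sup>2 - real (size H)\<bar> \<le> (real m)\<^sup>2 + real (size H)"
          using zero_le_power2[of "real m"] of_nat_0_le_iff[of "size H"] by linarith
        thus ?thesis using k mn by (intro mult_mono frac_le mult_right_mono) auto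
      qed
      also have "\<dots> = real d * ((real m)\<^sup>2 + real (size H)) * (1 / real n) / real n" by simp
      also have "\<dots> \<le> real d * ((real m)\<^sup>2 + real (size H)) * X / real n"
        using X by (intro divide_right_mono mult_left_mono) auto
      finally show ?thesis .
    qed
    have "err d n G / real n = real d * ((real m)\<^sup>2 + real (size H)) * X / real n + 2 ^ m * (10 * real m ^ 3 * (1 + real d)\<^sup>2) * X / real n"
      unfolding err_def X_def[symmetric] err_constant_def by (simp add: add_divide_distrib distrib_right)
    thus "\<bar>expect (conditional_choice m \<alpha> (Suc n) G) (\<lambda>ws. c ws v) - rate (deg G v) / real n\<bar> \<le> err d n G / real n"
      using near1 near2 by linarith
    fix w assume w: "w \<in> {1..n}" "deg G w \<le> d" "w \<noteq> v"
    have "expect (conditional_choice m \<alpha> (Suc n) G) (\<lambda>ws. c ws v * c ws w) \<le> 2 ^ m * ((real m)\<^sup>2 * (pmf ?P v * pmf ?P w))"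
      unfolding choice_eq[OF n G] by (rule cond_both[OF D]) (use w in simp)
    also have "\<dots> \<le> 2 ^ m * (real m ^ 3 * ((1 + real d) / real n * ((1 + real d) / real n)))"
      using m1 p_le[OF v] p_le[OF w(1,2)] by (intro mult_left_mono mult_mono power_increasing) auto
    also have "\<dots> = 2 ^ m * (1 * real m ^ 3 * (1 + real d)\<^sup>2) * (1 / real n) / real n" by (simp add: power2_eq_square)
    also have "\<dots> \<le> 2 ^ m * (10 * real m ^ 3 * (1 + real d)\<^sup>2) * X / real n"
      using X by (intro divide_right_mono mult_mono mult_left_mono mult_right_mono) auto
    also note const
    finally show "expect (conditional_choice m \<alpha> (Suc n) G) (\<lambda>ws. c ws v * c ws w) \<le> err d n G / real n" .
  qed
qed

lemma conditional_rate_driven: "rate_driven_graph m a \<beta> m (conditional_choice m \<alpha>) (\<lambda>_. H) err"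
proof (intro rate_driven_graph.intro rate_driven_graph_axioms.intro)
  show "limit_law m a \<beta>" by unfold_locales
  show "growing_graph m m (conditional_choice m \<alpha>) (\<lambda>_. H)" by unfold_locales
  show "0 \<le> err d n G" for d n G using err_constant_nonneg squares_nonneg by (simp add: err_def)
  show "(\<lambda>n. expect (law n) (err d n)) \<longlonglongrightarrow> 0" for d
  proof (rule Lim_transform_eventually)
    have "(\<lambda>n. err_constant d * (1 / real n + expect (law n) (squares n) / (real n)\<^sup>2)) \<longlonglongrightarrow> err_constant d * (0 + 0)"
      by (intro tendsto_mult tendsto_add tendsto_const lim_1_over_n squares_subquadratic)
    thus "(\<lambda>n. err_constant d * (1 / real n + expect (law n) (squares n) / (real n)\<^sup>2)) \<longlonglongrightarrow> 0" by simp
    show "\<forall>\<^sub>F n in sequentially. err_constant d * (1 / real n + expect (law n) (squares n) / (real n)\<^sup>2) = expect (law n) (err d n)"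
      using eventually_ge_at_top[of m]
      by eventually_elim (simp add: err_def[abs_def] expect_add_finite finite_law)
  qed
  show "\<forall>\<^sub>F n in sequentially. \<forall>G\<in>set_pmf (law n). attaches_at_rate rate n G d (err d n G) (conditional_choice m \<alpha> (Suc n) G)" for d
    using eventually_large by eventually_elim (blast intro: conditional_at_rate)
qed

end

section \<open>Convergence of the degree pair and tails of the limit\<close>

context pa_parameters
begin

definition limit_pmf :: "(nat \<times> nat) pmf" where
  "limit_pmf = map_pmf (\<lambda>(j, k). (m + j, m + 1 + k)) pair_pmf_excess"

lemma pmf_limit_pmf: "pmf limit_pmf (m + j, m + 1 + k) = joint j k"
proof -
  have "inj (\<lambda>(j, k). (m + j, m + 1 + k))" by (auto simp: inj_def)
  from pmf_map_inj'[OF this, of pair_pmf_excess "(j, k)"] show ?thesis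
    by (simp add: limit_pmf_def pmf_pair_excess)
qed

lemma set_limit_pmf: "set_pmf limit_pmf \<subseteq> {m..} \<times> {m + 1..}"
  by (auto simp: limit_pmf_def)

lemma pmf_limit_eq_edge_density: "pmf limit_pmf (d, d') = edge_density d d' / real m"
proof (cases "d < m \<or> d' < m + 1")
  case True
  hence "(d, d') \<notin> set_pmf limit_pmf" using set_limit_pmf by auto
  thus ?thesis using True by (auto simp: edge_density_def set_pmf_iff)
next
  case False
  thus ?thesis using pmf_limit_pmf[of "d - m" "d' - m - 1"] m_ge_2 by (simp add: edge_density_def)
qed

lemma degree_pair_converges:
  assumes "valid_version m V"
  shows "converges_in_distribution (degree_pair m \<alpha> V) limit_pmf"
proof (rule converges_in_distribution_if_pmf)
  fix x :: "nat \<times> nat"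
  have main: "(\<lambda>n. pmf (degree_pair m \<alpha> V n) x) \<longlonglongrightarrow> pmf limit_pmf x"
    if "rate_driven_graph m a \<beta> s choice init err" "\<And>n. degree_pair m \<alpha> V n = growing_graph.pair_law s choice init n"
    for s choice init err
    using rate_driven_graph.pair_law_limit[OF that(1), of "fst x" "snd x"] pmf_limit_eq_edge_density[of "fst x" "snd x"]
    by (simp add: that(2))
  show "(\<lambda>n. pmf (degree_pair m \<alpha> V n) x) \<longlonglongrightarrow> pmf limit_pmf x"
  proof (cases V)
    case Independent
    interpret rate_driven_graph m a \<beta> 2 "independent_choice m \<alpha>" "first_graphs m" "\<lambda>d n _. near_constant m d / real n"
      by (rule independent_rate_driven)
    show ?thesis by (rule main[OF independent_rate_driven]) (simp add: Independent degree_pair_def pair_law_def)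
  next
    case (Conditional H)
    interpret conditional_graph m \<alpha> \<beta> a H
      by unfold_locales (use assms Conditional in simp)
    show ?thesis by (rule main[OF conditional_rate_driven]) (simp add: Conditional degree_pair_def pair_law_def)
  next
    case Sequential
    interpret rate_driven_graph m a \<beta> 2 "\<lambda>k G. sequential_choice m \<alpha> k G m" "first_graphs m" "\<lambda>d n _. near_constant m d / real n"
      by (rule sequential_rate_driven)
    show ?thesis by (rule main[OF sequential_rate_driven]) (simp add: Sequential degree_pair_def pair_law_def)
  qed
qed

lemma prob_limit_pmf:
  "measure_pmf.prob limit_pmf {(d, d'). d' = m + 1 + k \<and> d = m + j} = joint j k"
proof -
  have "{(d, d'). d' = m + 1 + k \<and> d = m + j} = {(m + j, m + 1 + k)}" by auto
  thus ?thesis by (simp only: measure_pmf_single pmf_limit_pmf)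
qed

end

theorem lemma5p3:
  fixes m :: nat and \<alpha> u \<psi> a :: real
  assumes "m \<ge> 2" and "0 \<le> \<alpha>" and "\<alpha> < 1"
    and "u = \<alpha> / (1 - \<alpha>)" and "\<psi> = 1 / (1 + 2 * u)" and "a = real m + 2 * real m * u"
  shows "\<exists>L :: (nat \<times> nat) pmf.
    set_pmf L \<subseteq> {m..} \<times> {m + 1..} \<and>
    (\<forall>j k. measure_pmf.prob L {(d, d'). d' = m + 1 + k \<and> d = m + j} =
       (\<psi> + 1) / \<psi>\<^sup>2 *
       (Gamma (real k + a + 1) / (fact k * Gamma (a + 1))) *
       (Gamma (real j + a) / (fact j * Gamma a)) *
       integral {0..1} (\<lambda>v. (1 - v) ^ k * v powr (a + 1 / \<psi>) *
         integral {v..1} (\<lambda>w. (1 - w) ^ j * w powr a))) \<and>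
    (\<forall>V. valid_version m V \<longrightarrow> converges_in_distribution (degree_pair m \<alpha> V) L) \<and>
    (\<exists>C :: nat \<Rightarrow> real. \<forall>j. \<exists>\<epsilon> :: nat \<Rightarrow> real. \<epsilon> \<in> O(\<lambda>k. 1 / real k) \<and>
       (\<forall>\<^sub>F k in sequentially.
          \<P>((d, d') in measure_pmf L. d' = m + 1 + k \<bar> d = m + j) =
            C j * real k powr (- 1 - 1 / \<psi>) * (1 + \<epsilon> k))) \<and>
    (\<exists>C' :: nat \<Rightarrow> real. \<forall>k. \<exists>\<epsilon> :: nat \<Rightarrow> real. \<epsilon> \<in> O(\<lambda>j. 1 / real j) \<and>
       (\<forall>\<^sub>F j in sequentially.
          \<P>((d, d') in measure_pmf L. d = m + j \<bar> d' = m + 1 + k) =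
            C' k * real j powr (- a - 3 - 1 / \<psi>) * (1 + \<epsilon> j)))"
proof -
  define \<beta> where "\<beta> = (1 + \<alpha>) / (1 - \<alpha>)"
  have u: "1 + 2 * u = \<beta>" using assms(3) by (simp add: assms(4) \<beta>_def field_simps)
  have \<beta>: "\<beta> \<noteq> 0" using assms(2,3) by (simp add: \<beta>_def)
  have \<psi>: "1 / \<psi> = \<beta>" by (simp add: assms(5) u)
  have K: "(\<psi> + 1) / \<psi>\<^sup>2 = \<beta> * (\<beta> + 1)"
    unfolding assms(5) u using \<beta> by (simp add: divide_simps power2_eq_square)
  have a: "a = real m * \<beta>" by (simp add: assms(6) u[symmetric] algebra_simps)
  interpret pa_parameters m \<alpha> \<beta> a
    by unfold_locales (use assms(1-3) a in \<open>auto simp: \<beta>_def\<close>)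
  have formula: "joint j k = (\<psi> + 1) / \<psi>\<^sup>2 *
       (Gamma (real k + a + 1) / (fact k * Gamma (a + 1))) *
       (Gamma (real j + a) / (fact j * Gamma a)) *
       integral {0..1} (\<lambda>v. (1 - v) ^ k * v powr (a + 1 / \<psi>) *
         integral {v..1} (\<lambda>w. (1 - w) ^ j * w powr a))" for j k
    unfolding K \<psi> joint_def negbin_coeff_def double_beta_def upper_beta_def by (simp add: add.assoc)
  have set1: "{x \<in> space (measure_pmf limit_pmf). (case x of (d, d') \<Rightarrow> d' = m + 1 + k) \<and> (case x of (d, d') \<Rightarrow> d = m + j)}
      = {(d, d'). d' = m + 1 + k \<and> d = m + j}" for j k by auto
  have set2: "{x \<in> space (measure_pmf limit_pmf). (case x of (d, d') \<Rightarrow> d = m + j) \<and> (case x of (d, d') \<Rightarrow> d' = m + 1 + k)}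
      = {(d, d'). d' = m + 1 + k \<and> d = m + j}" for j k by auto
  have tail_snd: "\<exists>C. \<forall>j. \<exists>\<epsilon> :: nat \<Rightarrow> real. \<epsilon> \<in> O(\<lambda>k. 1 / real k) \<and>
       (\<forall>\<^sub>F k in sequentially.
          \<P>((d, d') in measure_pmf limit_pmf. d' = m + 1 + k \<bar> d = m + j) =
            C j * real k powr (- 1 - \<beta>) * (1 + \<epsilon> k))"
  proof (intro choice allI)
    fix j
    obtain C \<epsilon> where C: "\<epsilon> \<in> O(\<lambda>k. 1 / real k)"
        "\<forall>\<^sub>F k in sequentially. joint j k = C * real k powr (- 1 - \<beta>) * (1 + \<epsilon> k)"
      using joint_asymptotic_snd by blast
    define M where "M = measure_pmf.prob limit_pmf {x \<in> space (measure_pmf limit_pmf). case x of (d, d') \<Rightarrow> d = m + j}"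
    have "\<forall>\<^sub>F k in sequentially. \<P>((d, d') in measure_pmf limit_pmf. d' = m + 1 + k \<bar> d = m + j) =
            C / M * real k powr (- 1 - \<beta>) * (1 + \<epsilon> k)"
      using C(2) by eventually_elim (unfold cond_prob_def set1 prob_limit_pmf M_def[symmetric], simp)
    with C(1) show "\<exists>C. \<exists>\<epsilon> :: nat \<Rightarrow> real. \<epsilon> \<in> O(\<lambda>k. 1 / real k) \<and>
       (\<forall>\<^sub>F k in sequentially.
          \<P>((d, d') in measure_pmf limit_pmf. d' = m + 1 + k \<bar> d = m + j) = C * real k powr (- 1 - \<beta>) * (1 + \<epsilon> k))"
      by blast
  qed
  have tail_fst: "\<exists>C. \<forall>k. \<exists>\<epsilon> :: nat \<Rightarrow> real. \<epsilon> \<in> O(\<lambda>j. 1 / real j) \<and>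
       (\<forall>\<^sub>F j in sequentially.
          \<P>((d, d') in measure_pmf limit_pmf. d = m + j \<bar> d' = m + 1 + k) =
            C k * real j powr (- a - 3 - \<beta>) * (1 + \<epsilon> j))"
  proof (intro choice allI)
    fix k
    obtain C \<epsilon> where C: "\<epsilon> \<in> O(\<lambda>j. 1 / real j)"
        "\<forall>\<^sub>F j in sequentially. joint j k = C * real j powr (- a - 3 - \<beta>) * (1 + \<epsilon> j)"
      using joint_asymptotic_fst by blast
    define M where "M = measure_pmf.prob limit_pmf {x \<in> space (measure_pmf limit_pmf). case x of (d, d') \<Rightarrow> d' = m + 1 + k}"
    have "\<forall>\<^sub>F j in sequentially. \<P>((d, d') in measure_pmf limit_pmf. d = m + j \<bar> d' = m + 1 + k) =
            C / M * real j powr (- a - 3 - \<beta>) * (1 + \<epsilon> j)"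
      using C(2) by eventually_elim (unfold cond_prob_def set2 prob_limit_pmf M_def[symmetric], simp)
    with C(1) show "\<exists>C. \<exists>\<epsilon> :: nat \<Rightarrow> real. \<epsilon> \<in> O(\<lambda>j. 1 / real j) \<and>
       (\<forall>\<^sub>F j in sequentially.
          \<P>((d, d') in measure_pmf limit_pmf. d = m + j \<bar> d' = m + 1 + k) = C * real j powr (- a - 3 - \<beta>) * (1 + \<epsilon> j))"
      by blast
  qed
  show ?thesis
    unfolding \<psi>
    by (intro exI[of _ limit_pmf] conjI set_limit_pmf allI impI degree_pair_converges
        formula[unfolded \<psi>, folded prob_limit_pmf] tail_snd tail_fst)
qed

end
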